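(* Let $n \geq 2$ and $m \geq 3$ be integers. If $n \neq 8$ and $n$ is not of the form $6p+3$ or $6p+4$ for a nonnegative integer $p$, then $$\theta(K_n \Box P_m) = \left\lfloor \frac{n+9}{6} \right\rfloor .$$ (No claim is made when $n = 8$ or $n \in \{6p+3, 6p+4\}$.)
   Context: All graphs are finite and simple. $K_n$ is the complete graph on $n$ vertices and $P_m$ is the path on $m$ vertices. The Cartesian product $G \Box H$ of graphs $G$ and $H$ has vertex set $V(G)\times V(H)$, and $(u_1,v_1)$ is adjacent to $(u_2,v_2)$ iff either $u_1u_2 \in E(G)$ and $v_1=v_2$, or $v_1v_2\in E(H)$ and $u_1=u_2$. The thickness $\theta(G)$ of a graph $G$ is the minimum number $k$ such that $G$ has spanning subgraphs $G_1,\dots,G_k$, each planar, whose edge sets are pairwise disjoint and have union $E(G)$. *)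

theory Defs
  imports "HOL-Analysis.Analysis"
begin

text \<open>A finite simple graph is a pair (V, E) with E a set of 2-element subsets of V.\<close>

type_synonym 'a graph = "'a set \<times> 'a set set"

definition complete_graph :: "nat \<Rightarrow> nat graph" where
  "complete_graph n = ({0..<n}, {{i, j} | i j. i < n \<and> j < n \<and> i \<noteq> j})"

definition path_graph :: "nat \<Rightarrow> nat graph" where
  "path_graph m = ({0..<m}, {{i, Suc i} | i. Suc i < m})"

definition cartesian_product :: "'a graph \<Rightarrow> 'b graph \<Rightarrow> ('a \<times> 'b) graph" where
  "cartesian_product G H =
     (fst G \<times> fst H,
      {{(u1, v), (u2, v)} | u1 u2 v. {u1, u2} \<in> snd G \<and> u1 \<noteq> u2 \<and> v \<in> fst H}
      \<union> {{(u, v1), (u, v2)} | u v1 v2. {v1, v2} \<in> snd H \<and> v1 \<noteq> v2 \<and> u \<in> fst G})"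

definition planar :: "'a set \<Rightarrow> 'a set set \<Rightarrow> bool" where
  "planar V E \<longleftrightarrow>
     (\<exists>(f :: 'a \<Rightarrow> complex) (\<gamma> :: 'a set \<Rightarrow> real \<Rightarrow> complex).
        inj_on f V \<and>
        (\<forall>e \<in> E. \<exists>u v. e = {u, v} \<and> u \<noteq> v \<and> u \<in> V \<and> v \<in> V \<and>
            arc (\<gamma> e) \<and> pathstart (\<gamma> e) = f u \<and> pathfinish (\<gamma> e) = f v \<and>
            path_image (\<gamma> e) \<inter> f ` V = {f u, f v}) \<and>
        (\<forall>e \<in> E. \<forall>e' \<in> E. e \<noteq> e' \<longrightarrow>
            path_image (\<gamma> e) \<inter> path_image (\<gamma> e') \<subseteq> f ` (e \<inter> e')))"

definition thickness :: "'a graph \<Rightarrow> nat" where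
  "thickness G = (LEAST k. \<exists>Es :: nat \<Rightarrow> 'a set set.
      (\<forall>i < k. planar (fst G) (Es i)) \<and>
      (\<forall>i < k. \<forall>j < k. i \<noteq> j \<longrightarrow> Es i \<inter> Es j = {}) \<and>
      (\<Union>i < k. Es i) = snd G)"

end

theory Submission
  imports Defs
begin

text \<open>Lower bound: a plane drawing with \<open>V\<close> vertices and \<open>E\<close> edges has at least \<open>E - V + 2\<close> faces by the
  Jordan curve theorem, every edge touches at most two faces and every face at least three edges, so
  \<open>E \<le> 3V - 6\<close>. For \<open>n = 6p + 5\<close> this shows that \<open>p + 1\<close> layers cannot cover even one copy of \<open>K\<^sub>n\<close>.

  Upper bound: let \<open>z\<close> and \<open>w\<close> be two further vertices. Every decomposition of \<open>K\<^sub>n\<^sub>+\<^sub>2\<close> minus the edge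
  \<open>zw\<close> into \<open>k\<close> graphs with straight-line drawings gives \<open>k\<close> planar layers for the product with a path:
  the drawing minus small discs around \<open>z\<close> and \<open>w\<close> is an annulus, consecutive copies of it are
  reflected in their common boundary circle, and an edge from \<open>v\<close> to \<open>z\<close> or \<open>w\<close> becomes the path edge
  between two copies of \<open>v\<close>. It remains to find such decompositions into \<open>q + 1\<close> graphs for
  \<open>n = 6q + 2\<close>. For \<open>q \<ge> 3\<close> the vertices are three cyclic classes of \<open>2q\<close> vertices and two hubs;
  \<open>q\<close> layers are rotations of one triangulation and the last one collects what is left.\<close>

section \<open>Straight-line drawings from three linear orders\<close>

text \<open>Schnyder's condition is the hinge. It is purely combinatorial, so a fixed triangulation
  is settled by evaluation, and it survives putting a vertex into a face or onto an edge. Layers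
  that grow with \<open>q\<close> therefore need no topology, which enters only through the
  mirroring and Euler's bound. A path edge uses only one of z and w, depending on the parity of its
  copy, so a vertex may be joined to z in one layer and to w in another. Room: K_(6q+4) minus an
  edge has 18q^2 + 21q + 5 edges, while q + 1 triangulations on 6q + 4 vertices offer 18q^2 + 24q +
  6. The count also allows q = 1, but K_10 minus an edge contains K_9, which is not a union of two
  planar graphs. This is why mirroring does not reach n = 8 and the table for two layers stops at 7.
  The zigzag is a graceful labelling of a path: each difference occurs once. With one translate at
  offset 0 and one at offset q in every class, q rotations carry each difference to all 2q
  positions.\<close>

definition straight :: "('v \<Rightarrow> complex) \<Rightarrow> 'v set \<Rightarrow> 'v set set \<Rightarrow> bool" where
  "straight p V E \<longleftrightarrow> inj_on p V \<and>
     (\<forall>e\<in>E. card e = 2 \<and> e \<subseteq> V \<and> convex hull (p ` e) \<inter> p ` V \<subseteq> p ` e) \<and>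
     (\<forall>e\<in>E. \<forall>e'\<in>E. e \<noteq> e' \<longrightarrow> convex hull (p ` e) \<inter> convex hull (p ` e') \<subseteq> p ` (e \<inter> e'))"

text \<open>Schnyder's condition for a set \<open>K\<close> of triangles: outside a part \<open>e\<close> of a triangle, every vertex exceeds
  all of \<open>e\<close> in one of three orders.\<close>

definition separating :: "(nat \<Rightarrow> 'v \<Rightarrow> real) \<Rightarrow> 'v set \<Rightarrow> 'v set set \<Rightarrow> bool" where
  "separating R V K \<longleftrightarrow>
     (\<forall>t\<in>K. \<forall>e. e \<subseteq> t \<longrightarrow> (\<forall>x\<in>V - e. \<exists>i<3. \<forall>y\<in>e. R i y < R i x))"

lemma separatingD:
  assumes "separating R V K" "t \<in> K" "e \<subseteq> t" "x \<in> V" "x \<notin> e"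
  shows "\<exists>i<3. \<forall>y\<in>e. R i y < R i x"
  using assms unfolding separating_def by blast

text \<open>Two crossing segments yield one vector that is a nonnegative combination in two ways.
  Coordinate \<open>i\<close>, where \<open>x\<close> and \<open>y\<close> dominate, bounds \<gamma>
  + \<delta> by half of \<alpha> + \<beta>; the coordinates \<open>k\<close> and \<open>l\<close>
  bound \<alpha> and \<beta> each by half of \<gamma> + \<delta>. Together they force \<gamma> +
  \<delta> \<le> 0.\<close>

lemma cone_disjoint:
  fixes X :: "nat \<Rightarrow> 'v \<Rightarrow> real"
  assumes pos: "\<And>i v. X i v > 0"
    and nn: "\<alpha> \<ge> 0" "\<beta> \<ge> 0" "\<gamma> \<ge> 0" "\<delta> \<ge> 0" "\<gamma> + \<delta> > 0"
    and eq: "\<And>i. i < 3 \<Longrightarrow> \<alpha> * X i u + \<beta> * X i v = \<gamma> * X i x + \<delta> * X i y"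
    and i: "i < 3" "2 * X i u \<le> X i x" "2 * X i v \<le> X i x" "2 * X i u \<le> X i y" "2 * X i v \<le> X i y"
    and k: "k < 3" "2 * X k x \<le> X k u" "2 * X k y \<le> X k u"
    and l: "l < 3" "2 * X l x \<le> X l v" "2 * X l y \<le> X l v"
  shows False
proof -
  define m where "m = max (X i u) (X i v)"
  have mpos: "m > 0" using pos[of i u] unfolding m_def by linarith
  have "\<alpha> * X i u + \<beta> * X i v \<le> \<alpha> * m + \<beta> * m"
    using nn by (intro add_mono mult_left_mono) (auto simp: m_def)
  moreover have "\<gamma> * X i x + \<delta> * X i y \<ge> \<gamma> * (2 * m) + \<delta> * (2 * m)"
    using nn i by (intro add_mono mult_left_mono) (auto simp: m_def)
  ultimately have "2 * (\<gamma> + \<delta>) * m \<le> (\<alpha> + \<beta>) * m"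
    using eq[OF i(1)] by (simp add: algebra_simps)
  with mpos have 1: "2 * (\<gamma> + \<delta>) \<le> \<alpha> + \<beta>" by simp
  have "\<alpha> * X k u \<le> \<alpha> * X k u + \<beta> * X k v" using nn pos[of k v] by simp
  also have "\<dots> = \<gamma> * X k x + \<delta> * X k y" using eq k by simp
  also have "\<dots> \<le> \<gamma> * (X k u / 2) + \<delta> * (X k u / 2)"
    using nn k by (intro add_mono mult_left_mono) auto
  finally have "\<alpha> * X k u \<le> (\<gamma> + \<delta>) / 2 * X k u" by (simp add: field_simps)
  with pos[of k u] have 2: "\<alpha> \<le> (\<gamma> + \<delta>) / 2" by (metis mult_le_cancel_right_pos)
  have "\<beta> * X l v \<le> \<alpha> * X l u + \<beta> * X l v" using nn pos[of l u] by simp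
  also have "\<dots> = \<gamma> * X l x + \<delta> * X l y" using eq l by simp
  also have "\<dots> \<le> \<gamma> * (X l v / 2) + \<delta> * (X l v / 2)"
    using nn l by (intro add_mono mult_left_mono) auto
  finally have "\<beta> * X l v \<le> (\<gamma> + \<delta>) / 2 * X l v" by (simp add: field_simps)
  with pos[of l v] have 3: "\<beta> \<le> (\<gamma> + \<delta>) / 2" by (metis mult_le_cancel_right_pos)
  from 1 2 3 nn show False by (simp add: field_simps)
qed

text \<open>Similar inequalities with \<open>w\<close> alone on the right: \<delta> is at most half
  of \<alpha> + \<beta>, and \<alpha> and \<beta> are each at most half of \<delta>. It serves a
  vertex lying on an edge and, once the common end is cancelled, two edges with a common
  end.\<close>

lemma cone_common_vertex:
  fixes X :: "nat \<Rightarrow> 'v \<Rightarrow> real"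
  assumes pos: "\<And>i v. X i v > 0"
    and nn: "\<alpha> \<ge> 0" "\<beta> \<ge> 0" "\<delta> \<ge> 0"
    and eq: "\<And>i. i < 3 \<Longrightarrow> \<alpha> * X i u + \<beta> * X i v = \<delta> * X i w"
    and i: "i < 3" "2 * X i u \<le> X i w" "2 * X i v \<le> X i w"
    and j: "j < 3" "2 * X j w \<le> X j v"
    and k: "k < 3" "2 * X k w \<le> X k u"
  shows "\<delta> = 0"
proof -
  have "\<delta> * X i w \<le> \<alpha> * (X i w / 2) + \<beta> * (X i w / 2)"
    unfolding eq[OF i(1), symmetric] using nn i by (intro add_mono mult_left_mono) auto
  then have "\<delta> * X i w \<le> (\<alpha> + \<beta>) / 2 * X i w" by (simp add: field_simps)
  with pos[of i w] have 1: "\<delta> \<le> (\<alpha> + \<beta>) / 2" by (metis mult_le_cancel_right_pos)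
  have "\<beta> * X j v \<le> \<alpha> * X j u + \<beta> * X j v" using nn pos[of j u] by simp
  also have "\<dots> = \<delta> * X j w" using eq j by simp
  also have "\<dots> \<le> \<delta> * (X j v / 2)" using nn j by (intro mult_left_mono) auto
  finally have "\<beta> * X j v \<le> \<delta> / 2 * X j v" by simp
  with pos[of j v] have 2: "\<beta> \<le> \<delta> / 2" by (metis mult_le_cancel_right_pos)
  have "\<alpha> * X k u \<le> \<alpha> * X k u + \<beta> * X k v" using nn pos[of k v] by simp
  also have "\<dots> = \<delta> * X k w" using eq k by simp
  also have "\<dots> \<le> \<delta> * (X k u / 2)" using nn k by (intro mult_left_mono) auto
  finally have "\<alpha> * X k u \<le> \<delta> / 2 * X k u" by simp
  with pos[of k u] have 3: "\<alpha> \<le> \<delta> / 2" by (metis mult_le_cancel_right_pos)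
  have "\<delta> \<le> 0" using 1 2 3 nn by (simp add: field_simps)
  then show ?thesis using nn by simp
qed

text \<open>Projecting the points \<open>(2\<^sup>r\<^sup>1, 2\<^sup>r\<^sup>2, 2\<^sup>r\<^sup>3)\<close>, for the three ranks of a vertex, radially
  onto the plane of points with coordinate sum 1 gives a straight-line drawing.\<close>

lemma separating_imp_straight:
  fixes R :: "nat \<Rightarrow> 'v \<Rightarrow> real"
  assumes fin: "finite V" and sep: "separating R V K" and VK: "V \<subseteq> \<Union>K"
    and E: "\<And>e. e \<in> E \<Longrightarrow> card e = 2 \<and> e \<subseteq> V \<and> (\<exists>t\<in>K. e \<subseteq> t)"
  shows "\<exists>p. straight p V E"
proof -
  define X :: "nat \<Rightarrow> 'v \<Rightarrow> real" where "X i v = 2 ^ card {u \<in> V. R i u < R i v}" for i v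
  have pos: "X i v > 0" for i v by (simp add: X_def)
  \<comment> \<open>The exponents are positions within \<open>V\<close>, so a strict inequality of
    ranks becomes the factor 2 on which the cone inequalities rest.\<close>
  have X2: "2 * X i u \<le> X i v" if "R i u < R i v" "u \<in> V" for i u v
  proof -
    have "{w \<in> V. R i w < R i u} \<subset> {w \<in> V. R i w < R i v}" using that by auto
    then have "Suc (card {w \<in> V. R i w < R i u}) \<le> card {w \<in> V. R i w < R i v}"
      using fin by (simp add: Suc_leI psubset_card_mono)
    then have "(2::real) ^ Suc (card {w \<in> V. R i w < R i u}) \<le> 2 ^ card {w \<in> V. R i w < R i v}"
      by (intro power_increasing) auto
    then show ?thesis by (simp add: X_def)
  qed
  have dom: "\<exists>i<3. \<forall>y\<in>e. 2 * X i y \<le> X i x" if "t \<in> K" "e \<subseteq> t" "e \<subseteq> V" "x \<in> V" "x \<notin> e" for t e x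
    using separatingD[OF sep that(1,2,4,5)] X2 that(3) by (meson subsetD)
  have dom1: "\<exists>i<3. 2 * X i y \<le> X i x" if "y \<in> V" "x \<in> V" "x \<noteq> y" for x y
  proof -
    have "\<exists>t\<in>K. y \<in> t" using VK that(1) by auto
    then show ?thesis using dom[of _ "{y}" x] that by auto
  qed
  have dom2: "\<exists>i<3. 2 * X i u \<le> X i x \<and> 2 * X i v \<le> X i x"
    if "{u, v} \<in> E" "x \<in> V" "x \<noteq> u" "x \<noteq> v" for u v x
    using E[OF that(1)] dom[of _ "{u, v}" x] that by auto
  define S where "S v = X 0 v + X 1 v + X 2 v" for v
  have Spos: "S v > 0" for v using pos by (simp add: S_def add_pos_pos)
  define p where "p v = Complex (X 0 v / S v) (X 1 v / S v)" for v
  \<comment> \<open>The three coordinates of a point in the plane of coordinate sum 1; the complex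
    number stores the first two.\<close>
  define co :: "nat \<Rightarrow> complex \<Rightarrow> real" where
    "co i z = (if i = 0 then Re z else if i = 1 then Im z else 1 - Re z - Im z)" for i z
  have co_p: "co i (p v) = X i v / S v" if "i < 3" for i v
  proof -
    have "i = 0 \<or> i = 1 \<or> i = 2" using that by auto
    then show ?thesis
    proof (elim disjE)
      assume "i = 2"
      then have "co i (p v) = 1 - X 0 v / S v - X 1 v / S v" by (simp add: co_def p_def)
      also have "\<dots> = (S v - X 0 v - X 1 v) / S v"
        using Spos[of v] by (simp add: diff_divide_distrib)
      finally show ?thesis using \<open>i = 2\<close> by (simp add: S_def)
    qed (simp_all add: co_def p_def)
  qed
  have co_comb: "co i ((1 - s) *\<^sub>R z + s *\<^sub>R w) = (1 - s) * co i z + s * co i w" for i s z w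
    by (simp add: co_def algebra_simps)
  have seg: "\<exists>\<alpha> \<beta>. \<alpha> \<ge> 0 \<and> \<beta> \<ge> 0 \<and> \<alpha> + \<beta> > 0 \<and> (\<forall>i<3. co i z = \<alpha> * X i u + \<beta> * X i v) \<and>
               (\<beta> = 0 \<longrightarrow> z = p u) \<and> (\<alpha> = 0 \<longrightarrow> z = p v)"
    if "z \<in> closed_segment (p u) (p v)" for z u v
  proof -
    obtain s where s: "0 \<le> s" "s \<le> 1" "z = (1 - s) *\<^sub>R p u + s *\<^sub>R p v"
      using \<open>z \<in> closed_segment (p u) (p v)\<close> by (auto simp: closed_segment_def)
    have "co i z = (1 - s) / S u * X i u + s / S v * X i v" if "i < 3" for i
      using that s by (simp add: co_comb co_p)
    moreover have "(1 - s) / S u + s / S v > 0"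
      using s Spos[of u] Spos[of v]
      by (cases "s = 0") (auto intro!: add_nonneg_pos divide_nonneg_pos)
    moreover have "(1 - s) / S u \<ge> 0" "s / S v \<ge> 0"
      using s Spos[of u] Spos[of v] by (auto intro!: divide_nonneg_pos)
    ultimately show ?thesis
      using s Spos[of u] Spos[of v]
      by (intro exI[of _ "(1 - s) / S u"] exI[of _ "s / S v"]) auto
  qed
  have inj: "inj_on p V"
  proof (rule inj_onI, rule ccontr)
    fix u v assume uv: "u \<in> V" "v \<in> V" "p u = p v" "u \<noteq> v"
    have eq: "X i u / S u = X i v / S v" if "i < 3" for i using co_p[OF that] uv by metis
    obtain i where i: "i < 3" "2 * X i u \<le> X i v" using dom1[of u v] uv by auto
    obtain j where j: "j < 3" "2 * X j v \<le> X j u" using dom1[of v u] uv by auto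
    have "X i u * S v = X i v * S u" using eq[OF i(1)] Spos[of u] Spos[of v] by (simp add: field_simps)
    moreover have "X i v * S u \<ge> 2 * X i u * S u" using i Spos[of u] by (simp add: mult_right_mono)
    ultimately have "X i u * (2 * S u) \<le> X i u * S v" by (simp add: algebra_simps)
    then have 1: "2 * S u \<le> S v" using pos[of i u] by simp
    have "X j u * S v = X j v * S u" using eq[OF j(1)] Spos[of u] Spos[of v] by (simp add: field_simps)
    moreover have "X j u * S v \<ge> 2 * X j v * S v" using j Spos[of v] by (simp add: mult_right_mono)
    ultimately have "X j v * (2 * S v) \<le> X j v * S u" by (simp add: algebra_simps)
    then have "2 * S v \<le> S u" using pos[of j v] by simp
    with 1 Spos[of u] Spos[of v] show False by linarith
  qed
  have vertex: "p w \<notin> closed_segment (p u) (p v)"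
    if e: "{u, v} \<in> E" "w \<in> V" "w \<noteq> u" "w \<noteq> v" for u v w
  proof
    assume "p w \<in> closed_segment (p u) (p v)"
    then obtain \<alpha> \<beta> where ab: "\<alpha> \<ge> 0" "\<beta> \<ge> 0" "\<alpha> + \<beta> > 0"
        "\<forall>i<3. co i (p w) = \<alpha> * X i u + \<beta> * X i v" using seg by meson
    then have eq: "\<alpha> * X i u + \<beta> * X i v = 1 / S w * X i w" if "i < 3" for i
      using that co_p[OF that, of w] by auto
    have uv: "u \<in> V" "v \<in> V" using E[OF e(1)] by auto
    obtain i where i: "i < 3" "2 * X i u \<le> X i w" "2 * X i v \<le> X i w" using dom2 e by blast
    obtain j where j: "j < 3" "2 * X j w \<le> X j v" using dom1[of w v] e uv by auto
    obtain k where k: "k < 3" "2 * X k w \<le> X k u" using dom1[of w u] e uv by auto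
    have "1 / S w = 0"
      using cone_common_vertex[of X \<alpha> \<beta> "1 / S w" u v w, OF pos ab(1,2) _ eq i j k] Spos[of w] by simp
    then show False using Spos[of w] by simp
  qed
  have share: "closed_segment (p u) (p v) \<inter> closed_segment (p u) (p w) \<subseteq> {p u}"
    if e: "{u, v} \<in> E" "{u, w} \<in> E" "v \<noteq> w" for u v w
  proof
    fix z assume z: "z \<in> closed_segment (p u) (p v) \<inter> closed_segment (p u) (p w)"
    have V: "u \<in> V" "v \<in> V" "w \<in> V" "u \<noteq> v" "u \<noteq> w" using E[OF e(1)] E[OF e(2)] by auto
    obtain \<alpha> \<beta> where ab: "\<alpha> \<ge> 0" "\<beta> \<ge> 0" "\<forall>i<3. co i z = \<alpha> * X i u + \<beta> * X i v" "\<beta> = 0 \<longrightarrow> z = p u"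
      using seg[of z u v] z by auto
    obtain \<gamma> \<delta> where cd: "\<gamma> \<ge> 0" "\<delta> \<ge> 0" "\<forall>i<3. co i z = \<gamma> * X i u + \<delta> * X i w" "\<delta> = 0 \<longrightarrow> z = p u"
      using seg[of z u w] z by auto
    obtain i where i: "i < 3" "2 * X i u \<le> X i w" "2 * X i v \<le> X i w" using dom2[of u v w] e V by blast
    obtain j where j: "j < 3" "2 * X j u \<le> X j v" "2 * X j w \<le> X j v" using dom2[of u w v] e V by blast
    obtain k where k: "k < 3" "2 * X k w \<le> X k u" using dom1[of w u] V by auto
    obtain l where l: "l < 3" "2 * X l v \<le> X l u" using dom1[of v u] V by auto
    show "z \<in> {p u}"
    \<comment> \<open>The common end \<open>u\<close> occurs on both sides of the equation; its
      smaller coefficient is cancelled.\<close>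
    proof (cases "\<gamma> \<le> \<alpha>")
      case True
      have "(\<alpha> - \<gamma>) * X i u + \<beta> * X i v = \<delta> * X i w" if "i < 3" for i
        using ab(3) cd(3) that by (simp add: algebra_simps)
      then have "\<delta> = 0"
        using cone_common_vertex[of X "\<alpha> - \<gamma>" \<beta> \<delta> u v w, OF pos _ ab(2) cd(2) _ i j(1,3) k] True by simp
      then show ?thesis using cd by simp
    next
      case False
      have "(\<gamma> - \<alpha>) * X i u + \<delta> * X i w = \<beta> * X i v" if "i < 3" for i
        using ab(3) cd(3) that by (simp add: algebra_simps)
      then have "\<beta> = 0"
        using cone_common_vertex[of X "\<gamma> - \<alpha>" \<delta> \<beta> u w v, OF pos _ cd(2) ab(2) _ j i(1,3) l] False by simp
      then show ?thesis using ab by simp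
    qed
  qed
  have disj: "closed_segment (p u) (p v) \<inter> closed_segment (p x) (p y) = {}"
    if e: "{u, v} \<in> E" "{x, y} \<in> E" "{u, v} \<inter> {x, y} = {}" for u v x y
  proof (rule ccontr)
    assume "closed_segment (p u) (p v) \<inter> closed_segment (p x) (p y) \<noteq> {}"
    then obtain z where z: "z \<in> closed_segment (p u) (p v)" "z \<in> closed_segment (p x) (p y)" by auto
    have V: "u \<in> V" "v \<in> V" "x \<in> V" "y \<in> V" using E[OF e(1)] E[OF e(2)] by auto
    obtain \<alpha> \<beta> where ab: "\<alpha> \<ge> 0" "\<beta> \<ge> 0" "\<alpha> + \<beta> > 0" "\<forall>i<3. co i z = \<alpha> * X i u + \<beta> * X i v"
      using seg[OF z(1)] by auto
    obtain \<gamma> \<delta> where cd: "\<gamma> \<ge> 0" "\<delta> \<ge> 0" "\<gamma> + \<delta> > 0" "\<forall>i<3. co i z = \<gamma> * X i x + \<delta> * X i y"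
      using seg[OF z(2)] by auto
    have eq: "\<alpha> * X i u + \<beta> * X i v = \<gamma> * X i x + \<delta> * X i y" if "i < 3" for i
      using ab(4) cd(4) that by simp
    obtain i where i: "i < 3" "2 * X i u \<le> X i x" "2 * X i v \<le> X i x" using dom2[of u v x] e V by auto
    obtain j where j: "j < 3" "2 * X j u \<le> X j y" "2 * X j v \<le> X j y" using dom2[of u v y] e V by auto
    obtain k where k: "k < 3" "2 * X k x \<le> X k u" "2 * X k y \<le> X k u" using dom2[of x y u] e V by auto
    obtain l where l: "l < 3" "2 * X l x \<le> X l v" "2 * X l y \<le> X l v" using dom2[of x y v] e V by auto
    have ne: "i \<noteq> k" "i \<noteq> l" "j \<noteq> k" "j \<noteq> l"
      using i j k l pos by (smt (verit))+
    \<comment> \<open>An order in which \<open>x\<close> or \<open>y\<close> dominates differs from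
      one in which \<open>u\<close> or \<open>v\<close> does. With only three orders, one of the two
      pairs must coincide, which is what \<open>cone_disjoint\<close> asks for.\<close>
    then have "i = j \<or> k = l" using i(1) j(1) k(1) l(1) by arith
    then show False
    proof
      assume "i = j"
      then show False
        using cone_disjoint[of X \<alpha> \<beta> \<gamma> \<delta> u v x y i k l, OF pos ab(1,2) cd(1,2,3) eq i] i j k l by blast
    next
      assume "k = l"
      then show False
        using cone_disjoint[of X \<gamma> \<delta> \<alpha> \<beta> x y u v k i j, OF pos cd(1,2) ab(1,2,3) eq[symmetric] k(1)] i j k l
        by blast
    qed
  qed
  have "straight p V E"
    unfolding straight_def
  proof (intro conjI ballI impI)
    show "inj_on p V" by (rule inj)
  next
    fix e assume e: "e \<in> E"
    show "card e = 2" "e \<subseteq> V" using E[OF e] by auto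
    obtain u v where uv: "e = {u, v}" "u \<noteq> v" using E[OF e] by (meson card_2_iff)
    then have V: "u \<in> V" "v \<in> V" using E[OF e] by auto
    show "convex hull (p ` e) \<inter> p ` V \<subseteq> p ` e"
      using vertex[of u v] e uv V by (auto simp: segment_convex_hull[symmetric]; metis)
  next
    fix e e' assume e: "e \<in> E" "e' \<in> E" "e \<noteq> e'"
    obtain u v where euv: "e = {u, v}" "u \<noteq> v" using E[OF e(1)] by (meson card_2_iff)
    obtain x y where exy: "e' = {x, y}" "x \<noteq> y" using E[OF e(2)] by (meson card_2_iff)
    have im: "convex hull (p ` e) = closed_segment (p u) (p v)" "convex hull (p ` e') = closed_segment (p x) (p y)"
      by (simp_all add: euv exy segment_convex_hull)
    consider "e \<inter> e' = {}" | "u = x" | "u = y" | "v = x" | "v = y" using euv exy by auto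
    then show "convex hull (p ` e) \<inter> convex hull (p ` e') \<subseteq> p ` (e \<inter> e')"
    proof cases
      case 1 then show ?thesis using disj[of u v x y] e euv exy im by auto
    next
      case 2 then show ?thesis using share[of u v y] e euv exy im by auto
    next
      case 3 then show ?thesis using share[of u v x] e euv exy im
        by (auto simp: insert_commute closed_segment_commute)
    next
      case 4 then show ?thesis using share[of v u y] e euv exy im
        by (auto simp: insert_commute closed_segment_commute)
    next
      case 5 then show ?thesis using share[of v u x] e euv exy im
        by (auto simp: insert_commute closed_segment_commute)
    qed
  qed
  then show ?thesis by blast
qed

section \<open>Mirrored copies\<close>

text \<open>\<open>S\<close> holds the edges that are drawn inside every copy, and \<open>P k\<close> the vertices whose path edge from
  copy \<open>k\<close> to copy \<open>k + 1\<close> is drawn.\<close>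

definition stacked :: "nat \<Rightarrow> 'v set set \<Rightarrow> (nat \<Rightarrow> 'v set) \<Rightarrow> ('v \<times> nat) set set" where
  "stacked m S P = {(\<lambda>u. (u, k)) ` e | e k. e \<in> S \<and> k < m} \<union> {{(v, k), (v, Suc k)} | v k. v \<in> P k \<and> Suc k < m}"

text \<open>Used to cut a spoke where it first reaches a circle, given as the zero set of
  \<open>g\<close>. The least parameter with \<open>g \<le> 0\<close> exists by compactness and is a
  zero by the intermediate value theorem.\<close>

lemma segment_first_hit:
  fixes g :: "'a::euclidean_space \<Rightarrow> real"
  assumes "continuous_on UNIV g" "g v > 0" "g c \<le> 0"
  shows "\<exists>d\<in>closed_segment v c. g d = 0 \<and> (\<forall>x\<in>closed_segment v d. x \<noteq> d \<longrightarrow> g x > 0)"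
proof -
  define h where "h s = g ((1 - s) *\<^sub>R v + s *\<^sub>R c)" for s :: real
  have ch: "continuous_on T h" for T
    unfolding h_def
    by (rule continuous_on_compose2[OF assms(1)]) (auto intro!: continuous_intros)
  define K where "K = {0..1} \<inter> h -` {..0}"
  have "closed K" unfolding K_def
    by (rule continuous_closed_preimage[OF ch]) auto
  moreover have "bounded K" unfolding K_def by (rule bounded_subset[of "{0..1}"]) auto
  ultimately have "compact K" by (simp add: compact_eq_bounded_closed)
  moreover have "1 \<in> K" using assms(3) by (simp add: K_def h_def)
  ultimately obtain s where s: "s \<in> K" "\<And>r. r \<in> K \<Longrightarrow> s \<le> r"
    using compact_attains_inf[of K] by blast
  have s01: "0 \<le> s" "s \<le> 1" "h s \<le> 0" using s(1) by (auto simp: K_def)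
  have h0: "h 0 > 0" using assms(2) by (simp add: h_def)
  have before: "h r > 0" if "0 \<le> r" "r < s" for r
    using s(2)[of r] that s01 by (force simp: K_def)
  have "h s = 0"
  proof -
    obtain r where r: "0 \<le> r" "r \<le> s" "h r = 0"
      using IVT2'[of h s 0 0, OF s01(3) _ s01(1) ch] h0 by auto
    then show ?thesis using before[of r] by (cases "r = s") auto
  qed
  moreover have "g x > 0" if x: "x \<in> closed_segment v ((1 - s) *\<^sub>R v + s *\<^sub>R c)" "x \<noteq> (1 - s) *\<^sub>R v + s *\<^sub>R c" for x
  proof -
    obtain u where u: "0 \<le> u" "u \<le> 1" "x = (1 - u) *\<^sub>R v + u *\<^sub>R ((1 - s) *\<^sub>R v + s *\<^sub>R c)"
      using x(1) by (auto simp: closed_segment_def)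
    have xe: "x = (1 - u * s) *\<^sub>R v + (u * s) *\<^sub>R c"
      unfolding u(3) by (simp add: algebra_simps)
    have "u \<noteq> 1" using x(2) u by auto
    moreover have "s \<noteq> 0" using \<open>h s = 0\<close> h0 by auto
    ultimately have "u * s < s" using u s01 by simp
    then have "h (u * s) > 0" using before[of "u * s"] u s01 by simp
    then show ?thesis using xe by (simp add: h_def)
  qed
  ultimately show ?thesis
    using s01 by (intro bexI[of _ "(1 - s) *\<^sub>R v + s *\<^sub>R c"]) (auto simp: h_def closed_segment_def)
qed

text \<open>The annulus between the Apollonius discs around \<open>a\<close> and \<open>b\<close>, the side of its boundary that the copies
  \<open>k\<close> and \<open>k + 1\<close> share, and the map that places copy \<open>k\<close>.\<close>

definition ann :: "real \<Rightarrow> complex \<Rightarrow> complex \<Rightarrow> complex set" where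
  "ann \<epsilon> a b = {x. cmod (x - a) \<ge> \<epsilon> * cmod (x - b) \<and> cmod (x - b) \<ge> \<epsilon> * cmod (x - a)}"

definition bnd :: "real \<Rightarrow> complex \<Rightarrow> complex \<Rightarrow> nat \<Rightarrow> complex \<Rightarrow> bool" where
  "bnd \<epsilon> a b k x \<longleftrightarrow>
     (if even k then cmod (x - b) = \<epsilon> * cmod (x - a) else cmod (x - a) = \<epsilon> * cmod (x - b))"

definition leaf :: "real \<Rightarrow> complex \<Rightarrow> complex \<Rightarrow> nat \<Rightarrow> complex \<Rightarrow> complex" where
  "leaf \<epsilon> a b k x = of_real ((1 / \<epsilon>) ^ (2 * k)) *
     (if even k then (x - a) / (x - b) else cnj ((x - b) / (x - a)))"

context
  fixes \<epsilon> :: real and a b :: complex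
  assumes eps: "0 < \<epsilon>" "\<epsilon> < 1" and ab: "a \<noteq> b"
begin

lemma ann_pos:
  assumes "x \<in> ann \<epsilon> a b" shows "cmod (x - a) > 0" "cmod (x - b) > 0" "x \<noteq> a" "x \<noteq> b"
proof -
  have "x \<noteq> a"
  proof
    assume "x = a"
    then have "\<epsilon> * cmod (a - b) \<le> 0" using assms by (simp add: ann_def)
    then show False using eps ab by (simp add: mult_le_0_iff)
  qed
  moreover have "x \<noteq> b"
  proof
    assume "x = b"
    then have "\<epsilon> * cmod (b - a) \<le> 0" using assms by (simp add: ann_def)
    then show False using eps ab by (simp add: mult_le_0_iff)
  qed
  ultimately show "cmod (x - a) > 0" "cmod (x - b) > 0" "x \<noteq> a" "x \<noteq> b" by auto
qed

lemma leaf_cont: "continuous_on (ann \<epsilon> a b) (leaf \<epsilon> a b k)"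
proof (cases "even k")
  case True
  then show ?thesis unfolding leaf_def using ann_pos by (auto intro!: continuous_intros)
next
  case False
  then show ?thesis unfolding leaf_def using ann_pos by (auto intro!: continuous_intros)
qed

lemma mobius_inj:
  assumes "x \<noteq> b" "y \<noteq> b" "(x - a) / (x - b) = (y - a) / (y - b)" shows "x = y"
proof -
  have "(x - a) * (y - b) = (y - a) * (x - b)" using assms by (simp add: field_simps)
  then have "(x - y) * (a - b) = 0" by (simp add: algebra_simps)
  then show ?thesis using ab by simp
qed

lemma mobius_inj':
  assumes "x \<noteq> a" "y \<noteq> a" "(x - b) / (x - a) = (y - b) / (y - a)" shows "x = y"
proof -
  have "(x - b) * (y - a) = (y - b) * (x - a)" using assms by (simp add: field_simps)
  then have "(x - y) * (a - b) = 0" by (simp add: algebra_simps)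
  then show ?thesis using ab by simp
qed

lemma leaf_inj: "inj_on (leaf \<epsilon> a b k) (ann \<epsilon> a b)"
proof (rule inj_onI)
  fix x y assume xy: "x \<in> ann \<epsilon> a b" "y \<in> ann \<epsilon> a b" "leaf \<epsilon> a b k x = leaf \<epsilon> a b k y"
  have ne: "x \<noteq> a" "x \<noteq> b" "y \<noteq> a" "y \<noteq> b" using xy ann_pos by auto
  have nz: "(complex_of_real ((1 / \<epsilon>) ^ (2 * k))) \<noteq> 0" using eps by simp
  show "x = y"
  proof (cases "even k")
    case True
    then have "(x - a) / (x - b) = (y - a) / (y - b)"
      using xy(3) unfolding leaf_def by (simp only: if_True mult_left_cancel[OF nz])
    then show ?thesis using mobius_inj ne by blast
  next
    case False
    then have "cnj ((x - b) / (x - a)) = cnj ((y - b) / (y - a))"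
      using xy(3) unfolding leaf_def by (simp only: if_False mult_left_cancel[OF nz])
    then have "(x - b) / (x - a) = (y - b) / (y - a)" by (metis complex_cnj_cnj)
    then show ?thesis using mobius_inj' ne by blast
  qed
qed

text \<open>The Moebius quotient has modulus between \<epsilon> and 1/\<epsilon> on the annulus.
  Hence copy \<open>k\<close> lies in the ring between the powers 2k - 1 and 2k + 1 of 1/\<epsilon>.
  Neighbouring rings share a circle, and \<open>bnd\<close> is its preimage in both copies.\<close>

lemma leaf_norm:
  assumes "x \<in> ann \<epsilon> a b"
  shows "(1 / \<epsilon>) ^ (2 * k) * \<epsilon> \<le> cmod (leaf \<epsilon> a b k x)"
    "cmod (leaf \<epsilon> a b k x) \<le> (1 / \<epsilon>) ^ Suc (2 * k)"
    "cmod (leaf \<epsilon> a b k x) = (1 / \<epsilon>) ^ Suc (2 * k) \<longleftrightarrow> bnd \<epsilon> a b k x"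
    "cmod (leaf \<epsilon> a b (Suc k) x) = (1 / \<epsilon>) ^ Suc (2 * k) \<longleftrightarrow> bnd \<epsilon> a b k x"
proof -
  define s where "s = cmod (x - a)"
  define t where "t = cmod (x - b)"
  have st: "s > 0" "t > 0" "s \<ge> \<epsilon> * t" "t \<ge> \<epsilon> * s"
    using ann_pos[OF assms] assms by (auto simp: s_def t_def ann_def)
  have n: "cmod (leaf \<epsilon> a b k x) = (1 / \<epsilon>) ^ (2 * k) * (if even k then s / t else t / s)" for k
    using eps by (simp add: leaf_def norm_mult norm_divide norm_power s_def t_def del: complex_cnj_divide)
  have P: "(1 / \<epsilon>) ^ (2 * k) > 0" using eps by simp
  have q: "\<epsilon> \<le> s / t" "\<epsilon> \<le> t / s" "s / t \<le> 1 / \<epsilon>" "t / s \<le> 1 / \<epsilon>"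
    using st eps by (auto simp: field_simps)
  show "(1 / \<epsilon>) ^ (2 * k) * \<epsilon> \<le> cmod (leaf \<epsilon> a b k x)"
    unfolding n using P q by (auto intro!: mult_left_mono)
  have S: "(1 / \<epsilon>) ^ Suc (2 * k) = (1 / \<epsilon>) ^ (2 * k) * (1 / \<epsilon>)" by simp
  show "cmod (leaf \<epsilon> a b k x) \<le> (1 / \<epsilon>) ^ Suc (2 * k)"
    unfolding n S using P q by (intro mult_left_mono) auto
  show "cmod (leaf \<epsilon> a b k x) = (1 / \<epsilon>) ^ Suc (2 * k) \<longleftrightarrow> bnd \<epsilon> a b k x"
    unfolding n S mult_left_cancel[OF less_imp_neq[OF P, symmetric]]
    using st eps by (auto simp: bnd_def s_def[symmetric] t_def[symmetric] field_simps)
  have S2: "(1 / \<epsilon>) ^ (2 * Suc k) = (1 / \<epsilon>) ^ (2 * k) * ((1 / \<epsilon>) * (1 / \<epsilon>))" by simp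
  show "cmod (leaf \<epsilon> a b (Suc k) x) = (1 / \<epsilon>) ^ Suc (2 * k) \<longleftrightarrow> bnd \<epsilon> a b k x"
    unfolding n S S2 mult.assoc mult_left_cancel[OF less_imp_neq[OF P, symmetric]]
    using st eps by (auto simp: bnd_def s_def[symmetric] t_def[symmetric] field_simps)
qed

text \<open>On the shared circle the unscaled map of copy \<open>k\<close> has a value M of modulus
  1/\<epsilon>, so the unscaled map of the next copy, \<open>cnj (1 / M)\<close>, equals
  \<epsilon>^2 M. The additional scaling by 1/\<epsilon>^2 undoes this: the two maps are mirror
  images in that circle.\<close>

lemma leaf_bnd:
  assumes x: "x \<in> ann \<epsilon> a b" and "bnd \<epsilon> a b k x"
  shows "leaf \<epsilon> a b (Suc k) x = leaf \<epsilon> a b k x"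
proof -
  have ne: "x \<noteq> a" "x \<noteq> b" using ann_pos[OF x] by auto
  have cn: "u * cnj u = of_real ((cmod u)\<^sup>2)" for u by (simp only: complex_norm_square)
  have S2: "(1 / \<epsilon>) ^ (2 * Suc k) = (1 / \<epsilon>) ^ (2 * k) * ((1 / \<epsilon>)\<^sup>2)" by (simp add: power2_eq_square)
  show ?thesis
  proof (cases "even k")
    case True
    then have "(cmod (x - b))\<^sup>2 = \<epsilon>\<^sup>2 * (cmod (x - a))\<^sup>2" using assms by (simp add: bnd_def power_mult_distrib)
    then have "(x - b) * cnj (x - b) = of_real (\<epsilon>\<^sup>2) * ((x - a) * cnj (x - a))"
      unfolding cn by simp
    then have "cnj (x - b) / cnj (x - a) = of_real (\<epsilon>\<^sup>2) * ((x - a) / (x - b))"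
      using ne by (simp add: field_simps)
    then have q: "cnj ((x - b) / (x - a)) = of_real (\<epsilon>\<^sup>2) * ((x - a) / (x - b))" by simp
    have "leaf \<epsilon> a b (Suc k) x = of_real ((1 / \<epsilon>) ^ (2 * k) * (1 / \<epsilon>)\<^sup>2 * \<epsilon>\<^sup>2) * ((x - a) / (x - b))"
      using True unfolding leaf_def S2 by (simp only: q even_Suc if_False not_True_eq_False of_real_mult mult.assoc)
    also have "(1 / \<epsilon>) ^ (2 * k) * (1 / \<epsilon>)\<^sup>2 * \<epsilon>\<^sup>2 = (1 / \<epsilon>) ^ (2 * k)" using eps by (simp add: power_divide)
    finally show ?thesis using True unfolding leaf_def by simp
  next
    case False
    then have "(cmod (x - a))\<^sup>2 = \<epsilon>\<^sup>2 * (cmod (x - b))\<^sup>2" using assms by (simp add: bnd_def power_mult_distrib)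
    then have "(x - a) * cnj (x - a) = of_real (\<epsilon>\<^sup>2) * ((x - b) * cnj (x - b))"
      unfolding cn by simp
    then have "(x - a) / (x - b) = of_real (\<epsilon>\<^sup>2) * (cnj (x - b) / cnj (x - a))"
      using ne by (simp add: field_simps)
    then have q: "(x - a) / (x - b) = of_real (\<epsilon>\<^sup>2) * cnj ((x - b) / (x - a))" by simp
    have "leaf \<epsilon> a b (Suc k) x = of_real ((1 / \<epsilon>) ^ (2 * k) * (1 / \<epsilon>)\<^sup>2 * \<epsilon>\<^sup>2) * cnj ((x - b) / (x - a))"
      using False unfolding leaf_def S2 by (simp only: q even_Suc if_True not_False_eq_True of_real_mult mult.assoc)
    also have "(1 / \<epsilon>) ^ (2 * k) * (1 / \<epsilon>)\<^sup>2 * \<epsilon>\<^sup>2 = (1 / \<epsilon>) ^ (2 * k)" using eps by (simp add: power_divide)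
    finally show ?thesis using False unfolding leaf_def by simp
  qed
qed

text \<open>Comparing radii excludes copies that are not neighbours. For neighbours the common value
  has the extreme modulus, so it lies on the shared circle; there both maps agree, and injectivity
  gives \<open>x = y\<close>.\<close>

lemma leaf_eqD:
  assumes x: "x \<in> ann \<epsilon> a b" and y: "y \<in> ann \<epsilon> a b" and "k < l" and eq: "leaf \<epsilon> a b k x = leaf \<epsilon> a b l y"
  shows "l = Suc k \<and> x = y \<and> bnd \<epsilon> a b k x"
proof -
  have g: "1 / \<epsilon> > 1" using eps by simp
  have lo: "(1 / \<epsilon>) ^ (2 * l) * \<epsilon> = (1 / \<epsilon>) ^ (2 * l - 1)"
  proof -
    obtain n where "2 * l = Suc n" using \<open>k < l\<close> by (cases l) auto
    then show ?thesis using eps by simp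
  qed
  have "(1 / \<epsilon>) ^ (2 * l - 1) \<le> cmod (leaf \<epsilon> a b l y)"
    using leaf_norm(1)[OF y, of l] lo by simp
  also have "\<dots> \<le> (1 / \<epsilon>) ^ Suc (2 * k)" using leaf_norm(2)[OF x, of k] eq by simp
  finally have le: "(1 / \<epsilon>) ^ (2 * l - 1) \<le> (1 / \<epsilon>) ^ Suc (2 * k)" .
  then have "2 * l - 1 \<le> Suc (2 * k)" using power_le_imp_le_exp[OF g] by blast
  then have l: "l = Suc k" using \<open>k < l\<close> by linarith
  then have "cmod (leaf \<epsilon> a b k x) = (1 / \<epsilon>) ^ Suc (2 * k)"
    using leaf_norm(1)[OF y, of l] lo leaf_norm(2)[OF x, of k] eq by simp
  then have bx: "bnd \<epsilon> a b k x" using leaf_norm(3)[OF x] by simp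
  then have "leaf \<epsilon> a b l x = leaf \<epsilon> a b l y" using leaf_bnd[OF x] l eq by simp
  then have "x = y" using inj_onD[OF leaf_inj _ x y] by blast
  then show ?thesis using l bx by blast
qed

end

text \<open>On \<open>K\<close> the distance to \<open>a\<close> is bounded below and the distance
  to \<open>b\<close> above, so an Apollonius disc around \<open>a\<close> of small ratio misses
  \<open>K\<close>.\<close>

lemma far_from_point:
  fixes a b :: complex
  assumes "compact K" "a \<notin> K"
  shows "\<exists>\<delta>>0. \<forall>\<epsilon>. 0 < \<epsilon> \<longrightarrow> \<epsilon> < \<delta> \<longrightarrow> (\<forall>x\<in>K. cmod (x - a) > \<epsilon> * cmod (x - b))"
proof -
  obtain d where d: "d > 0" "\<And>x. x \<in> K \<Longrightarrow> d \<le> dist a x"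
    using separate_point_closed[OF compact_imp_closed[OF assms(1)] assms(2)] by blast
  obtain B where B: "B > 0" "\<And>x. x \<in> K \<Longrightarrow> cmod x \<le> B"
    using compact_imp_bounded[OF assms(1)] by (meson bounded_pos)
  have Bb: "B + cmod b > 0" using B by (simp add: add_pos_nonneg)
  show ?thesis
  proof (intro exI[of _ "d / (B + cmod b)"] conjI allI impI ballI)
    show "d / (B + cmod b) > 0" using d Bb by simp
  next
    fix \<epsilon> x assume e: "0 < \<epsilon>" "\<epsilon> < d / (B + cmod b)" and x: "x \<in> K"
    have "cmod (x - b) \<le> B + cmod b" using norm_triangle_ineq4[of x b] B(2)[OF x] by linarith
    then have "\<epsilon> * cmod (x - b) \<le> \<epsilon> * (B + cmod b)" using e by simp
    also have "\<dots> < d" using e Bb by (simp add: field_simps)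
    also have "\<dots> \<le> cmod (x - a)" using d(2)[OF x] by (simp add: dist_norm norm_minus_commute)
    finally show "cmod (x - a) > \<epsilon> * cmod (x - b)" .
  qed
qed

text \<open>Mirroring: \<open>z\<close> and \<open>w\<close> are moved to \<open>0\<close> and \<open>\<infinity>\<close> by a Moebius map, and the part of the
  drawing outside small discs around them is reflected repeatedly in the boundary circles.
  A spoke to \<open>z\<close> or \<open>w\<close>, cut at the circle, then continues into its mirror image.\<close>

lemma planar_stacked:
  fixes p :: "'v \<Rightarrow> complex"
  assumes fin: "finite U" and st: "straight p U E" and zw: "z \<noteq> w" "z \<in> U" "w \<in> U"
    and V: "V \<subseteq> U - {z, w}"
    and S: "\<And>e. e \<in> S \<Longrightarrow> e \<in> E \<and> e \<subseteq> V"
    and P: "\<And>v k. v \<in> P k \<Longrightarrow> v \<in> V \<and> {v, if even k then w else z} \<in> E"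
  shows "planar (V \<times> {..<m}) (stacked m S P)"
proof -
  define H where "H e = convex hull (p ` e)" for e
  define a where "a = p z"
  define b where "b = p w"
  have inj: "inj_on p U" using st by (simp add: straight_def)
  have EU: "card e = 2" "e \<subseteq> U" "H e \<inter> p ` U \<subseteq> p ` e" if "e \<in> E" for e
    using st that by (auto simp: straight_def H_def)
  have HH: "H e \<inter> H e' \<subseteq> p ` (e \<inter> e')" if "e \<in> E" "e' \<in> E" "e \<noteq> e'" for e e'
    using st that by (auto simp: straight_def H_def)
  have "a \<noteq> b" using inj zw by (auto simp: a_def b_def dest: inj_onD)
  have finE: "finite E" using EU(2) fin by (meson Pow_iff finite_Pow_iff finite_subset subsetI)
  have finp: "finite e" if "e \<in> E" for e using EU(1)[OF that] by (metis card.infinite zero_neq_numeral)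
  \<comment> \<open>All of the drawing that does not end at \<open>c\<close>. It is compact and
    misses the point of \<open>c\<close>, so a small disc around that point meets only edges ending
    at \<open>c\<close>.\<close>
  define K where "K c = p ` (U - {c}) \<union> (\<Union>e\<in>{e\<in>E. c \<notin> e}. H e)" for c
  have compK: "compact (K c)" for c
    unfolding K_def H_def using fin finE finp
    by (intro compact_Un compact_UN finite_imp_compact compact_convex_hull) auto
  have notK: "p c \<notin> K c" if "c \<in> U" for c
  proof
    assume "p c \<in> K c"
    then consider x where "x \<in> U" "x \<noteq> c" "p c = p x" | e where "e \<in> E" "c \<notin> e" "p c \<in> H e"
      unfolding K_def by blast
    then show False
    proof cases
      case 1 then show ?thesis using inj that by (auto dest: inj_onD)
    next
      case 2
      then have "p c \<in> p ` e" using EU(3) that by blast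
      then obtain y where "y \<in> e" "p c = p y" by blast
      then show ?thesis using inj that 2 EU(2) by (metis inj_onD subsetD)
    qed
  qed
  obtain \<delta>1 where d1: "\<delta>1 > 0" "\<And>\<epsilon>. 0 < \<epsilon> \<Longrightarrow> \<epsilon> < \<delta>1 \<Longrightarrow> (\<forall>x\<in>K z. cmod (x - a) > \<epsilon> * cmod (x - b))"
    using far_from_point[OF compK notK[OF zw(2)], of b] unfolding a_def by blast
  obtain \<delta>2 where d2: "\<delta>2 > 0" "\<And>\<epsilon>. 0 < \<epsilon> \<Longrightarrow> \<epsilon> < \<delta>2 \<Longrightarrow> (\<forall>x\<in>K w. cmod (x - b) > \<epsilon> * cmod (x - a))"
    using far_from_point[OF compK notK[OF zw(3)], of a] unfolding b_def by blast
  define \<epsilon> where "\<epsilon> = min (1/2) (min \<delta>1 \<delta>2 / 2)"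
  have eps: "0 < \<epsilon>" "\<epsilon> < 1" "\<epsilon> < \<delta>1" "\<epsilon> < \<delta>2" using d1(1) d2(1) by (auto simp: \<epsilon>_def)
  have Ka: "cmod (x - a) > \<epsilon> * cmod (x - b)" if "x \<in> K z" for x using d1(2) eps that by blast
  have Kb: "cmod (x - b) > \<epsilon> * cmod (x - a)" if "x \<in> K w" for x using d2(2) eps that by blast
  define \<Omega> where "\<Omega> = ann \<epsilon> a b"
  define \<Phi> where "\<Phi> = leaf \<epsilon> a b"
  define B where "B = bnd \<epsilon> a b"
  have cont: "continuous_on \<Omega> (\<Phi> k)" for k unfolding \<Omega>_def \<Phi>_def by (rule leaf_cont[OF eps(1,2) \<open>a \<noteq> b\<close>])
  have \<Phi>inj: "inj_on (\<Phi> k) \<Omega>" for k unfolding \<Omega>_def \<Phi>_def by (rule leaf_inj[OF eps(1,2) \<open>a \<noteq> b\<close>])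
  have \<Phi>eq: "l = Suc k \<and> x = y \<and> B k x" if "x \<in> \<Omega>" "y \<in> \<Omega>" "k < l" "\<Phi> k x = \<Phi> l y" for k l x y
    using leaf_eqD[OF eps(1,2) \<open>a \<noteq> b\<close>] that unfolding \<Omega>_def \<Phi>_def B_def by blast
  have \<Phi>B: "\<Phi> (Suc k) x = \<Phi> k x" if "x \<in> \<Omega>" "B k x" for k x
    using leaf_bnd[OF eps(1,2) \<open>a \<noteq> b\<close>] that unfolding \<Omega>_def \<Phi>_def B_def by blast
  have inner: "x \<in> \<Omega> \<and> \<not> B k x" if "x \<in> K z" "x \<in> K w" for x k
    using Ka[OF that(1)] Kb[OF that(2)] by (auto simp: \<Omega>_def ann_def B_def bnd_def)
  have pV: "p v \<in> K z" "p v \<in> K w" if "v \<in> V" for v using V that unfolding K_def by auto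
  have H_inner: "H e \<subseteq> K z" "H e \<subseteq> K w" if "e \<in> E" "e \<subseteq> V" for e
    using V that unfolding K_def by auto
  have H_O: "H e \<subseteq> \<Omega>" if "e \<in> E" "e \<subseteq> V" for e
  proof
    fix x assume "x \<in> H e"
    then have "x \<in> K z" "x \<in> K w" using H_inner[OF that] by auto
    then show "x \<in> \<Omega>" using inner by blast
  qed
  \<comment> \<open>The pole whose circle is shared by the copies \<open>k\<close> and
    \<open>k + 1\<close>; the parity is that of \<open>bnd\<close>.\<close>
  define po where "po k = (if even k then w else z)" for k :: nat
  have po: "po k \<in> U" "po k \<notin> V" "po (Suc k) \<noteq> po k" for k using zw V by (auto simp: po_def)
  \<comment> \<open>The cut spoke meets only the circle of its own pole, and that one only in the
    cut point \<open>d\<close>. As \<open>bnd\<close> depends on the index through its parity alone,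
    this reads \<open>even (j + k)\<close>.\<close>
  have spoke: "\<exists>d. d \<in> H {v, po k} \<and> B k d \<and> closed_segment (p v) d \<subseteq> H {v, po k} \<inter> \<Omega> \<and>
      (\<forall>x\<in>closed_segment (p v) d. \<forall>j. B j x \<longrightarrow> x = d \<and> even (j + k))" if v: "v \<in> P k" for v k
  proof -
    have e: "{v, po k} \<in> E" "v \<in> V" using P[OF v] by (auto simp: po_def)
    have "po (Suc k) \<notin> {v, po k}" using po(2,3) e(2) by (metis insert_iff singletonD)
    then have HK: "H {v, po k} \<subseteq> K (po (Suc k))" using e unfolding K_def by blast
    define g where "g x = (if even k then cmod (x - b) - \<epsilon> * cmod (x - a) else cmod (x - a) - \<epsilon> * cmod (x - b))" for x
    have "continuous_on UNIV g" unfolding g_def by (cases "even k") (auto intro!: continuous_intros)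
    moreover have "g (p v) > 0" using Ka[OF pV(1)[OF e(2)]] Kb[OF pV(2)[OF e(2)]] by (simp add: g_def)
    moreover have "g (p (po k)) \<le> 0" using eps by (simp add: g_def po_def a_def b_def)
    ultimately obtain d where d: "d \<in> closed_segment (p v) (p (po k))" "g d = 0"
        "\<And>x. x \<in> closed_segment (p v) d \<Longrightarrow> x \<noteq> d \<Longrightarrow> g x > 0"
      using segment_first_hit[of g "p v" "p (po k)"] by blast
    have Hs: "H {v, po k} = closed_segment (p v) (p (po k))" by (simp add: H_def segment_convex_hull)
    have sub: "closed_segment (p v) d \<subseteq> H {v, po k}"
      unfolding Hs using d(1) by (simp add: subset_closed_segment)
    have x: "x \<in> \<Omega> \<and> (B j x \<longrightarrow> x = d \<and> even (j + k))" if xs: "x \<in> closed_segment (p v) d" for x j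
    proof -
      have gx: "g x \<ge> 0" using d xs by (cases "x = d") (auto intro: less_imp_le)
      have "x \<in> K (po (Suc k))" using xs sub HK by blast
      then have ot: "(if even k then cmod (x - a) > \<epsilon> * cmod (x - b) else cmod (x - b) > \<epsilon> * cmod (x - a))"
        using Ka Kb by (auto simp: po_def split: if_splits)
      show ?thesis
      proof (intro conjI impI)
        show "x \<in> \<Omega>" using gx ot by (auto simp: \<Omega>_def ann_def g_def split: if_splits)
        assume Bj: "B j x"
        show "even (j + k)" using Bj gx ot by (auto simp: B_def bnd_def g_def split: if_splits)
        then show "x = d" using Bj d(3)[OF xs] by (auto simp: B_def bnd_def g_def split: if_splits)
      qed
    qed
    have "B k d" using d(2) by (auto simp: B_def bnd_def g_def split: if_splits)
    then show ?thesis using sub x d(1) Hs by (intro exI[of _ d]) auto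
  qed
  define c where "c v k = (SOME d. d \<in> H {v, po k} \<and> B k d \<and> closed_segment (p v) d \<subseteq> H {v, po k} \<inter> \<Omega> \<and>
      (\<forall>x\<in>closed_segment (p v) d. \<forall>j. B j x \<longrightarrow> x = d \<and> even (j + k)))" for v k
  have c: "B k (c v k)" "closed_segment (p v) (c v k) \<subseteq> H {v, po k} \<inter> \<Omega>"
      "\<And>x j. x \<in> closed_segment (p v) (c v k) \<Longrightarrow> B j x \<Longrightarrow> x = c v k \<and> even (j + k)" if "v \<in> P k" for v k
    using someI_ex[OF spoke[OF that]] unfolding c_def by blast+
  define f where "f q = \<Phi> (snd q) (p (fst q))" for q
  \<comment> \<open>A piece is the part of the edge \<open>e\<close> drawn in copy \<open>k\<close>:
    \<open>T\<close> is its preimage in the annulus and \<open>e0\<close> the straight edge carrying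
    \<open>T\<close>. A path edge has two pieces with the same \<open>T\<close>, one in copy
    \<open>j\<close> and one in copy \<open>j + 1\<close>.\<close>
  define piece where "piece e k T e0 \<longleftrightarrow> (e0 \<in> S \<and> e = (\<lambda>u. (u, k)) ` e0 \<and> T = H e0) \<or>
     (\<exists>v j. v \<in> P j \<and> (k = j \<or> k = Suc j) \<and> e = {(v, j), (v, Suc j)} \<and> e0 = {v, po j} \<and> T = closed_segment (p v) (c v j))"
    for e k T e0
  have pieceE: thesis
    if "piece e k T e0" "e0 \<in> S \<Longrightarrow> e = (\<lambda>u. (u, k)) ` e0 \<Longrightarrow> T = H e0 \<Longrightarrow> thesis"
      "\<And>v j. v \<in> P j \<Longrightarrow> k = j \<or> k = Suc j \<Longrightarrow> e = {(v, j), (v, Suc j)} \<Longrightarrow> e0 = {v, po j} \<Longrightarrow>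
         T = closed_segment (p v) (c v j) \<Longrightarrow> thesis" for e k T e0 thesis
    using that unfolding piece_def by blast
  have pc: "T \<subseteq> \<Omega> \<inter> H e0" "e0 \<in> E" "u \<in> e0 \<Longrightarrow> u \<in> V \<Longrightarrow> (u, k) \<in> e" if "piece e k T e0" for e k T e0 u
  proof -
    have Ppo: "{v, po k} \<in> E" if "v \<in> P k" for v k using P[OF that] by (simp add: po_def)
    have "T \<subseteq> \<Omega> \<inter> H e0 \<and> e0 \<in> E"
      using that
    proof (rule pieceE)
      assume "e0 \<in> S" "T = H e0"
      then show ?thesis using S H_O by auto
    next
      fix v j assume "v \<in> P j" "e0 = {v, po j}" "T = closed_segment (p v) (c v j)"
      then show ?thesis using c(2) Ppo by auto
    qed
    then show "T \<subseteq> \<Omega> \<inter> H e0" "e0 \<in> E" by auto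
    show "(u, k) \<in> e" if "u \<in> e0" "u \<in> V"
      using \<open>piece e k T e0\<close>
    proof (rule pieceE)
      fix v j assume "v \<in> P j" "e0 = {v, po j}" "k = j \<or> k = Suc j" "e = {(v, j), (v, Suc j)}"
      moreover have "u \<noteq> po j" using po(2) that by metis
      ultimately show ?thesis using that by auto
    qed (use that in auto)
  qed
  have pcB: "\<exists>v j. v \<in> P j \<and> (k = j \<or> k = Suc j) \<and> e = {(v, j), (v, Suc j)} \<and> e0 = {v, po j} \<and> x = c v j \<and> even (i + j)"
    if "piece e k T e0" "x \<in> T" "B i x" for e k T e0 x i
    using that(1) unfolding piece_def
  proof (elim disjE)
    assume "e0 \<in> S \<and> e = (\<lambda>u. (u, k)) ` e0 \<and> T = H e0"
    then have "x \<in> K z" "x \<in> K w" using H_inner[of e0] S[of e0] that(2) by auto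
    then show ?thesis using inner that(3) by blast
  next
    assume "\<exists>v j. v \<in> P j \<and> (k = j \<or> k = Suc j) \<and> e = {(v, j), (v, Suc j)} \<and> e0 = {v, po j} \<and> T = closed_segment (p v) (c v j)"
    then obtain v j where "v \<in> P j" "k = j \<or> k = Suc j" "e = {(v, j), (v, Suc j)}" "e0 = {v, po j}" "T = closed_segment (p v) (c v j)"
      by blast
    then show ?thesis using c(3)[of v j x i] that by (intro exI[of _ v] exI[of _ j]) auto
  qed
  \<comment> \<open>Within one copy, \<open>e0\<close> determines \<open>e\<close>: the spokes seen
    in copy \<open>k\<close> have index \<open>k\<close> or \<open>k - 1\<close>, and these lead to
    different poles.\<close>
  have uniq: "e = e'" if 1: "piece e k T e0" "piece e' k T' e0" for e e' k T T' e0
  proof -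
    have *: "j = j'" if "po j = po j'" "k = j \<or> k = Suc j" "k = j' \<or> k = Suc j'" for j j'
      using that po(3)[of j] po(3)[of j'] by auto
    have A: "\<not> ({v, po j} \<in> S)" for v j using S[of "{v, po j}"] po(2)[of j] by blast
    show ?thesis using 1(1)
    proof (rule pieceE)
      assume h: "e0 \<in> S" "e = (\<lambda>u. (u, k)) ` e0"
      show ?thesis using 1(2) by (rule pieceE) (use h A in auto)
    next
      fix v j assume h: "v \<in> P j" "k = j \<or> k = Suc j" "e = {(v, j), (v, Suc j)}" "e0 = {v, po j}"
      show ?thesis using 1(2)
      proof (rule pieceE)
        assume "e0 \<in> S" then show ?thesis using A h by simp
      next
        fix v' j' assume h': "v' \<in> P j'" "k = j' \<or> k = Suc j'" "e' = {(v', j'), (v', Suc j')}" "e0 = {v', po j'}"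
        have "v \<in> V" "v' \<in> V" using h h' P by auto
        then have "po j = po j'" "v = v'" using h(4) h'(4) po(2) by (metis doubleton_eq_iff)+
        then show ?thesis using *[of j j'] h h' by simp
      qed
    qed
  qed
  \<comment> \<open>Pieces in different copies can meet only on a shared circle, hence in cut
    points. Different straight edges to one pole meet only in the pole, which lies off the
    annulus.\<close>
  have same: "e = e'" if 1: "piece e k T e0" "piece e' l T' e0'" "k < l" "x \<in> T" "y \<in> T'" "\<Phi> k x = \<Phi> l y" for e e' k l T T' e0 e0' x y
  proof -
    have "x \<in> \<Omega>" "y \<in> \<Omega>" using pc(1) 1 by blast+
    then have l: "l = Suc k" "x = y" "B k x" using \<Phi>eq 1 by blast+
    obtain v j where v: "v \<in> P j" "k = j \<or> k = Suc j" "e = {(v, j), (v, Suc j)}" "e0 = {v, po j}" "x = c v j" "even (k + j)"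
      using pcB[OF 1(1,4) l(3)] by blast
    obtain v' j' where v': "v' \<in> P j'" "l = j' \<or> l = Suc j'" "e' = {(v', j'), (v', Suc j')}" "e0' = {v', po j'}" "x = c v' j'" "even (k + j')"
      using pcB[OF 1(2), of x k] l 1(5) by blast
    have j: "j = k" "j' = k" using v(2,6) v'(2,6) l(1) by auto
    have "e0 \<in> E" "e0' \<in> E" "x \<in> H e0" "x \<in> H e0'" using pc 1 l by blast+
    moreover have "x \<notin> p ` V" using l(3) inner pV by blast
    moreover have "x \<noteq> p (po k)"
    proof
      assume "x = p (po k)"
      moreover have "x \<noteq> a" "x \<noteq> b" using ann_pos[OF eps(1,2) \<open>a \<noteq> b\<close>] \<open>x \<in> \<Omega>\<close> unfolding \<Omega>_def by blast+
      ultimately show False by (auto simp: po_def a_def b_def split: if_splits)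
    qed
    moreover have "v \<in> V" "v' \<in> V" using v v' P by auto
    ultimately have "e0 = e0'" using HH[of e0 e0'] v(4) v'(4) j by blast
    then have "v = v'" using v(4) v'(4) j po(2) \<open>v \<in> V\<close> \<open>v' \<in> V\<close> by (metis doubleton_eq_iff)
    then show ?thesis using v(3) v'(3) j by simp
  qed
  have common: "q \<in> f ` (e \<inter> e')"
    if 1: "piece e k T e0" "piece e' l T' e0'" "e \<noteq> e'" "x \<in> T" "y \<in> T'" "q = \<Phi> k x" "q = \<Phi> l y" for e e' k l T T' e0 e0' x y q
  proof -
    have kl: "k = l" using same[of e k T e0 e' l T' e0' x y] same[of e' l T' e0' e k T e0 y x] 1
      by (metis linorder_neqE_nat)
    have xO: "x \<in> \<Omega>" "y \<in> \<Omega>" using pc(1) 1 by blast+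
    then have xy: "x = y" using inj_onD[OF \<Phi>inj] 1 kl by metis
    have "e0 \<noteq> e0'" using uniq 1 kl by blast
    then have "x \<in> p ` (e0 \<inter> e0')" using HH pc(1,2) 1 xy by blast
    then obtain u where u: "u \<in> e0" "u \<in> e0'" "x = p u" by blast
    have "x \<noteq> a" "x \<noteq> b" using ann_pos[OF eps(1,2) \<open>a \<noteq> b\<close>] xO unfolding \<Omega>_def by blast+
    then have "u \<noteq> z" "u \<noteq> w" using u by (auto simp: a_def b_def)
    have "u \<in> V"
    proof -
      from 1(1) show ?thesis
      proof (rule pieceE)
        assume "e0 \<in> S" then show ?thesis using S u by blast
      next
        fix v j assume "v \<in> P j" "e0 = {v, po j}"
        then show ?thesis using u \<open>u \<noteq> z\<close> \<open>u \<noteq> w\<close> P[of v j] by (auto simp: po_def split: if_splits)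
      qed
    qed
    then have "(u, k) \<in> e \<inter> e'" using pc(3) 1 kl u by blast
    moreover have "q = f (u, k)" using u 1 by (simp add: f_def)
    ultimately show ?thesis by blast
  qed
  have vert: "(v, i) \<in> e" if h: "piece e k T e0" "x \<in> T" "v \<in> V" "f (v, i) = \<Phi> k x" for e k T e0 x v i
  proof -
    have xO: "x \<in> \<Omega>" using pc(1) h by blast
    have vO: "p v \<in> \<Omega>" "\<And>j. \<not> B j (p v)" using inner pV h by blast+
    have "i = k"
    proof (rule ccontr)
      assume "i \<noteq> k"
      then consider "i < k" | "k < i" by linarith
      then show False
      proof cases
        case 1 then show ?thesis using \<Phi>eq[OF vO(1) xO 1] h vO(2) by (auto simp: f_def)
      next
        case 2
        then have "x = p v \<and> B k x" using \<Phi>eq[OF xO vO(1) 2] h by (auto simp: f_def)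
        then show ?thesis using vO(2) by blast
      qed
    qed
    then have "x = p v" using inj_onD[OF \<Phi>inj _ xO vO(1), of k] h by (simp add: f_def)
    then have "p v \<in> H e0" using pc(1)[OF h(1)] h(2) by auto
    moreover have "v \<in> U" using V h(3) by auto
    ultimately have "p v \<in> p ` e0" using EU(3)[OF pc(2)[OF h(1)]] by auto
    then obtain u where u: "u \<in> e0" "p u = p v" by auto
    then have "u \<in> U" using EU(2)[OF pc(2)[OF h(1)]] by auto
    then have "v \<in> e0" using inj_onD[OF inj u(2) _ \<open>v \<in> U\<close>] u(1) by simp
    then show ?thesis using pc(3) h \<open>i = k\<close> by blast
  qed
  have arcT: "arc (\<Phi> k \<circ> linepath x y)" if "x \<noteq> y" "closed_segment x y \<subseteq> \<Omega>" for x y k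
    unfolding arc_def
  proof
    show "path (\<Phi> k \<circ> linepath x y)"
      by (rule path_continuous_image) (use continuous_on_subset[OF cont] that in auto)
    have "inj_on (linepath x y) {0..1}" using arc_linepath[OF that(1)] by (simp add: arc_def)
    moreover have "inj_on (\<Phi> k) (linepath x y ` {0..1})"
      using inj_on_subset[OF \<Phi>inj] that(2) by (simp add: path_image_linepath[unfolded path_image_def])
    ultimately show "inj_on (\<Phi> k \<circ> linepath x y) {0..1}" by (rule comp_inj_on)
  qed
  have pimT: "path_image (\<Phi> k \<circ> linepath x y) = \<Phi> k ` closed_segment x y" for x y k
    by (simp add: path_image_compose)
  have curve: "\<exists>g. (\<exists>u v. e = {u, v} \<and> u \<noteq> v \<and> u \<in> V \<times> {..<m} \<and> v \<in> V \<times> {..<m} \<and> arc g \<and> pathstart g = f u \<and>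
      pathfinish g = f v) \<and> (\<forall>q\<in>path_image g. \<exists>k T e0 x. piece e k T e0 \<and> x \<in> T \<and> q = \<Phi> k x)"
    if e: "e \<in> stacked m S P" for e
  proof -
    from e consider e0 k where "e0 \<in> S" "k < m" "e = (\<lambda>u. (u, k)) ` e0"
      | v k where "v \<in> P k" "Suc k < m" "e = {(v, k), (v, Suc k)}" unfolding stacked_def by blast
    then show ?thesis
    proof cases
      case (1 e0 k)
      obtain u v where uv: "e0 = {u, v}" "u \<noteq> v" using EU(1) S[OF 1(1)] by (meson card_2_iff)
      have V2: "u \<in> V" "v \<in> V" using S[OF 1(1)] uv by auto
      have Hs: "H e0 = closed_segment (p u) (p v)" using uv by (simp add: H_def segment_convex_hull)
      have sub: "closed_segment (p u) (p v) \<subseteq> \<Omega>" using inner H_inner S[OF 1(1)] Hs by blast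
      have ne: "p u \<noteq> p v" using inj V2 uv V by (auto dest: inj_onD)
      have pie: "piece e k (H e0) e0" using 1 unfolding piece_def by blast
      show ?thesis
      proof (intro exI[of _ "\<Phi> k \<circ> linepath (p u) (p v)"] conjI ballI)
        show "\<exists>u' v'. e = {u', v'} \<and> u' \<noteq> v' \<and> u' \<in> V \<times> {..<m} \<and> v' \<in> V \<times> {..<m} \<and> arc (\<Phi> k \<circ> linepath (p u) (p v)) \<and>
            pathstart (\<Phi> k \<circ> linepath (p u) (p v)) = f u' \<and> pathfinish (\<Phi> k \<circ> linepath (p u) (p v)) = f v'"
          using 1 uv V2 arcT[OF ne sub, of k]
          by (intro exI[of _ "(u, k)"] exI[of _ "(v, k)"]) (auto simp: f_def pathstart_compose pathfinish_compose)
      next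
        fix q assume "q \<in> path_image (\<Phi> k \<circ> linepath (p u) (p v))"
        then show "\<exists>k T e0 x. piece e k T e0 \<and> x \<in> T \<and> q = \<Phi> k x" using pie unfolding pimT Hs by blast
      qed
    next
      case (2 v k)
      have vV: "v \<in> V" using P 2 by blast
      define L where "L = linepath (p v) (c v k)"
      have sub: "closed_segment (p v) (c v k) \<subseteq> \<Omega>" and Bc: "B k (c v k)" using c[OF 2(1)] by auto
      have ne: "p v \<noteq> c v k" using Bc inner pV vV by metis
      have cO: "c v k \<in> \<Omega>" using sub by auto
      have arcs: "arc (\<Phi> k \<circ> L)" "arc (reversepath (\<Phi> (Suc k) \<circ> L))"
        unfolding L_def using arcT[OF ne sub] by (auto intro: arc_reversepath)
      \<comment> \<open>Both halves come from the same segment, so a common point lies on the shared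
        circle and must be the cut point; the halves therefore join to an arc.\<close>
      have "path_image (\<Phi> k \<circ> L) \<inter> path_image (reversepath (\<Phi> (Suc k) \<circ> L)) \<subseteq> {\<Phi> (Suc k) (c v k)}"
      proof
        fix q assume "q \<in> path_image (\<Phi> k \<circ> L) \<inter> path_image (reversepath (\<Phi> (Suc k) \<circ> L))"
        then obtain x y where xy: "x \<in> closed_segment (p v) (c v k)" "y \<in> closed_segment (p v) (c v k)"
          "q = \<Phi> k x" "q = \<Phi> (Suc k) y" unfolding L_def by (auto simp: pimT)
        then have "x = y" "B k x" using \<Phi>eq[of x y k "Suc k"] sub by auto
        then have "y = c v k" using c(3)[OF 2(1) xy(1)] by simp
        then show "q \<in> {\<Phi> (Suc k) (c v k)}" using xy(4) by simp
      qed
      then have arc: "arc ((\<Phi> k \<circ> L) +++ reversepath (\<Phi> (Suc k) \<circ> L))"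
        using arcs \<Phi>B[OF cO Bc] by (intro arc_join) (auto simp: L_def pathstart_compose pathfinish_compose)
      have pie: "piece e k (closed_segment (p v) (c v k)) {v, po k}" "piece e (Suc k) (closed_segment (p v) (c v k)) {v, po k}"
        using 2 unfolding piece_def by blast+
      show ?thesis
      proof (intro exI[of _ "(\<Phi> k \<circ> L) +++ reversepath (\<Phi> (Suc k) \<circ> L)"] conjI ballI)
        show "\<exists>u' v'. e = {u', v'} \<and> u' \<noteq> v' \<and> u' \<in> V \<times> {..<m} \<and> v' \<in> V \<times> {..<m} \<and>
            arc ((\<Phi> k \<circ> L) +++ reversepath (\<Phi> (Suc k) \<circ> L)) \<and>
            pathstart ((\<Phi> k \<circ> L) +++ reversepath (\<Phi> (Suc k) \<circ> L)) = f u' \<and>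
            pathfinish ((\<Phi> k \<circ> L) +++ reversepath (\<Phi> (Suc k) \<circ> L)) = f v'"
          using 2 vV arc
          by (intro exI[of _ "(v, k)"] exI[of _ "(v, Suc k)"]) (auto simp: f_def L_def pathstart_compose pathfinish_compose)
      next
        fix q assume "q \<in> path_image ((\<Phi> k \<circ> L) +++ reversepath (\<Phi> (Suc k) \<circ> L))"
        then have "q \<in> path_image (\<Phi> k \<circ> L) \<or> q \<in> path_image (\<Phi> (Suc k) \<circ> L)"
          using path_image_join_subset[of "\<Phi> k \<circ> L" "reversepath (\<Phi> (Suc k) \<circ> L)"] by auto
        then show "\<exists>k T e0 x. piece e k T e0 \<and> x \<in> T \<and> q = \<Phi> k x" using pie unfolding L_def pimT by blast
      qed
    qed
  qed
  then obtain \<gamma> where \<gamma>: "\<And>e. e \<in> stacked m S P \<Longrightarrow> (\<exists>u v. e = {u, v} \<and> u \<noteq> v \<and> u \<in> V \<times> {..<m} \<and> v \<in> V \<times> {..<m} \<and>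
      arc (\<gamma> e) \<and> pathstart (\<gamma> e) = f u \<and> pathfinish (\<gamma> e) = f v) \<and>
      (\<forall>q\<in>path_image (\<gamma> e). \<exists>k T e0 x. piece e k T e0 \<and> x \<in> T \<and> q = \<Phi> k x)"
    by metis
  show ?thesis
    unfolding planar_def
  proof (intro exI[of _ f] exI[of _ \<gamma>] conjI ballI impI)
    show "inj_on f (V \<times> {..<m})"
    proof (rule inj_onI)
      fix s t assume s: "s \<in> V \<times> {..<m}" "t \<in> V \<times> {..<m}" "f s = f t"
      obtain u i where [simp]: "s = (u, i)" by (cases s)
      obtain v j where [simp]: "t = (v, j)" by (cases t)
      have uv: "u \<in> V" "v \<in> V" using s by auto
      have O: "p u \<in> \<Omega>" "p v \<in> \<Omega>" "\<And>k. \<not> B k (p u)" "\<And>k. \<not> B k (p v)" using inner pV uv by blast+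
      have "i = j" using \<Phi>eq[of "p u" "p v" i j] \<Phi>eq[of "p v" "p u" j i] O s by (auto simp: f_def) (metis linorder_neqE_nat)
      then have "p u = p v" using inj_onD[OF \<Phi>inj _ O(1,2), of i] s by (simp add: f_def)
      then have "u = v" using inj V uv by (metis Diff_iff inj_onD subsetD)
      then show "s = t" using \<open>i = j\<close> by simp
    qed
  next
    fix e assume e: "e \<in> stacked m S P"
    obtain u v where uv: "e = {u, v}" "u \<noteq> v" "u \<in> V \<times> {..<m}" "v \<in> V \<times> {..<m}" "arc (\<gamma> e)" "pathstart (\<gamma> e) = f u"
      "pathfinish (\<gamma> e) = f v" using \<gamma>[OF e] by blast
    have "f u \<in> path_image (\<gamma> e)" "f v \<in> path_image (\<gamma> e)"
      using uv(6,7) by (metis pathstart_in_path_image, metis pathfinish_in_path_image)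
    moreover have "path_image (\<gamma> e) \<inter> f ` (V \<times> {..<m}) \<subseteq> {f u, f v}"
    proof
      fix q assume q: "q \<in> path_image (\<gamma> e) \<inter> f ` (V \<times> {..<m})"
      then obtain x i where xi: "x \<in> V" "q = f (x, i)" by auto
      obtain k T e0 y where "piece e k T e0" "y \<in> T" "q = \<Phi> k y" using \<gamma>[OF e] q by blast
      then have "(x, i) \<in> e" using vert[of e k T e0 y x i] xi by simp
      then show "q \<in> {f u, f v}" using xi uv(1) by auto
    qed
    moreover have "f u \<in> f ` (V \<times> {..<m})" "f v \<in> f ` (V \<times> {..<m})" using uv(3,4) by simp_all
    ultimately have "path_image (\<gamma> e) \<inter> f ` (V \<times> {..<m}) = {f u, f v}" by auto
    with uv show "\<exists>u v. e = {u, v} \<and> u \<noteq> v \<and> u \<in> V \<times> {..<m} \<and> v \<in> V \<times> {..<m} \<and> arc (\<gamma> e) \<and> pathstart (\<gamma> e) = f u \<and>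
        pathfinish (\<gamma> e) = f v \<and> path_image (\<gamma> e) \<inter> f ` (V \<times> {..<m}) = {f u, f v}"
      by (rule_tac exI[of _ u], rule_tac exI[of _ v]) simp
  next
    fix e e' assume e: "e \<in> stacked m S P" "e' \<in> stacked m S P" "e \<noteq> e'"
    show "path_image (\<gamma> e) \<inter> path_image (\<gamma> e') \<subseteq> f ` (e \<inter> e')"
    proof
      fix q assume q: "q \<in> path_image (\<gamma> e) \<inter> path_image (\<gamma> e')"
      obtain k T e0 x where 1: "piece e k T e0" "x \<in> T" "q = \<Phi> k x" using \<gamma>[OF e(1)] q by blast
      obtain l T' e0' y where 2: "piece e' l T' e0'" "y \<in> T'" "q = \<Phi> l y" using \<gamma>[OF e(2)] q by blast
      show "q \<in> f ` (e \<inter> e')" using common[OF 1(1) 2(1) e(3) 1(2) 2(2) 1(3) 2(3)] .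
    qed
  qed
qed

section \<open>Stacking and splitting faces\<close>

text \<open>Real ranks leave room directly below the rank of \<open>t i\<close>; the new vertex
  takes that place in every order at once.\<close>

lemma insert_below:
  fixes R :: "nat \<Rightarrow> 'v \<Rightarrow> real"
  assumes "finite V" "w \<notin> V"
  shows "\<exists>R'. (\<forall>i. \<forall>x\<in>V. R' i x = R i x \<and> (R' i x < R' i w \<longleftrightarrow> R i x < R i (t i)) \<and> (R' i w < R' i x \<longleftrightarrow> R i (t i) \<le> R i x))"
proof -
  have "\<exists>c. c < R i (t i) \<and> (\<forall>x\<in>V. R i x < R i (t i) \<longrightarrow> R i x < c)" for i
  proof -
    define M where "M = Max (insert (R i (t i) - 1) {R i x | x. x \<in> V \<and> R i x < R i (t i)})"
    have f: "finite (insert (R i (t i) - 1) {R i x | x. x \<in> V \<and> R i x < R i (t i)})"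
      using assms(1) by simp
    have "M < R i (t i)" unfolding M_def using f by (subst Max_less_iff) auto
    moreover have "R i x \<le> M" if "x \<in> V" "R i x < R i (t i)" for x
      unfolding M_def using f that by (intro Max_ge) auto
    ultimately show ?thesis
      by (intro exI[of _ "(M + R i (t i)) / 2"]) (force simp: field_simps)
  qed
  then obtain c where c: "\<And>i. c i < R i (t i)" "\<And>i x. x \<in> V \<Longrightarrow> R i x < R i (t i) \<Longrightarrow> R i x < c i"
    by metis
  show ?thesis
  proof (intro exI[of _ "\<lambda>i. (R i)(w := c i)"] allI ballI conjI)
    fix i x assume x: "x \<in> V"
    then have "x \<noteq> w" using assms(2) by auto
    then show "((R i)(w := c i)) x = R i x"
      "(((R i)(w := c i)) x < ((R i)(w := c i)) w) = (R i x < R i (t i))"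
      "(((R i)(w := c i)) w < ((R i)(w := c i)) x) = (R i (t i) \<le> R i x)"
      using c(1)[of i] c(2)[OF x, of i] by (auto simp: not_less[symmetric] intro: order.strict_trans)
  qed
qed

lemma separatingI:
  assumes "\<And>t e x. t \<in> K \<Longrightarrow> e \<subseteq> t \<Longrightarrow> x \<in> V \<Longrightarrow> x \<notin> e \<Longrightarrow> \<exists>i<3. \<forall>y\<in>e. R i y < R i x"
  shows "separating R V K"
  unfolding separating_def using assms by blast

text \<open>Each of the three orders has a different corner of the face on top, and \<open>w\<close>
  goes directly below that corner. Whatever exceeds the whole face still exceeds \<open>w\<close>.
  Every other face lacks a corner of this one, and in an order where that corner exceeds a part of
  the face, so does \<open>w\<close>.\<close>

lemma separating_stack:
  fixes R :: "nat \<Rightarrow> 'v \<Rightarrow> real"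
  assumes fin: "finite V" and sep: "separating R V K" and KV: "\<And>t. t \<in> K \<Longrightarrow> t \<subseteq> V \<and> card t = 3"
    and abc: "{a, b, c} \<in> K" "w \<notin> V"
  shows "\<exists>R'. separating R' (insert w V) (K - {{a, b, c}} \<union> {{a, b, w}, {a, c, w}, {b, c, w}})"
proof -
  have d: "a \<noteq> b" "a \<noteq> c" "b \<noteq> c" using KV[OF abc(1)] by (auto simp: card_insert_if split: if_splits)
  have V: "a \<in> V" "b \<in> V" "c \<in> V" using KV[OF abc(1)] by auto
  obtain ia where ia: "ia < 3" "R ia b < R ia a" "R ia c < R ia a"
    using separatingD[OF sep abc(1), of "{b, c}" a] V d by auto
  obtain ib where ib: "ib < 3" "R ib a < R ib b" "R ib c < R ib b"
    using separatingD[OF sep abc(1), of "{a, c}" b] V d by auto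
  obtain ic where ic: "ic < 3" "R ic a < R ic c" "R ic b < R ic c"
    using separatingD[OF sep abc(1), of "{a, b}" c] V d by auto
  have ne: "ia \<noteq> ib" "ia \<noteq> ic" "ib \<noteq> ic" using ia ib ic by auto
  have i3: "i = ia \<or> i = ib \<or> i = ic" if "i < 3" for i using that ia(1) ib(1) ic(1) ne by linarith
  define t where "t i = (if i = ia then a else if i = ib then b else c)" for i
  obtain R' where R': "\<And>i x. x \<in> V \<Longrightarrow> R' i x = R i x"
      "\<And>i x. x \<in> V \<Longrightarrow> R' i x < R' i w \<longleftrightarrow> R i x < R i (t i)" "\<And>i x. x \<in> V \<Longrightarrow> R' i w < R' i x \<longleftrightarrow> R i (t i) \<le> R i x"
    using insert_below[OF fin abc(2), of R t] by blast
  have tt: "t ia = a" "t ib = b" "t ic = c" using ne by (auto simp: t_def)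
  have F: "R' ia w < R' ia a" "R' ia b < R' ia a" "R' ia c < R' ia a" "R' ia b < R' ia w" "R' ia c < R' ia w"
      "R' ib w < R' ib b" "R' ib a < R' ib b" "R' ib c < R' ib b" "R' ib a < R' ib w" "R' ib c < R' ib w"
      "R' ic w < R' ic c" "R' ic a < R' ic c" "R' ic b < R' ic c" "R' ic a < R' ic w" "R' ic b < R' ic w"
    using R' V ia ib ic tt by auto
  have top: "R i y \<le> R i (t i)" if "i < 3" "y \<in> {a, b, c}" for i y
    using i3[OF that(1)] that(2) ia ib ic tt by auto
  have tV: "t i \<in> {a, b, c}" for i by (auto simp: t_def)
  have out: "\<exists>i<3. \<forall>y\<in>{a, b, c, w}. R' i y < R' i x" if h: "x \<in> V" "x \<notin> {a, b, c}" for x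
  proof -
    obtain i where i: "i < 3" "\<forall>y\<in>{a, b, c}. R i y < R i x"
      using separatingD[OF sep abc(1) subset_refl h] by blast
    have "R' i w < R' i x" using R'(3)[OF h(1)] i(2) tV by (metis less_imp_le)
    then show ?thesis using i R'(1) V h(1) by (intro exI[of _ i]) auto
  qed
  have new: "\<exists>i<3. \<forall>y\<in>e. R' i y < R' i x" if h: "s \<in> {{a, b, w}, {a, c, w}, {b, c, w}}" "e \<subseteq> s" "x \<in> insert w V" "x \<notin> e" for s e x
  proof -
    consider "x \<in> V" "x \<notin> {a, b, c}" | "x = a" | "x = b" | "x = c" | "x = w" using h(3) by blast
    then show ?thesis
    proof cases
      case 1
      then obtain i where "i < 3" "\<forall>y\<in>{a, b, c, w}. R' i y < R' i x" using out by blast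
      moreover have "e \<subseteq> {a, b, c, w}" using h(1,2) by auto
      ultimately show ?thesis by blast
    next
      case 2 then have "e \<subseteq> {b, c, w}" using h by auto
      then show ?thesis using F ia(1) 2 by (intro exI[of _ ia]) auto
    next
      case 3 then have "e \<subseteq> {a, c, w}" using h by auto
      then show ?thesis using F ib(1) 3 by (intro exI[of _ ib]) auto
    next
      case 4 then have "e \<subseteq> {a, b, w}" using h by auto
      then show ?thesis using F ic(1) 4 by (intro exI[of _ ic]) auto
    next
      case 5
      then have "e \<subseteq> {a, b} \<or> e \<subseteq> {a, c} \<or> e \<subseteq> {b, c}" using h by auto
      then show ?thesis
      proof (elim disjE)
        assume "e \<subseteq> {a, b}" then show ?thesis using F ic(1) 5 by (intro exI[of _ ic]) auto
      next
        assume "e \<subseteq> {a, c}" then show ?thesis using F ib(1) 5 by (intro exI[of _ ib]) auto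
      next
        assume "e \<subseteq> {b, c}" then show ?thesis using F ia(1) 5 by (intro exI[of _ ia]) auto
      qed
    qed
  qed
  have old: "\<exists>i<3. \<forall>y\<in>e. R' i y < R' i x" if h: "s \<in> K" "s \<noteq> {a, b, c}" "e \<subseteq> s" "x \<in> insert w V" "x \<notin> e" for s e x
  proof -
    have eV: "e \<subseteq> V" using KV[OF h(1)] h(3) by auto
    show ?thesis
    proof (cases "x = w")
      case False
      then have x: "x \<in> V" using h by auto
      obtain i where "i < 3" "\<forall>y\<in>e. R i y < R i x" using separatingD[OF sep h(1,3) x h(5)] by blast
      then show ?thesis using R'(1) x eV by (intro exI[of _ i]) (auto simp: subset_iff)
    next
      case True
      have "\<not> {a, b, c} \<subseteq> e"
      proof
        assume "{a, b, c} \<subseteq> e"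
        then have "{a, b, c} \<subseteq> s" using h by auto
        moreover have "finite s" "card s = card {a, b, c}" using KV[OF h(1)] d by (auto intro: card_ge_0_finite)
        ultimately show False using h(2) by (metis card_subset_eq)
      qed
      then obtain y where y: "y \<in> {a, b, c}" "y \<notin> e" by auto
      then have "y \<in> V" using V by auto
      then obtain i where i: "i < 3" "\<forall>z\<in>e. R i z < R i y" using separatingD[OF sep h(1,3) _ y(2)] by blast
      have "R' i z < R' i w" if "z \<in> e" for z
        using R'(2)[of z i] that eV i(2) top[OF i(1) y(1)] by fastforce
      then show ?thesis using i(1) True by blast
    qed
  qed
  have "separating R' (insert w V) (K - {{a, b, c}} \<union> {{a, b, w}, {a, c, w}, {b, c, w}})"
  proof (rule separatingI)
    fix s e x assume s: "s \<in> K - {{a, b, c}} \<union> {{a, b, w}, {a, c, w}, {b, c, w}}" and h: "e \<subseteq> s" "x \<in> insert w V" "x \<notin> e"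
    show "\<exists>i<3. \<forall>y\<in>e. R' i y < R' i x"
      using s
    proof (rule UnE)
      assume "s \<in> K - {{a, b, c}}"
      then show ?thesis using old[OF _ _ h] by simp
    next
      assume "s \<in> {{a, b, w}, {a, c, w}, {b, c, w}}"
      then show ?thesis by (rule new[OF _ h])
    qed
  qed
  then show ?thesis by blast
qed

text \<open>In every order \<open>w\<close> goes directly below the higher end of the edge
  \<open>uv\<close>: this is \<open>u\<close> in order \<open>k\<close> and \<open>v\<close> in the
  two orders where \<open>b\<close> or \<open>c\<close> is highest. Each face other than the two at
  \<open>uv\<close> misses an end of \<open>uv\<close>, and in an order where that end exceeds a
  part of the face, so does \<open>w\<close>.\<close>

lemma separating_split_aux:
  fixes R :: "nat \<Rightarrow> 'v \<Rightarrow> real"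
  assumes fin: "finite V" and sep: "separating R V K" and KV: "\<And>t. t \<in> K \<Longrightarrow> t \<subseteq> V \<and> card t = 3"
    and f: "{u, v, b} \<in> K" "{u, v, c} \<in> K" and w: "w \<notin> V"
    and d: "distinct [u, v, b, c]"
    and k: "k < 3" "R k v < R k u" "R k b < R k u" "R k c < R k u"
    and ib: "ib < 3" "R ib u < R ib v" "R ib c < R ib v" "R ib v < R ib b"
    and ic: "ic < 3" "R ic u < R ic v" "R ic b < R ic v" "R ic v < R ic c"
  shows "\<exists>R'. separating R' (insert w V) (K - {{u, v, b}, {u, v, c}} \<union> {{u, w, b}, {w, v, b}, {u, w, c}, {w, v, c}})"
proof -
  have V: "u \<in> V" "v \<in> V" "b \<in> V" "c \<in> V" using KV[OF f(1)] KV[OF f(2)] by auto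
  have ne: "k \<noteq> ib" "k \<noteq> ic" "ib \<noteq> ic" using k ib ic by auto
  have i3: "i = k \<or> i = ib \<or> i = ic" if "i < 3" for i using that k(1) ib(1) ic(1) ne by linarith
  \<comment> \<open>An edge has no third face: its corner \<open>x\<close> would lie below
    \<open>u\<close> in order \<open>k\<close> but above \<open>v\<close> in the orders
    \<open>ib\<close> and \<open>ic\<close>, so in no order would \<open>v\<close> exceed both
    \<open>u\<close> and \<open>x\<close>.\<close>
  have third: False if h: "s \<in> K" "s \<noteq> {u, v, b}" "s \<noteq> {u, v, c}" "u \<in> s" "v \<in> s" for s
  proof -
    have cs: "card s = 3" "finite s" using KV[OF h(1)] by (auto intro: card_ge_0_finite)
    have "card (s - {u, v}) = 1" using cs h d by (subst card_Diff_subset) auto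
    then obtain x where "s - {u, v} = {x}" by (auto simp: card_1_singleton_iff)
    then have s: "s = {u, v, x}" "x \<noteq> u" "x \<noteq> v" using h by auto
    have xbc: "x \<noteq> b" "x \<noteq> c" "x \<in> V" using s h KV[OF h(1)] by auto
    obtain i1 where i1: "i1 < 3" "R i1 v < R i1 u" "R i1 x < R i1 u"
      using separatingD[OF sep h(1), of "{v, x}" u] s V d by auto
    then have k2: "R k x < R k u" using i3[of i1] ib ic by auto
    obtain i2 where i2: "i2 < 3" "R i2 u < R i2 v" "R i2 x < R i2 v"
      using separatingD[OF sep h(1), of "{u, x}" v] s V d by auto
    obtain i3' where i3': "i3' < 3" "R i3' u < R i3' b" "R i3' v < R i3' b" "R i3' x < R i3' b"
      using separatingD[OF sep h(1), of "{u, v, x}" b] s V d xbc by auto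
    then have b2: "R ib x < R ib b" using i3[of i3'] k ic by auto
    obtain i4 where i4: "i4 < 3" "R i4 u < R i4 c" "R i4 v < R i4 c" "R i4 x < R i4 c"
      using separatingD[OF sep h(1), of "{u, v, x}" c] s V d xbc by auto
    then have c2: "R ic x < R ic c" using i3[of i4] k ib by auto
    obtain i5 where i5: "i5 < 3" "R i5 u < R i5 x" "R i5 v < R i5 x" "R i5 b < R i5 x"
      using separatingD[OF sep f(1), of "{u, v, b}" x] s xbc by auto
    then have c3: "R ic v < R ic x" using i3[of i5] k2 b2 by auto
    obtain i6 where i6: "i6 < 3" "R i6 u < R i6 x" "R i6 v < R i6 x" "R i6 c < R i6 x"
      using separatingD[OF sep f(2), of "{u, v, c}" x] s xbc by auto
    then have b3: "R ib v < R ib x" using i3[of i6] k2 c2 by auto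
    show False using i3[OF i2(1)] i2 c3 b3 k by auto
  qed
  define t where "t i = (if i = k then u else v)" for i
  obtain R' where R': "\<And>i x. x \<in> V \<Longrightarrow> R' i x = R i x"
      "\<And>i x. x \<in> V \<Longrightarrow> R' i x < R' i w \<longleftrightarrow> R i x < R i (t i)" "\<And>i x. x \<in> V \<Longrightarrow> R' i w < R' i x \<longleftrightarrow> R i (t i) \<le> R i x"
    using insert_below[OF fin w, of R t] by blast
  have tt: "t k = u" "t ib = v" "t ic = v" using ne by (auto simp: t_def)
  have F: "R' k v < R' k u" "R' k b < R' k u" "R' k c < R' k u" "R' k w < R' k u" "R' k v < R' k w" "R' k b < R' k w" "R' k c < R' k w"
      "R' ib u < R' ib v" "R' ib c < R' ib v" "R' ib v < R' ib b" "R' ib u < R' ib b" "R' ib c < R' ib b" "R' ib w < R' ib v" "R' ib w < R' ib b"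
      "R' ib u < R' ib w" "R' ib c < R' ib w"
      "R' ic u < R' ic v" "R' ic b < R' ic v" "R' ic v < R' ic c" "R' ic u < R' ic c" "R' ic b < R' ic c" "R' ic w < R' ic v" "R' ic w < R' ic c"
      "R' ic u < R' ic w" "R' ic b < R' ic w"
    using R' V k ib ic tt by auto
  have tV: "t i = u \<or> t i = v" for i by (auto simp: t_def)
  have out: "\<exists>i<3. R' i u < R' i x \<and> R' i v < R' i x \<and> R' i y < R' i x \<and> R' i w < R' i x"
    if h: "{u, v, y} \<in> K" "x \<in> V" "x \<notin> {u, v, y}" for x y
  proof -
    obtain i where i: "i < 3" "R i u < R i x" "R i v < R i x" "R i y < R i x"
      using separatingD[OF sep h(1) subset_refl h(2,3)] by auto
    have "R' i w < R' i x" using R'(3)[OF h(2), of i] i tV[of i] by auto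
    moreover have "y \<in> V" using KV[OF h(1)] by auto
    ultimately show ?thesis using i R'(1) V h(2) by (intro exI[of _ i]) auto
  qed
  have newb: "\<exists>i<3. \<forall>y\<in>e. R' i y < R' i x" if h: "s \<in> {{u, w, b}, {w, v, b}}" "e \<subseteq> s" "x \<in> insert w V" "x \<notin> e" for s e x
  proof -
    consider "x \<in> V" "x \<notin> {u, v, b}" | "x = u" | "x = v" | "x = b" | "x = w" using h(3) by blast
    then show ?thesis
    proof cases
      case 1
      then obtain i where "i < 3" "R' i u < R' i x \<and> R' i v < R' i x \<and> R' i b < R' i x \<and> R' i w < R' i x" using out[OF f(1)] by blast
      moreover have "e \<subseteq> {u, v, b, w}" using h(1,2) by auto
      ultimately show ?thesis by (intro exI[of _ i]) auto
    next
      case 2 then have "e \<subseteq> {w, v, b}" using h by auto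
      then show ?thesis using F k(1) 2 by (intro exI[of _ k]) auto
    next
      case 3 then have "e \<subseteq> {u, w, b}" using h by auto
      then show ?thesis using F ic(1) 3 by (intro exI[of _ ic]) auto
    next
      case 4 then have "e \<subseteq> {u, v, w}" using h by auto
      then show ?thesis using F ib(1) 4 by (intro exI[of _ ib]) auto
    next
      case 5
      then have "e \<subseteq> {u, b} \<or> e \<subseteq> {v, b}" using h by auto
      then show ?thesis
      proof (elim disjE)
        assume "e \<subseteq> {u, b}" then show ?thesis using F ic(1) 5 by (intro exI[of _ ic]) auto
      next
        assume "e \<subseteq> {v, b}" then show ?thesis using F k(1) 5 by (intro exI[of _ k]) auto
      qed
    qed
  qed
  have newc: "\<exists>i<3. \<forall>y\<in>e. R' i y < R' i x" if h: "s \<in> {{u, w, c}, {w, v, c}}" "e \<subseteq> s" "x \<in> insert w V" "x \<notin> e" for s e x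
  proof -
    consider "x \<in> V" "x \<notin> {u, v, c}" | "x = u" | "x = v" | "x = c" | "x = w" using h(3) by blast
    then show ?thesis
    proof cases
      case 1
      then obtain i where "i < 3" "R' i u < R' i x \<and> R' i v < R' i x \<and> R' i c < R' i x \<and> R' i w < R' i x" using out[OF f(2)] by blast
      moreover have "e \<subseteq> {u, v, c, w}" using h(1,2) by auto
      ultimately show ?thesis by (intro exI[of _ i]) auto
    next
      case 2 then have "e \<subseteq> {w, v, c}" using h by auto
      then show ?thesis using F k(1) 2 by (intro exI[of _ k]) auto
    next
      case 3 then have "e \<subseteq> {u, w, c}" using h by auto
      then show ?thesis using F ib(1) 3 by (intro exI[of _ ib]) auto
    next
      case 4 then have "e \<subseteq> {u, v, w}" using h by auto
      then show ?thesis using F ic(1) 4 by (intro exI[of _ ic]) auto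
    next
      case 5
      then have "e \<subseteq> {u, c} \<or> e \<subseteq> {v, c}" using h by auto
      then show ?thesis
      proof (elim disjE)
        assume "e \<subseteq> {u, c}" then show ?thesis using F ib(1) 5 by (intro exI[of _ ib]) auto
      next
        assume "e \<subseteq> {v, c}" then show ?thesis using F k(1) 5 by (intro exI[of _ k]) auto
      qed
    qed
  qed
  have old: "\<exists>i<3. \<forall>y\<in>e. R' i y < R' i x" if h: "s \<in> K" "s \<noteq> {u, v, b}" "s \<noteq> {u, v, c}" "e \<subseteq> s" "x \<in> insert w V" "x \<notin> e" for s e x
  proof -
    have eV: "e \<subseteq> V" using KV[OF h(1)] h(4) by auto
    show ?thesis
    proof (cases "x = w")
      case False
      then have x: "x \<in> V" using h by auto
      obtain i where "i < 3" "\<forall>y\<in>e. R i y < R i x" using separatingD[OF sep h(1,4) x h(6)] by blast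
      then show ?thesis using R'(1) x eV by (intro exI[of _ i]) (auto simp: subset_iff)
    next
      case True
      have "u \<notin> e \<or> v \<notin> e" using third[OF h(1-3)] h(4) by blast
      then obtain y where y: "y = u \<or> y = v" "y \<notin> e" by blast
      then have "y \<in> V" using V by auto
      then obtain i where i: "i < 3" "\<forall>z\<in>e. R i z < R i y" using separatingD[OF sep h(1,4) _ y(2)] by blast
      have "R i y \<le> R i (t i)" using i3[OF i(1)] y(1) k ib ic tt by auto
      then have "R' i z < R' i w" if "z \<in> e" for z
        using R'(2)[of z i] that eV i(2) by fastforce
      then show ?thesis using i(1) True by blast
    qed
  qed
  have "separating R' (insert w V) (K - {{u, v, b}, {u, v, c}} \<union> {{u, w, b}, {w, v, b}, {u, w, c}, {w, v, c}})"
  proof (rule separatingI)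
    fix s e x assume "s \<in> K - {{u, v, b}, {u, v, c}} \<union> {{u, w, b}, {w, v, b}, {u, w, c}, {w, v, c}}" and h: "e \<subseteq> s" "x \<in> insert w V" "x \<notin> e"
    then consider "s \<in> K" "s \<noteq> {u, v, b}" "s \<noteq> {u, v, c}" | "s \<in> {{u, w, b}, {w, v, b}}" | "s \<in> {{u, w, c}, {w, v, c}}"
      by (elim UnE DiffE insertE emptyE) simp_all
    then show "\<exists>i<3. \<forall>y\<in>e. R' i y < R' i x"
    proof cases
      case 1 then show ?thesis using old[OF _ _ _ h] by simp
    next
      case 2 then show ?thesis by (rule newb[OF _ h])
    next
      case 3 then show ?thesis by (rule newc[OF _ h])
    qed
  qed
  then show ?thesis by blast
qed

text \<open>The orders in which \<open>b\<close> and \<open>c\<close> are highest differ. In the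
  remaining one, the same end of \<open>uv\<close> is highest in both faces, either \<open>u\<close>
  or \<open>v\<close>, and exchanging the names of the ends reduces both cases to the preceding
  lemma.\<close>

lemma separating_split:
  fixes R :: "nat \<Rightarrow> 'v \<Rightarrow> real"
  assumes fin: "finite V" and sep: "separating R V K" and KV: "\<And>t. t \<in> K \<Longrightarrow> t \<subseteq> V \<and> card t = 3"
    and f: "{u, v, b} \<in> K" "{u, v, c} \<in> K" and w: "w \<notin> V" and "b \<noteq> c"
  shows "\<exists>R'. separating R' (insert w V) (K - {{u, v, b}, {u, v, c}} \<union> {{u, w, b}, {w, v, b}, {u, w, c}, {w, v, c}})"
proof -
  have d: "distinct [u, v, b, c]" using KV[OF f(1)] KV[OF f(2)] \<open>b \<noteq> c\<close> by (auto simp: card_insert_if split: if_splits)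
  have V: "u \<in> V" "v \<in> V" "b \<in> V" "c \<in> V" using KV[OF f(1)] KV[OF f(2)] by auto
  obtain ib where ib: "ib < 3" "R ib u < R ib b" "R ib v < R ib b" "R ib c < R ib b"
    using separatingD[OF sep f(2), of "{u, v, c}" b] V d by auto
  obtain ic where ic: "ic < 3" "R ic u < R ic c" "R ic v < R ic c" "R ic b < R ic c"
    using separatingD[OF sep f(1), of "{u, v, b}" c] V d by auto
  have nbc: "ib \<noteq> ic" using ib ic by auto
  obtain iv where iv: "iv < 3" "R iv u < R iv v" "R iv b < R iv v"
    using separatingD[OF sep f(1), of "{u, b}" v] V d by auto
  obtain iu where iu: "iu < 3" "R iu v < R iu u" "R iu b < R iu u"
    using separatingD[OF sep f(1), of "{v, b}" u] V d by auto
  obtain jv where jv: "jv < 3" "R jv u < R jv v" "R jv c < R jv v"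
    using separatingD[OF sep f(2), of "{u, c}" v] V d by auto
  obtain ju where ju: "ju < 3" "R ju v < R ju u" "R ju c < R ju u"
    using separatingD[OF sep f(2), of "{v, c}" u] V d by auto
  have n1: "iv \<noteq> ib" "iu \<noteq> ib" "jv \<noteq> ic" "ju \<noteq> ic" "iu \<noteq> iv" "ju \<noteq> jv" using ib ic iv iu jv ju by auto
  \<comment> \<open>The indices are 0, 1 and 2, so the remaining one is 3 minus the other
    two.\<close>
  define k where "k = 3 - ib - ic"
  have i3: "i = ib \<or> i = ic \<or> i = k" if "i < 3" for i unfolding k_def using that ib(1) ic(1) nbc by linarith
  have "iv \<in> {ic, k}" "iu \<in> {ic, k}" "jv \<in> {ib, k}" "ju \<in> {ib, k}" "jv \<noteq> iu" "iv \<noteq> ju"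
    using i3[OF iu(1)] i3[OF iv(1)] i3[OF jv(1)] i3[OF ju(1)] n1 jv iu iv ju by auto
  then have "(iv = ic \<and> jv = ib \<and> iu = ju) \<or> (iu = ic \<and> ju = ib \<and> iv = jv)"
    using n1 by (elim insertE emptyE) simp_all
  then show ?thesis
  proof (elim disjE conjE)
    assume e: "iv = ic" "jv = ib" "iu = ju"
    show ?thesis
      by (rule separating_split_aux[OF fin sep KV f w d, of iu ib ic]) (use e ib ic iu iv jv ju in auto)
  next
    assume e: "iu = ic" "ju = ib" "iv = jv"
    have d': "distinct [v, u, b, c]" using d by auto
    have f': "{v, u, b} \<in> K" "{v, u, c} \<in> K" using f by (simp_all add: insert_commute)
    have "\<exists>R'. separating R' (insert w V) (K - {{v, u, b}, {v, u, c}} \<union> {{v, w, b}, {w, u, b}, {v, w, c}, {w, u, c}})"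
      by (rule separating_split_aux[OF fin sep KV f' w d', of iv ib ic]) (use e ib ic iu iv jv ju in auto)
    moreover have "K - {{v, u, b}, {v, u, c}} \<union> {{v, w, b}, {w, u, b}, {v, w, c}, {w, u, c}} =
        K - {{u, v, b}, {u, v, c}} \<union> {{u, w, b}, {w, v, b}, {u, w, c}, {w, v, c}}"
      by (auto simp: insert_commute)
    ultimately show ?thesis by simp
  qed
qed

section \<open>Subdividing an edge into a path between two poles\<close>

fun strip :: "'v list \<Rightarrow> 'v \<Rightarrow> 'v \<Rightarrow> 'v set set" where
  "strip (x # y # zs) b c = {{x, y, b}, {x, y, c}} \<union> strip (y # zs) b c"
| "strip _ b c = {}"

text \<open>The last edge is split again and again: after \<open>w\<close> splits \<open>uv\<close>,
  the two faces at \<open>uw\<close> are final and move to \<open>K\<close>, and the rest of the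
  path goes into \<open>wv\<close>.\<close>

lemma separating_strip:
  fixes R :: "nat \<Rightarrow> 'v \<Rightarrow> real"
  assumes "finite V" "separating R V (K \<union> {{u, v, b}, {u, v, c}})"
    and "\<And>t. t \<in> K \<union> {{u, v, b}, {u, v, c}} \<Longrightarrow> t \<subseteq> V \<and> card t = 3"
    and "{u, v, b} \<notin> K" "{u, v, c} \<notin> K" "b \<noteq> c" "distinct ws" "set ws \<inter> V = {}"
  shows "\<exists>R'. separating R' (V \<union> set ws) (K \<union> strip (u # ws @ [v]) b c)"
  using assms
proof (induction ws arbitrary: u V K R)
  case Nil
  then show ?case by auto
next
  case (Cons w ws)
  define F where "F = K \<union> {{u, v, b}, {u, v, c}}"
  have w: "w \<notin> V" using Cons.prems by auto
  have F3: "t \<subseteq> V \<and> card t = 3" if "t \<in> F" for t using Cons.prems(3) that unfolding F_def by blast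
  have inF: "{u, v, b} \<in> F" "{u, v, c} \<in> F" by (auto simp: F_def)
  have d: "distinct [u, v, b, c]" using F3[OF inF(1)] F3[OF inF(2)] \<open>b \<noteq> c\<close> by (auto simp: card_insert_if split: if_splits)
  have V: "u \<in> V" "v \<in> V" "b \<in> V" "c \<in> V" using F3[OF inF(1)] F3[OF inF(2)] by auto
  have wn: "w \<noteq> u" "w \<noteq> v" "w \<noteq> b" "w \<noteq> c" using V w by auto
  obtain R1 where R1: "separating R1 (insert w V) (F - {{u, v, b}, {u, v, c}} \<union> {{u, w, b}, {w, v, b}, {u, w, c}, {w, v, c}})"
    using separating_split[OF Cons.prems(1) Cons.prems(2)[folded F_def] F3 inF w \<open>b \<noteq> c\<close>] by blast
  have FK: "F - {{u, v, b}, {u, v, c}} = K" using Cons.prems(4,5) unfolding F_def by blast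
  define K1 where "K1 = K \<union> {{u, w, b}, {u, w, c}}"
  have K1: "K \<union> {{u, w, b}, {w, v, b}, {u, w, c}, {w, v, c}} = K1 \<union> {{w, v, b}, {w, v, c}}" unfolding K1_def by blast
  have KV: "t \<subseteq> V" if "t \<in> K" for t using F3[of t] that by (simp add: F_def)
  have "\<exists>R'. separating R' (insert w V \<union> set ws) (K1 \<union> strip (w # ws @ [v]) b c)"
  proof (rule Cons.IH)
    show "finite (insert w V)" using Cons.prems(1) by simp
    show "separating R1 (insert w V) (K1 \<union> {{w, v, b}, {w, v, c}})" using R1 unfolding FK K1 .
    show "t \<subseteq> insert w V \<and> card t = 3" if "t \<in> K1 \<union> {{w, v, b}, {w, v, c}}" for t
    proof -
      from that consider "t \<in> K" | "t = {u, w, b} \<or> t = {u, w, c} \<or> t = {w, v, b} \<or> t = {w, v, c}" unfolding K1_def by blast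
      then show ?thesis
      proof cases
        case 1 then show ?thesis using F3[of t] by (auto simp: F_def)
      next
        case 2 then show ?thesis using V wn d by (elim disjE) (simp_all)
      qed
    qed
    have "{w, v, x} \<notin> K1" if "x \<in> {b, c}" for x
    proof
      assume "{w, v, x} \<in> K1"
      then consider "{w, v, x} \<in> K" | "{w, v, x} = {u, w, b} \<or> {w, v, x} = {u, w, c}" unfolding K1_def by blast
      then show False
      proof cases
        case 1 then show False using KV w by auto
      next
        case 2
        then have "v \<in> {u, w, b} \<or> v \<in> {u, w, c}" by blast
        then show False using d wn by auto
      qed
    qed
    then show "{w, v, b} \<notin> K1" "{w, v, c} \<notin> K1" by auto
  qed (use Cons.prems in auto)
  then show ?case by (auto simp: K1_def Un_assoc insert_commute)
qed

section \<open>Planar graphs and decompositions of the product\<close>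

definition drawing :: "('a \<Rightarrow> complex) \<Rightarrow> ('a set \<Rightarrow> real \<Rightarrow> complex) \<Rightarrow> 'a set \<Rightarrow> 'a set set \<Rightarrow> bool" where
  "drawing f \<gamma> V E \<longleftrightarrow>
     inj_on f V \<and>
        (\<forall>e \<in> E. \<exists>u v. e = {u, v} \<and> u \<noteq> v \<and> u \<in> V \<and> v \<in> V \<and>
            arc (\<gamma> e) \<and> pathstart (\<gamma> e) = f u \<and> pathfinish (\<gamma> e) = f v \<and>
            path_image (\<gamma> e) \<inter> f ` V = {f u, f v}) \<and>
        (\<forall>e \<in> E. \<forall>e' \<in> E. e \<noteq> e' \<longrightarrow>
            path_image (\<gamma> e) \<inter> path_image (\<gamma> e') \<subseteq> f ` (e \<inter> e'))"

lemma planar_iff_drawing: "planar V E \<longleftrightarrow> (\<exists>f \<gamma>. drawing f \<gamma> V E)"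
  unfolding planar_def drawing_def ..

lemma drawingD:
  assumes "drawing f \<gamma> V E"
  shows "inj_on f V"
    and "\<And>e. e \<in> E \<Longrightarrow> \<exists>u v. e = {u, v} \<and> u \<noteq> v \<and> u \<in> V \<and> v \<in> V \<and>
            arc (\<gamma> e) \<and> pathstart (\<gamma> e) = f u \<and> pathfinish (\<gamma> e) = f v \<and> path_image (\<gamma> e) \<inter> f ` V = {f u, f v}"
    and "\<And>e e'. e \<in> E \<Longrightarrow> e' \<in> E \<Longrightarrow> e \<noteq> e' \<Longrightarrow> path_image (\<gamma> e) \<inter> path_image (\<gamma> e') \<subseteq> f ` (e \<inter> e')"
  using assms unfolding drawing_def by simp_all

text \<open>It serves both bounds: renaming constructed layers into layers of the product, and
  restricting a given layer to one copy of a complete graph.\<close>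

lemma planar_pullback:
  assumes pl: "planar V E" and h: "inj_on h W" "h ` W \<subseteq> V"
    and E': "\<And>e. e \<in> E' \<Longrightarrow> e \<subseteq> W \<and> h ` e \<in> E"
  shows "planar W E'"
proof -
  obtain f \<gamma> where D: "drawing f \<gamma> V E" using pl unfolding planar_iff_drawing by blast
  note inj = drawingD(1)[OF D] and ed = drawingD(2)[OF D] and cr = drawingD(3)[OF D]
  show ?thesis
    unfolding planar_iff_drawing drawing_def
  proof (intro exI[of _ "f \<circ> h"] exI[of _ "\<lambda>e. \<gamma> (h ` e)"] conjI ballI impI)
    show "inj_on (f \<circ> h) W" using comp_inj_on[OF h(1) inj_on_subset[OF inj h(2)]] .
  next
    fix e assume e: "e \<in> E'"
    have eW: "e \<subseteq> W" "h ` e \<in> E" using E'[OF e] by auto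
    obtain u' v' where uv': "h ` e = {u', v'}" "u' \<noteq> v'" "u' \<in> V" "v' \<in> V"
            "arc (\<gamma> (h ` e))" "pathstart (\<gamma> (h ` e)) = f u'" "pathfinish (\<gamma> (h ` e)) = f v'"
            "path_image (\<gamma> (h ` e)) \<inter> f ` V = {f u', f v'}"
      using ed[OF eW(2)] by blast
    obtain u where u: "u \<in> e" "h u = u'" using uv'(1) by (metis imageE insertI1)
    obtain v where v: "v \<in> e" "h v = v'" using uv'(1) by (metis imageE insert_iff)
    have W: "u \<in> W" "v \<in> W" using u v eW by auto
    have "h ` e = h ` {u, v}" using uv'(1) u v by simp
    then have euv: "e = {u, v}" using inj_on_image_eq_iff[OF h(1) eW(1), of "{u, v}"] W by simp
    have "path_image (\<gamma> (h ` e)) \<inter> (f \<circ> h) ` W = {f u', f v'}"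
    proof
      show "path_image (\<gamma> (h ` e)) \<inter> (f \<circ> h) ` W \<subseteq> {f u', f v'}"
        unfolding uv'(8)[symmetric] image_comp[symmetric] using image_mono[OF h(2), of f] by blast
      have "f u' \<in> path_image (\<gamma> (h ` e))" "f v' \<in> path_image (\<gamma> (h ` e))" using uv'(8) by auto
      then show "{f u', f v'} \<subseteq> path_image (\<gamma> (h ` e)) \<inter> (f \<circ> h) ` W" using u(2) v(2) W by auto
    qed
    then show "\<exists>u v. e = {u, v} \<and> u \<noteq> v \<and> u \<in> W \<and> v \<in> W \<and> arc (\<gamma> (h ` e)) \<and> pathstart (\<gamma> (h ` e)) = (f \<circ> h) u \<and>
        pathfinish (\<gamma> (h ` e)) = (f \<circ> h) v \<and> path_image (\<gamma> (h ` e)) \<inter> (f \<circ> h) ` W = {(f \<circ> h) u, (f \<circ> h) v}"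
      using euv W uv'(2,5,6,7) u(2) v(2) by (intro exI[of _ u] exI[of _ v]) auto
  next
    fix e e' assume e: "e \<in> E'" "e' \<in> E'" "e \<noteq> e'"
    have eW: "e \<subseteq> W" "e' \<subseteq> W" using E' e by auto
    have "h ` e \<noteq> h ` e'" using inj_on_image_eq_iff[OF h(1) eW] e by simp
    then have "path_image (\<gamma> (h ` e)) \<inter> path_image (\<gamma> (h ` e')) \<subseteq> f ` (h ` e \<inter> h ` e')"
      using cr E' e by blast
    also have "h ` e \<inter> h ` e' = h ` (e \<inter> e')" using inj_on_image_Int[OF h(1) eW] by simp
    finally show "path_image (\<gamma> (h ` e)) \<inter> path_image (\<gamma> (h ` e')) \<subseteq> (f \<circ> h) ` (e \<inter> e')"
      by (simp add: image_comp)
  qed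
qed

lemma planar_disjoint_union:
  assumes fin: "finite V1" "finite V2" and d: "V1 \<inter> V2 = {}" and pl: "planar V1 E1" "planar V2 E2"
  shows "planar (V1 \<union> V2) (E1 \<union> E2)"
proof -
  obtain f1 \<gamma>1 f2 \<gamma>2 where D: "drawing f1 \<gamma>1 V1 E1" "drawing f2 \<gamma>2 V2 E2"
    using pl unfolding planar_iff_drawing by blast
  note inj1 = drawingD(1)[OF D(1)] and ed1 = drawingD(2)[OF D(1)] and cr1 = drawingD(3)[OF D(1)]
    and inj2 = drawingD(1)[OF D(2)] and ed2 = drawingD(2)[OF D(2)] and cr2 = drawingD(3)[OF D(2)]
  have sub: "e \<subseteq> V1" "e \<noteq> {}" if "e \<in> E1" for e using ed1[OF that] by auto
  have sub2: "e \<subseteq> V2" "e \<noteq> {}" if "e \<in> E2" for e using ed2[OF that] by auto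
  have finE: "finite E1" "finite E2"
    using sub sub2 fin by (meson Pow_iff finite_Pow_iff finite_subset subsetI)+
  have dE: "e \<notin> E1" if "e \<in> E2" for e using sub(1)[of e] sub2[OF that] d by blast
  define X1 where "X1 = f1 ` V1 \<union> (\<Union>e\<in>E1. path_image (\<gamma>1 e))"
  define X2 where "X2 = f2 ` V2 \<union> (\<Union>e\<in>E2. path_image (\<gamma>2 e))"
  have "bounded (path_image (\<gamma>1 e))" if "e \<in> E1" for e
    using ed1[OF that] by (auto intro!: bounded_path_image arc_imp_path)
  then have "bounded X1" unfolding X1_def bounded_Un using fin finE bounded_UN[of E1 "\<lambda>e. path_image (\<gamma>1 e)"] by (simp add: finite_imp_bounded)
  moreover have "bounded (path_image (\<gamma>2 e))" if "e \<in> E2" for e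
    using ed2[OF that] by (auto intro!: bounded_path_image arc_imp_path)
  then have "bounded X2" unfolding X2_def bounded_Un using fin finE bounded_UN[of E2 "\<lambda>e. path_image (\<gamma>2 e)"] by (simp add: finite_imp_bounded)
  ultimately have "bounded (X1 \<union> X2)" by simp
  then obtain B where B: "B > 0" "\<And>x. x \<in> X1 \<union> X2 \<Longrightarrow> cmod x \<le> B" by (meson bounded_pos)
  \<comment> \<open>Both drawings lie in the disc of radius \<open>B\<close> about 0, so a shift by
    more than 2B separates them.\<close>
  define \<tau> where "\<tau> = complex_of_real (2 * B + 1)"
  have apart: "\<tau> + y \<noteq> x" if "x \<in> X1" "y \<in> X2" for x y
  proof
    assume "\<tau> + y = x"
    then have "\<tau> = x - y" by (simp add: algebra_simps)
    then have "cmod \<tau> \<le> cmod x + cmod y" by (simp add: norm_triangle_ineq4)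
    moreover have "cmod x \<le> B" "cmod y \<le> B" using B that by auto
    moreover have "cmod \<tau> = 2 * B + 1" unfolding \<tau>_def using B(1) by (simp only: norm_of_real)
    ultimately show False by simp
  qed
  define f where "f v = (if v \<in> V1 then f1 v else \<tau> + f2 v)" for v
  define \<gamma> where "\<gamma> e = (if e \<in> E1 then \<gamma>1 e else (\<lambda>x. \<tau> + x) \<circ> \<gamma>2 e)" for e
  have f1: "f ` A = f1 ` A" if "A \<subseteq> V1" for A using that unfolding f_def by force
  have f2: "f ` A = (\<lambda>x. \<tau> + x) ` f2 ` A" if "A \<subseteq> V2" for A
  proof -
    have "f v = \<tau> + f2 v" if "v \<in> A" for v using that \<open>A \<subseteq> V2\<close> d by (auto simp: f_def)
    then show ?thesis by (simp add: image_image)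
  qed
  have g1: "path_image (\<gamma> e) = path_image (\<gamma>1 e)" if "e \<in> E1" for e using that by (simp add: \<gamma>_def)
  have g2: "path_image (\<gamma> e) = (\<lambda>x. \<tau> + x) ` path_image (\<gamma>2 e)" if "e \<in> E2" for e
    using dE[OF that] by (simp add: \<gamma>_def path_image_translation)
  have X: "path_image (\<gamma>1 e) \<subseteq> X1" if "e \<in> E1" for e using that by (auto simp: X1_def)
  have Y: "path_image (\<gamma>2 e) \<subseteq> X2" if "e \<in> E2" for e using that by (auto simp: X2_def)
  have XV: "f1 ` V1 \<subseteq> X1" "f2 ` V2 \<subseteq> X2" by (auto simp: X1_def X2_def)
  have fU: "f ` (V1 \<union> V2) = f1 ` V1 \<union> (\<lambda>x. \<tau> + x) ` f2 ` V2" by (simp add: image_Un f1 f2)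
  have sep: "A \<inter> (\<lambda>x. \<tau> + x) ` C = {}" if "A \<subseteq> X1" "C \<subseteq> X2" for A C
    using apart that by (force simp: subset_iff)
  show ?thesis
    unfolding planar_iff_drawing drawing_def
  proof (intro exI[of _ f] exI[of _ \<gamma>] conjI ballI impI)
    show "inj_on f (V1 \<union> V2)"
    proof (rule inj_onI)
      fix u v assume h: "u \<in> V1 \<union> V2" "v \<in> V1 \<union> V2" "f u = f v"
      have a: "f u \<noteq> f v" if "u \<in> V1" "v \<in> V2" for u v
        using apart[of "f1 u" "f2 v"] that XV d by (auto simp: f_def dest: not_sym)
      have V2n: "v \<notin> V1" if "v \<in> V2" for v using that d by auto
      from h(1,2) consider "u \<in> V1" "v \<in> V1" | "u \<in> V1" "v \<in> V2" | "u \<in> V2" "v \<in> V1" | "u \<in> V2" "v \<in> V2" by blast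
      then show "u = v"
      proof cases
        case 1 then show ?thesis using h(3) inj_onD[OF inj1] by (simp add: f_def)
      next
        case 2 then show ?thesis using h(3) a by blast
      next
        case 3 then show ?thesis using h(3)[symmetric] a by blast
      next
        case 4 then show ?thesis using h(3) V2n inj_onD[OF inj2] by (simp add: f_def)
      qed
    qed
  next
    fix e assume "e \<in> E1 \<union> E2"
    then show "\<exists>u v. e = {u, v} \<and> u \<noteq> v \<and> u \<in> V1 \<union> V2 \<and> v \<in> V1 \<union> V2 \<and> arc (\<gamma> e) \<and> pathstart (\<gamma> e) = f u \<and>
        pathfinish (\<gamma> e) = f v \<and> path_image (\<gamma> e) \<inter> f ` (V1 \<union> V2) = {f u, f v}"
    proof
      assume e: "e \<in> E1"
      obtain u v where uv: "e = {u, v}" "u \<noteq> v" "u \<in> V1" "v \<in> V1" "arc (\<gamma>1 e)" "pathstart (\<gamma>1 e) = f1 u"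
        "pathfinish (\<gamma>1 e) = f1 v" "path_image (\<gamma>1 e) \<inter> f1 ` V1 = {f1 u, f1 v}" using ed1[OF e] by blast
      have "path_image (\<gamma> e) \<inter> f ` (V1 \<union> V2) = {f u, f v}"
        using g1[OF e] fU uv(3,4,8) sep[OF X[OF e] XV(2)] by (auto simp: f_def)
      then show ?thesis using uv e by (intro exI[of _ u] exI[of _ v]) (simp add: f_def \<gamma>_def)
    next
      assume e: "e \<in> E2"
      obtain u v where uv: "e = {u, v}" "u \<noteq> v" "u \<in> V2" "v \<in> V2" "arc (\<gamma>2 e)" "pathstart (\<gamma>2 e) = f2 u"
        "pathfinish (\<gamma>2 e) = f2 v" "path_image (\<gamma>2 e) \<inter> f2 ` V2 = {f2 u, f2 v}" using ed2[OF e] by blast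
      have fu: "f u = \<tau> + f2 u" "f v = \<tau> + f2 v" using uv d by (auto simp: f_def)
      have "path_image (\<gamma> e) \<inter> f ` (V1 \<union> V2) = (\<lambda>x. \<tau> + x) ` (path_image (\<gamma>2 e) \<inter> f2 ` V2)"
        unfolding g2[OF e] fU using sep[OF XV(1) Y[OF e]] by auto
      then have "path_image (\<gamma> e) \<inter> f ` (V1 \<union> V2) = {f u, f v}" unfolding uv(8) fu by simp
      moreover have "arc (\<gamma> e)" "pathstart (\<gamma> e) = f u" "pathfinish (\<gamma> e) = f v"
        using uv dE[OF e] fu by (simp_all add: \<gamma>_def arc_translation_eq pathstart_translation pathfinish_translation)
      ultimately show ?thesis using uv by (intro exI[of _ u] exI[of _ v]) simp
    qed
  next
    fix e e' assume h: "e \<in> E1 \<union> E2" "e' \<in> E1 \<union> E2" "e \<noteq> e'"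
    from h(1,2) consider "e \<in> E1" "e' \<in> E1" | "e \<in> E1" "e' \<in> E2" | "e \<in> E2" "e' \<in> E1" | "e \<in> E2" "e' \<in> E2" by blast
    then show "path_image (\<gamma> e) \<inter> path_image (\<gamma> e') \<subseteq> f ` (e \<inter> e')"
    proof cases
      case 1
      then have "e \<inter> e' \<subseteq> V1" using sub by blast
      then show ?thesis using cr1[OF 1 h(3)] by (simp add: g1 1 f1)
    next
      case 2 then show ?thesis using sep[OF X Y] by (simp add: g1 g2)
    next
      case 3 then show ?thesis using sep[OF X Y] by (simp add: g1 g2 Int_commute)
    next
      case 4
      have s: "e \<inter> e' \<subseteq> V2" using sub2 4 by blast
      have "path_image (\<gamma> e) \<inter> path_image (\<gamma> e') = (\<lambda>x. \<tau> + x) ` (path_image (\<gamma>2 e) \<inter> path_image (\<gamma>2 e'))"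
        unfolding g2[OF 4(1)] g2[OF 4(2)] by auto
      then show ?thesis using cr2[OF 4 h(3)] unfolding f2[OF s] by blast
    qed
  qed
qed

definition decomposable :: "'a graph \<Rightarrow> nat \<Rightarrow> bool" where
  "decomposable G k \<longleftrightarrow> (\<exists>Es :: nat \<Rightarrow> 'a set set.
      (\<forall>i < k. planar (fst G) (Es i)) \<and>
      (\<forall>i < k. \<forall>j < k. i \<noteq> j \<longrightarrow> Es i \<inter> Es j = {}) \<and>
      (\<Union>i < k. Es i) = snd G)"

lemma thickness_eqI:
  assumes "decomposable G k" "\<And>l. decomposable G l \<Longrightarrow> k \<le> l"
  shows "thickness G = k"
  unfolding thickness_def decomposable_def[symmetric] using assms by (rule Least_equality)

text \<open>Covering by planar graphs is enough, since each edge can be kept in the first layer that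
  contains it. The layer that supplies a path edge may depend on the copy \<open>j\<close>, and the
  injection \<open>g\<close> admits graphs smaller than the constructed one.\<close>

lemma decomposable_product:
  fixes V :: "'v set"
  assumes g: "inj_on g {0..<n}" "g ` {0..<n} \<subseteq> V"
    and pl: "\<And>i. i < k \<Longrightarrow> planar (V \<times> {..<m}) (stacked m (S i) (P i))"
    and S: "\<And>u v. u \<in> V \<Longrightarrow> v \<in> V \<Longrightarrow> u \<noteq> v \<Longrightarrow> \<exists>i<k. {u, v} \<in> S i"
    and P: "\<And>u j. u \<in> V \<Longrightarrow> \<exists>i<k. u \<in> P i j"
  shows "decomposable (cartesian_product (complete_graph n) (path_graph m)) k"
proof -
  define G where "G = cartesian_product (complete_graph n) (path_graph m)"
  define h where "h = (map_prod g id :: nat \<times> nat \<Rightarrow> 'v \<times> nat)"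
  define A where "A i = {e \<in> snd G. h ` e \<in> stacked m (S i) (P i)}" for i
  define Es where "Es i = A i - (\<Union>j<i. A j)" for i
  have V: "fst G = {0..<n} \<times> {0..<m}" by (simp add: G_def cartesian_product_def complete_graph_def path_graph_def)
  have sub: "e \<subseteq> fst G" if "e \<in> snd G" for e
    using that by (auto simp: G_def cartesian_product_def complete_graph_def path_graph_def doubleton_eq_iff)
  have "inj_on h (fst G)" using g(1) unfolding V h_def by (auto intro: map_prod_inj_on)
  moreover have "h ` fst G \<subseteq> V \<times> {..<m}" using g(2) unfolding V h_def by auto
  ultimately have plE: "planar (fst G) (Es i)" if "i < k" for i
    using planar_pullback[OF pl[OF that], of h "fst G" "Es i"] sub by (auto simp: Es_def A_def)
  have cov: "\<exists>i<k. e \<in> A i" if e: "e \<in> snd G" for e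
  proof -
    from e consider u1 u2 v where "e = {(u1, v), (u2, v)}" "u1 < n" "u2 < n" "u1 \<noteq> u2" "v < m"
      | u v where "e = {(u, v), (u, Suc v)}" "u < n" "Suc v < m"
      by (auto simp: G_def cartesian_product_def complete_graph_def path_graph_def doubleton_eq_iff) blast+
    then show ?thesis
    proof cases
      case (1 u1 u2 v)
      have "g u1 \<noteq> g u2" "g u1 \<in> V" "g u2 \<in> V" using 1 g by (auto dest: inj_onD)
      then obtain i where i: "i < k" "{g u1, g u2} \<in> S i" using S by blast
      have "h ` e = (\<lambda>u. (u, v)) ` {g u1, g u2}" using 1 by (simp add: h_def)
      then have "h ` e \<in> stacked m (S i) (P i)" using i(2) 1(5) unfolding stacked_def by blast
      then show ?thesis using i e by (auto simp: A_def)
    next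
      case (2 u v)
      have "g u \<in> V" using 2 g by auto
      then obtain i where i: "i < k" "g u \<in> P i v" using P by blast
      have "h ` e = {(g u, v), (g u, Suc v)}" using 2 by (simp add: h_def)
      then have "h ` e \<in> stacked m (S i) (P i)" using i(2) 2(3) unfolding stacked_def by blast
      then show ?thesis using i e by (auto simp: A_def)
    qed
  qed
  have "(\<forall>i<k. planar (fst G) (Es i)) \<and> (\<forall>i<k. \<forall>j<k. i \<noteq> j \<longrightarrow> Es i \<inter> Es j = {}) \<and> (\<Union>i<k. Es i) = snd G"
  proof (intro conjI allI impI)
    show "planar (fst G) (Es i)" if "i < k" for i using plE that .
    show "Es i \<inter> Es j = {}" if "i \<noteq> j" for i j
      using that by (cases "i < j") (auto simp: Es_def)
    have "e \<in> (\<Union>i<k. Es i)" if "e \<in> snd G" for e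
    proof -
      define i where "i = (LEAST i. e \<in> A i)"
      obtain i' where i': "i' < k" "e \<in> A i'" using cov[OF \<open>e \<in> snd G\<close>] by blast
      have "e \<in> A i" unfolding i_def using i'(2) by (rule LeastI)
      moreover have "e \<notin> A j" if "j < i" for j using that unfolding i_def by (rule not_less_Least)
      moreover have "i < k" using Least_le[of "\<lambda>i. e \<in> A i", OF i'(2)] i'(1) unfolding i_def by linarith
      ultimately show ?thesis unfolding Es_def by blast
    qed
    then show "(\<Union>i<k. Es i) = snd G" by (auto simp: Es_def A_def)
  qed
  then show ?thesis unfolding decomposable_def G_def[symmetric] by blast
qed

section \<open>Triangulations and the cases of few vertices\<close>

text \<open>\<open>K\<close> need not contain the outer face of the drawing.\<close>

definition triang :: "'v set \<Rightarrow> 'v set set \<Rightarrow> bool" where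
  "triang V K \<longleftrightarrow> finite V \<and> (\<forall>t\<in>K. t \<subseteq> V \<and> card t = 3) \<and> V \<subseteq> \<Union>K \<and> (\<exists>R. separating R V K)"

lemma triangD:
  assumes "triang V K"
  shows "finite V" "\<And>t. t \<in> K \<Longrightarrow> t \<subseteq> V \<and> card t = 3" "V \<subseteq> \<Union>K" "\<exists>R. separating R V K"
  using assms unfolding triang_def by auto

definition joined :: "'v set set \<Rightarrow> 'v \<Rightarrow> 'v \<Rightarrow> bool" where
  "joined K u v \<longleftrightarrow> (\<exists>t\<in>K. u \<in> t \<and> v \<in> t)"

lemma joinedI: "t \<in> K \<Longrightarrow> u \<in> t \<Longrightarrow> v \<in> t \<Longrightarrow> joined K u v"
  unfolding joined_def by blast

lemma joined_sym: "joined K u v \<Longrightarrow> joined K v u"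
  unfolding joined_def by blast

definition sides :: "'v set \<Rightarrow> 'v set set \<Rightarrow> 'v set set" where
  "sides V K = {{u, v} | u v. u \<in> V \<and> v \<in> V \<and> u \<noteq> v \<and> joined K u v}"

text \<open>Copy \<open>k\<close> meets the next one around \<open>w\<close> for even
  \<open>k\<close> and around \<open>z\<close> for odd \<open>k\<close>, in accordance with
  \<open>bnd\<close>.\<close>

definition spokes :: "'v set \<Rightarrow> 'v set set \<Rightarrow> 'v \<Rightarrow> 'v \<Rightarrow> nat \<Rightarrow> 'v set" where
  "spokes V K z w k = {v \<in> V. joined K v (if even k then w else z)}"

text \<open>Schnyder's drawing followed by mirroring. From here on a layer is given by its faces
  alone.\<close>

lemma planar_layer:
  assumes T: "triang U K" and zw: "z \<noteq> w" "z \<in> U" "w \<in> U" and V: "V \<subseteq> U - {z, w}"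
  shows "planar (V \<times> {..<m}) (stacked m (sides V K) (spokes V K z w))"
proof -
  note D = triangD[OF T]
  define E where "E = {{u, v} | u v. u \<in> U \<and> v \<in> U \<and> u \<noteq> v \<and> joined K u v}"
  obtain R where R: "separating R U K" using D(4) by blast
  have "\<exists>p. straight p U E"
  proof (rule separating_imp_straight[OF D(1) R D(3)])
    fix e assume "e \<in> E"
    then show "card e = 2 \<and> e \<subseteq> U \<and> (\<exists>t\<in>K. e \<subseteq> t)" by (auto simp: E_def joined_def)
  qed
  then obtain p where p: "straight p U E" by blast
  show ?thesis
  proof (rule planar_stacked[OF D(1) p zw V])
    show "e \<in> E \<and> e \<subseteq> V" if "e \<in> sides V K" for e using that V unfolding sides_def E_def by auto
    show "v \<in> V \<and> {v, if even k then w else z} \<in> E" if v: "v \<in> spokes V K z w k" for v k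
    proof -
      have "v \<in> V" "joined K v (if even k then w else z)" using v by (auto simp: spokes_def)
      moreover have "v \<in> U" "v \<noteq> (if even k then w else z)" "(if even k then w else z) \<in> U"
        using \<open>v \<in> V\<close> V zw by auto
      ultimately show ?thesis unfolding E_def by blast
    qed
  qed
qed

lemma triang_image:
  assumes T: "triang V K" and h: "inj_on h V"
  shows "triang (h ` V) ((`) h ` K)"
proof -
  note D = triangD[OF T]
  obtain R where R: "separating R V K" using D(4) by blast
  have inv: "the_inv_into V h (h v) = v" if "v \<in> V" for v using the_inv_into_f_f[OF h that] .
  have "separating (\<lambda>i x. R i (the_inv_into V h x)) (h ` V) ((`) h ` K)"
  proof (rule separatingI)
    fix t' e' x' assume t': "t' \<in> (`) h ` K" "e' \<subseteq> t'" "x' \<in> h ` V" "x' \<notin> e'"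
    obtain t where t: "t \<in> K" "t' = h ` t" using t'(1) by blast
    obtain x where x: "x \<in> V" "x' = h x" using t'(3) by blast
    define e where "e = {y \<in> t. h y \<in> e'}"
    have e: "e \<subseteq> t" "e' = h ` e" using t'(2) t(2) unfolding e_def by auto
    have "x \<notin> e" using t'(4) e(2) x(2) by auto
    then obtain i where i: "i < 3" "\<forall>y\<in>e. R i y < R i x" using separatingD[OF R t(1) e(1) x(1)] by blast
    have "e \<subseteq> V" using e(1) D(2)[OF t(1)] by auto
    then have "\<forall>y\<in>e'. R i (the_inv_into V h y) < R i (the_inv_into V h x')"
      using i(2) x inv unfolding e(2) by auto
    then show "\<exists>i<3. \<forall>y\<in>e'. R i (the_inv_into V h y) < R i (the_inv_into V h x')" using i(1) by blast
  qed
  moreover have "\<forall>t\<in>(`) h ` K. t \<subseteq> h ` V \<and> card t = 3"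
  proof
    fix t' assume "t' \<in> (`) h ` K"
    then obtain t where t: "t \<in> K" "t' = h ` t" by blast
    then have "card t' = card t" using D(2)[OF t(1)] h by (metis card_image inj_on_subset)
    then show "t' \<subseteq> h ` V \<and> card t' = 3" using t D(2)[OF t(1)] by auto
  qed
  moreover have "h ` V \<subseteq> \<Union>((`) h ` K)" using D(3) by blast
  ultimately show ?thesis using D(1) unfolding triang_def by blast
qed

lemma joined_image: "joined K u v \<Longrightarrow> joined ((`) h ` K) (h u) (h v)"
  unfolding joined_def by blast

lemma triang_stack:
  assumes T: "triang V K" and t: "{a, b, c} \<in> K" "w \<notin> V"
  shows "triang (insert w V) (K - {{a, b, c}} \<union> {{a, b, w}, {a, c, w}, {b, c, w}})"
proof -
  note D = triangD[OF T]
  have d: "a \<noteq> b" "a \<noteq> c" "b \<noteq> c" using D(2)[OF t(1)] by (auto simp: card_insert_if split: if_splits)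
  have V: "a \<in> V" "b \<in> V" "c \<in> V" using D(2)[OF t(1)] by auto
  obtain R where R: "separating R V K" using D(4) by blast
  have "\<exists>R'. separating R' (insert w V) (K - {{a, b, c}} \<union> {{a, b, w}, {a, c, w}, {b, c, w}})"
    by (rule separating_stack[OF D(1) R D(2) t])
  moreover have "s \<subseteq> insert w V \<and> card s = 3" if "s \<in> K - {{a, b, c}} \<union> {{a, b, w}, {a, c, w}, {b, c, w}}" for s
    using that
  proof (rule UnE)
    assume "s \<in> K - {{a, b, c}}" then show ?thesis using D(2)[of s] by auto
  next
    assume "s \<in> {{a, b, w}, {a, c, w}, {b, c, w}}"
    then show ?thesis using d V t(2) by (elim insertE emptyE) (auto simp: card_insert_if)
  qed
  moreover have "insert w V \<subseteq> \<Union>(K - {{a, b, c}} \<union> {{a, b, w}, {a, c, w}, {b, c, w}})"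
    using D(3) by blast
  ultimately show ?thesis using D(1) unfolding triang_def by simp
qed

lemma strip_face:
  assumes "s \<in> strip xs b c" "distinct xs" "b \<notin> set xs" "c \<notin> set xs"
  shows "card s = 3 \<and> s \<subseteq> insert b (insert c (set xs))"
  using assms by (induction xs b c rule: strip.induct) auto

lemma strip_cover: "x \<in> set (u # ws @ [v]) \<Longrightarrow> x \<in> \<Union>(strip (u # ws @ [v]) b c)"
  by (induction ws arbitrary: u x) auto

lemma strip_bc: "b \<in> \<Union>(strip (u # ws @ [v]) b c)" "c \<in> \<Union>(strip (u # ws @ [v]) b c)"
  by (cases ws; auto)+

lemma triang_strip:
  assumes T: "triang V (K \<union> {{u, v, b}, {u, v, c}})"
    and n: "{u, v, b} \<notin> K" "{u, v, c} \<notin> K" "b \<noteq> c" "distinct ws" "set ws \<inter> V = {}"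
  shows "triang (V \<union> set ws) (K \<union> strip (u # ws @ [v]) b c)"
proof -
  note D = triangD[OF T]
  obtain R where R: "separating R V (K \<union> {{u, v, b}, {u, v, c}})" using D(4) by blast
  have R': "\<exists>R'. separating R' (V \<union> set ws) (K \<union> strip (u # ws @ [v]) b c)"
    by (rule separating_strip[OF D(1) R D(2) n])
  have t: "card {u, v, b} = 3" "card {u, v, c} = 3" "{u, v, b, c} \<subseteq> V" using D(2)[of "{u, v, b}"] D(2)[of "{u, v, c}"] by auto
  then have d: "u \<noteq> v" "u \<noteq> b" "v \<noteq> b" "u \<noteq> c" "v \<noteq> c" by (auto simp: card_insert_if split: if_splits)
  have di: "distinct (u # ws @ [v])" "b \<notin> set (u # ws @ [v])" "c \<notin> set (u # ws @ [v])"
    using d t(3) n(4,5) by auto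
  have "s \<subseteq> V \<union> set ws \<and> card s = 3" if "s \<in> K \<union> strip (u # ws @ [v]) b c" for s
    using that
  proof (rule UnE)
    assume "s \<in> K" then show ?thesis using D(2)[of s] by auto
  next
    assume "s \<in> strip (u # ws @ [v]) b c"
    then have "card s = 3 \<and> s \<subseteq> insert b (insert c (set (u # ws @ [v])))" using strip_face di by metis
    then show ?thesis using t(3) by auto
  qed
  moreover have "V \<union> set ws \<subseteq> \<Union>(K \<union> strip (u # ws @ [v]) b c)"
  proof
    fix x assume "x \<in> V \<union> set ws"
    then consider "x \<in> \<Union>K" | "x = b \<or> x = c" | "x \<in> set (u # ws @ [v])" using D(3) by auto
    then show "x \<in> \<Union>(K \<union> strip (u # ws @ [v]) b c)"
    proof cases
      case 2 then show ?thesis using strip_bc[of b u ws v c] strip_bc[of c u ws v b] by auto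
    next
      case 3 then show ?thesis using strip_cover[OF 3] by blast
    qed blast
  qed
  moreover have "finite (V \<union> set ws)" using D(1) by simp
  ultimately show ?thesis using R' unfolding triang_def by blast
qed

section \<open>Evaluating Schnyder's condition on tables\<close>

definition tri :: "nat \<times> nat \<times> nat \<Rightarrow> nat set" where
  "tri = (\<lambda>(a, b, c). {a, b, c})"

definition below :: "nat list list \<Rightarrow> nat list \<Rightarrow> nat \<Rightarrow> bool" where
  "below Ls xs y = list_ex (\<lambda>L. list_all (\<lambda>x. L ! x < L ! y) xs) Ls"

text \<open>Testing the largest parts suffices: the two other corners if \<open>x\<close> is a
  corner, the whole face otherwise. Smaller parts inherit the order.\<close>

definition face_ok :: "nat \<Rightarrow> nat list list \<Rightarrow> nat \<times> nat \<times> nat \<Rightarrow> bool" where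
  "face_ok n Ls = (\<lambda>(a, b, c). a < n \<and> b < n \<and> c < n \<and> a \<noteq> b \<and> a \<noteq> c \<and> b \<noteq> c \<and>
     below Ls [b, c] a \<and> below Ls [a, c] b \<and> below Ls [a, b] c \<and>
     list_all (\<lambda>x. x = a \<or> x = b \<or> x = c \<or> below Ls [a, b, c] x) [0..<n])"

definition faces_ok :: "nat \<Rightarrow> nat list list \<Rightarrow> (nat \<times> nat \<times> nat) list \<Rightarrow> bool" where
  "faces_ok n Ls fs \<longleftrightarrow> length Ls = 3 \<and> list_all (face_ok n Ls) fs \<and>
     list_all (\<lambda>v. list_ex (\<lambda>(a, b, c). v = a \<or> v = b \<or> v = c) fs) [0..<n]"

lemma triang_faces_ok:
  assumes ok: "faces_ok n Ls fs"
  shows "triang {..<n} (tri ` set fs)"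
proof -
  define R where "R i v = real (Ls ! i ! v)" for i v
  have len: "length Ls = 3" using ok by (simp add: faces_ok_def)
  have fok: "face_ok n Ls f" if "f \<in> set fs" for f using ok that by (auto simp: faces_ok_def list_all_iff)
  have bel: "\<exists>i<3. \<forall>x\<in>set xs. R i x < R i y" if b: "below Ls xs y" for xs y
  proof -
    obtain L where L: "L \<in> set Ls" "\<forall>x\<in>set xs. L ! x < L ! y"
      using b by (auto simp: below_def list_ex_iff list_all_iff)
    then obtain i where "i < 3" "L = Ls ! i" using len by (metis in_set_conv_nth)
    then show ?thesis using L(2) by (auto simp: R_def)
  qed
  have "separating R {..<n} (tri ` set fs)"
  proof (rule separatingI)
    fix t e x assume t: "t \<in> tri ` set fs" and e: "e \<subseteq> t" "x \<in> {..<n}" "x \<notin> e"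
    obtain a b c where f: "(a, b, c) \<in> set fs" "t = {a, b, c}" using t by (auto simp: tri_def)
    have F: "below Ls [b, c] a" "below Ls [a, c] b" "below Ls [a, b] c"
      "x = a \<or> x = b \<or> x = c \<or> below Ls [a, b, c] x"
      using fok[OF f(1)] e(2) by (auto simp: face_ok_def list_all_iff)
    have "\<exists>xs. below Ls xs x \<and> e \<subseteq> set xs"
      using F(4)
    proof (elim disjE)
      assume "x = a" then show ?thesis using F(1) e f(2) by (intro exI[of _ "[b, c]"]) auto
    next
      assume "x = b" then show ?thesis using F(2) e f(2) by (intro exI[of _ "[a, c]"]) auto
    next
      assume "x = c" then show ?thesis using F(3) e f(2) by (intro exI[of _ "[a, b]"]) auto
    next
      assume "below Ls [a, b, c] x" then show ?thesis using e f(2) by (intro exI[of _ "[a, b, c]"]) auto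
    qed
    then show "\<exists>i<3. \<forall>y\<in>e. R i y < R i x" using bel by blast
  qed
  moreover have "t \<subseteq> {..<n} \<and> card t = 3" if t: "t \<in> tri ` set fs" for t
  proof -
    obtain a b c where f: "(a, b, c) \<in> set fs" "t = {a, b, c}" using t by (auto simp: tri_def)
    then show ?thesis using fok[OF f(1)] by (auto simp: face_ok_def)
  qed
  moreover have "{..<n} \<subseteq> \<Union>(tri ` set fs)"
  proof
    fix v assume "v \<in> {..<n}"
    then obtain f where "f \<in> set fs" "v \<in> tri f"
      using ok by (fastforce simp: faces_ok_def list_all_iff list_ex_iff tri_def)
    then show "v \<in> \<Union>(tri ` set fs)" by blast
  qed
  ultimately show ?thesis unfolding triang_def by blast
qed

definition in_face :: "nat \<Rightarrow> nat \<times> nat \<times> nat \<Rightarrow> bool" where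
  "in_face v = (\<lambda>(a, b, c). v = a \<or> v = b \<or> v = c)"

definition pair_in :: "(nat \<times> nat \<times> nat) list \<Rightarrow> nat \<Rightarrow> nat \<Rightarrow> bool" where
  "pair_in fs u v = list_ex (\<lambda>f. in_face u f \<and> in_face v f) fs"

lemma joined_tri: "joined (tri ` set fs) u v \<longleftrightarrow> pair_in fs u v"
proof -
  have "u \<in> tri f \<longleftrightarrow> in_face u f" for u f by (cases f) (simp add: tri_def in_face_def)
  then show ?thesis by (simp add: joined_def pair_in_def list_ex_iff)
qed

text \<open>The vertices \<open>n\<close> and \<open>n + 1\<close> play z and w; the edge between
  them is the one pair that no layer has to contain.\<close>

definition layers_ok :: "nat \<Rightarrow> (nat list list \<times> (nat \<times> nat \<times> nat) list) list \<Rightarrow> bool" where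
  "layers_ok n ls \<longleftrightarrow> list_all (\<lambda>(Ls, fs). faces_ok (n + 2) Ls fs) ls \<and>
     list_all (\<lambda>u. list_all (\<lambda>v. v = Suc n \<and> u = n \<or> list_ex (\<lambda>(Ls, fs). pair_in fs u v) ls) [Suc u..<n + 2]) [0..<n + 1]"

lemma decomposable_layers_ok:
  assumes ok: "layers_ok n0 ls" and n: "n \<le> n0"
  shows "decomposable (cartesian_product (complete_graph n) (path_graph m)) (length ls)"
proof (rule decomposable_product[where V = "{..<n0}" and g = id])
  define K where "K i = tri ` set (snd (ls ! i))" for i
  define S where "S i = sides {..<n0} (K i)" for i
  define P where "P i = spokes {..<n0} (K i) n0 (Suc n0)" for i
  have T: "triang {..<n0 + 2} (K i)" if i: "i < length ls" for i
  proof -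
    have "ls ! i \<in> set ls" using i by simp
    then have "faces_ok (n0 + 2) (fst (ls ! i)) (snd (ls ! i))"
      using ok unfolding layers_ok_def by (auto simp: list_all_iff split: prod.splits)
    then show ?thesis unfolding K_def by (rule triang_faces_ok)
  qed
  have cov: "\<exists>i<length ls. joined (K i) u v" if uv: "u < v" "v < n0 + 2" "\<not> (v = Suc n0 \<and> u = n0)" for u v
  proof -
    have "u \<in> set [0..<n0 + 1]" "v \<in> set [Suc u..<n0 + 2]" using uv by auto
    then have "list_ex (\<lambda>(Ls, fs). pair_in fs u v) ls"
      using ok uv(3) unfolding layers_ok_def list_all_iff by blast
    then obtain l where "l \<in> set ls" "pair_in (snd l) u v" by (auto simp: list_ex_iff)
    then show ?thesis unfolding K_def joined_tri by (metis in_set_conv_nth)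
  qed
  show "inj_on id {0..<n}" "id ` {0..<n} \<subseteq> {..<n0}" using n by auto
  show "planar ({..<n0} \<times> {..<m}) (stacked m (S i) (P i))" if "i < length ls" for i
    unfolding S_def P_def by (rule planar_layer[OF T[OF that]]) auto
  show "\<exists>i<length ls. {u, v} \<in> S i" if uv: "u \<in> {..<n0}" "v \<in> {..<n0}" "u \<noteq> v" for u v
  proof -
    obtain i where "i < length ls" "joined (K i) u v"
      using cov[of u v] cov[of v u] uv joined_sym by (metis lessThan_iff linorder_neqE_nat less_irrefl trans_less_add1)
    then show ?thesis using uv unfolding S_def sides_def by blast
  qed
  show "\<exists>i<length ls. u \<in> P i j" if u: "u \<in> {..<n0}" for u j
    using cov[of u n0] cov[of u "Suc n0"] u unfolding P_def spokes_def by (cases "even j") auto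
qed

text \<open>Three vertex orders, each listing the ranks of the vertices, and the inner faces for every layer; the
  tables were found by computer search.\<close>

definition layers_two :: "(nat list list \<times> (nat \<times> nat \<times> nat) list) list" where
  "layers_two = [
   ([[3, 0, 1, 2],
     [0, 3, 1, 2],
     [0, 1, 3, 2]],
    [(0, 1, 3), (0, 2, 3), (1, 2, 3)])]"

lemma layers_two_ok: "layers_ok 2 layers_two" "length layers_two = 1"
  by code_simp (simp add: layers_two_def)

definition layers_seven :: "(nat list list \<times> (nat \<times> nat \<times> nat) list) list" where
  "layers_seven = [
   ([[8, 0, 5, 2, 4, 1, 7, 6, 3],
     [0, 8, 3, 2, 6, 1, 4, 5, 7],
     [0, 1, 6, 7, 3, 8, 4, 5, 2]],
    [(0, 1, 8), (0, 2, 3), (0, 2, 6), (0, 3, 5), (0, 4, 6), (0, 4, 8), (1, 3, 5), (1, 3, 8), (2, 3, 4),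
     (2, 4, 7), (2, 6, 7), (3, 4, 8), (4, 6, 7)]),
   ([[8, 2, 3, 6, 0, 1, 5, 7, 4],
     [0, 7, 6, 3, 8, 1, 4, 2, 5],
     [0, 3, 5, 6, 1, 8, 4, 2, 7]],
    [(0, 4, 7), (0, 5, 7), (1, 2, 5), (1, 2, 6), (1, 4, 5), (1, 4, 7), (1, 6, 7), (2, 5, 8), (2, 6, 8),
     (3, 5, 6), (3, 5, 7), (3, 6, 7), (5, 6, 8)])]"

lemma layers_seven_ok: "layers_ok 7 layers_seven" "length layers_seven = 2"
  by code_simp (simp add: layers_seven_def)

definition layers_fourteen :: "(nat list list \<times> (nat \<times> nat \<times> nat) list) list" where
  "layers_fourteen = [
   ([[15, 6, 3, 10, 0, 5, 2, 4, 7, 11, 13, 1, 9, 8, 12, 14],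
     [0, 8, 12, 5, 15, 7, 14, 6, 13, 9, 2, 1, 11, 10, 4, 3],
     [0, 12, 10, 6, 1, 13, 3, 14, 9, 5, 7, 15, 8, 11, 4, 2]],
    [(0, 4, 15), (0, 10, 11), (0, 10, 15), (1, 2, 5), (1, 2, 13), (1, 3, 5), (1, 3, 13), (2, 5, 7), (2, 6, 8),
     (2, 6, 11), (2, 7, 11), (2, 8, 12), (2, 12, 13), (3, 5, 7), (3, 6, 9), (3, 6, 12), (3, 7, 11), (3, 9, 14),
     (3, 11, 14), (3, 12, 13), (4, 6, 11), (4, 6, 15), (6, 8, 12), (6, 9, 14), (6, 14, 15), (10, 11, 14), (10, 14, 15)]),
   ([[15, 8, 0, 1, 2, 9, 13, 11, 3, 4, 6, 7, 5, 12, 14, 10],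
     [0, 10, 15, 1, 14, 5, 6, 4, 2, 3, 13, 11, 12, 7, 8, 9],
     [0, 11, 1, 15, 3, 12, 5, 6, 14, 13, 7, 10, 8, 4, 2, 9]],
    [(0, 2, 14), (0, 3, 8), (0, 6, 7), (0, 6, 13), (0, 7, 9), (0, 8, 9), (0, 13, 14), (1, 5, 9), (1, 5, 15),
     (1, 9, 11), (1, 11, 15), (2, 3, 4), (2, 4, 14), (3, 4, 8), (4, 7, 10), (4, 7, 13), (4, 8, 9), (4, 9, 12),
     (4, 10, 12), (4, 13, 14), (5, 7, 9), (5, 7, 15), (6, 7, 13), (7, 10, 12), (7, 12, 15), (9, 11, 12), (11, 12, 15)]),
   ([[15, 0, 9, 10, 1, 3, 2, 12, 11, 6, 4, 7, 14, 5, 13, 8],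
     [0, 15, 11, 10, 1, 2, 14, 6, 5, 12, 13, 7, 3, 8, 4, 9],
     [0, 1, 8, 7, 15, 14, 9, 4, 5, 10, 6, 13, 2, 12, 3, 11]],
    [(0, 1, 12), (0, 4, 5), (0, 5, 12), (1, 4, 6), (1, 6, 10), (1, 7, 8), (1, 7, 14), (1, 8, 10), (1, 12, 14),
     (2, 3, 10), (2, 3, 15), (2, 9, 10), (2, 9, 15), (3, 8, 10), (3, 8, 15), (4, 5, 6), (5, 6, 10), (5, 8, 11),
     (5, 8, 14), (5, 10, 13), (5, 11, 13), (5, 12, 14), (7, 8, 14), (8, 11, 13), (8, 13, 15), (9, 10, 13), (9, 13, 15)])]"

lemma layers_fourteen_ok: "layers_ok 14 layers_fourteen" "length layers_fourteen = 3"
  by code_simp (simp add: layers_fourteen_def)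

section \<open>Adjacencies and faces that survive insertion\<close>

lemma strip_pole: "x \<in> set (u # ws @ [v]) \<Longrightarrow> joined (strip (u # ws @ [v]) b c) x b \<and> joined (strip (u # ws @ [v]) b c) x c"
proof (induction ws arbitrary: u x)
  case Nil
  then show ?case by (auto simp: joined_def)
next
  case (Cons w ws)
  then consider "x = u" | "x \<in> set (w # ws @ [v])" by auto
  then show ?case
  proof cases
    case 1
    then have "{u, w, b} \<in> strip (u # (w # ws) @ [v]) b c" "{u, w, c} \<in> strip (u # (w # ws) @ [v]) b c" by auto
    then show ?thesis using 1 by (auto intro: joinedI)
  next
    case 2
    then show ?thesis using Cons.IH[OF 2] by (auto simp: joined_def)
  qed
qed

lemma strip_consecutive:
  "Suc j < length xs \<Longrightarrow> {xs ! j, xs ! Suc j, b} \<in> strip xs b c \<and> {xs ! j, xs ! Suc j, c} \<in> strip xs b c"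
proof (induction xs b c arbitrary: j rule: strip.induct)
  case (1 x y zs b c)
  then show ?case by (cases j) auto
qed auto

lemma joined_mono: "joined K x y \<Longrightarrow> K \<subseteq> K' \<Longrightarrow> joined K' x y"
  unfolding joined_def by blast

text \<open>Used to place z and w. The face itself is lost, but its sides survive in the three new
  triangles; all other faces remain, so one of them can receive a second vertex.\<close>

lemma triang_host:
  assumes T: "triang V K" and t: "{a, b, c} \<in> K" "w \<notin> V"
  shows "\<exists>K'. triang (insert w V) K' \<and> (\<forall>x y. joined K x y \<longrightarrow> joined K' x y) \<and>
    (\<forall>x\<in>{a, b, c}. joined K' x w) \<and> K - {{a, b, c}} \<subseteq> K'"
proof (intro exI conjI allI impI ballI)
  let ?K = "K - {{a, b, c}} \<union> {{a, b, w}, {a, c, w}, {b, c, w}}"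
  show "triang (insert w V) ?K" by (rule triang_stack[OF T t])
  show "joined ?K x y" if j: "joined K x y" for x y
  proof -
    obtain s where s: "s \<in> K" "x \<in> s" "y \<in> s" using j unfolding joined_def by blast
    show ?thesis
    proof (cases "s = {a, b, c}")
      case False then show ?thesis using s unfolding joined_def by blast
    next
      case True
      then have "x \<in> {a, b, c}" "y \<in> {a, b, c}" using s by auto
      then have "\<exists>s\<in>{{a, b, w}, {a, c, w}, {b, c, w}}. x \<in> s \<and> y \<in> s"
        by (elim insertE emptyE) simp_all
      then show ?thesis unfolding joined_def by (metis UnI2)
    qed
  qed
  show "joined ?K x w" if "x \<in> {a, b, c}" for x
  proof -
    have "\<exists>s\<in>{{a, b, w}, {a, c, w}, {b, c, w}}. x \<in> s \<and> w \<in> s"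
      using that by (elim insertE emptyE) simp_all
    then show ?thesis unfolding joined_def by (metis UnI2)
  qed
  show "K - {{a, b, c}} \<subseteq> ?K" by blast
qed

text \<open>A gap \<open>(u, v, b, c, ws)\<close> is an edge \<open>uv\<close> with its two faces \<open>uvb\<close> and \<open>uvc\<close>, to be subdivided by \<open>ws\<close>.\<close>

type_synonym 'v gap = "'v \<times> 'v \<times> 'v \<times> 'v \<times> 'v list"

definition gap_faces :: "'v gap \<Rightarrow> 'v set set" where
  "gap_faces = (\<lambda>(u, v, b, c, ws). {{u, v, b}, {u, v, c}})"

definition gap_strip :: "'v gap \<Rightarrow> 'v set set" where
  "gap_strip = (\<lambda>(u, v, b, c, ws). strip (u # ws @ [v]) b c)"

definition gap_verts :: "'v gap \<Rightarrow> 'v set" where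
  "gap_verts = (\<lambda>(u, v, b, c, ws). {u, v, b, c} \<union> set ws)"

definition gap_end :: "'v gap \<Rightarrow> 'v" where
  "gap_end = (\<lambda>(u, v, b, c, ws). v)"

definition gap_new :: "'v gap \<Rightarrow> 'v list" where
  "gap_new = (\<lambda>(u, v, b, c, ws). ws)"

definition gap_poles :: "'v gap \<Rightarrow> 'v \<times> 'v" where
  "gap_poles = (\<lambda>(u, v, b, c, ws). (b, c))"

lemma strip_sub: "s \<in> strip xs b c \<Longrightarrow> s \<subseteq> insert b (insert c (set xs))"
  by (induction xs b c rule: strip.induct) auto

text \<open>The gaps are filled one by one. Every face of a gap contains its \<open>gap_end\<close>,
  which no other gap touches, so filling one gap neither destroys nor duplicates the faces of
  another.\<close>

lemma triang_strips:
  assumes "triang V (G \<union> \<Union>(gap_faces ` set L))" "distinct L"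
    and "\<And>s. s \<in> set L \<Longrightarrow> gap_faces s \<inter> G = {} \<and> fst (gap_poles s) \<noteq> snd (gap_poles s) \<and> distinct (gap_new s) \<and> set (gap_new s) \<inter> V = {}"
    and "\<And>s s'. s \<in> set L \<Longrightarrow> s' \<in> set L \<Longrightarrow> s \<noteq> s' \<Longrightarrow> gap_end s \<notin> gap_verts s' \<and> set (gap_new s) \<inter> set (gap_new s') = {}"
  shows "triang (V \<union> \<Union>((set \<circ> gap_new) ` set L)) (G \<union> \<Union>(gap_strip ` set L))"
  using assms
proof (induction L arbitrary: V G)
  case Nil
  then show ?case by simp
next
  case (Cons s L)
  obtain u v b c ws where s: "s = (u, v, b, c, ws)" by (cases s)
  define K where "K = G \<union> \<Union>(gap_faces ` set L)"
  have n: "gap_faces s \<inter> G = {}" "b \<noteq> c" "distinct ws" "set ws \<inter> V = {}"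
    using Cons.prems(3)[of s] by (auto simp: s gap_poles_def gap_new_def)
  have other: "gap_end s' \<notin> gap_verts s" "gap_end s \<notin> gap_verts s'" "set ws \<inter> set (gap_new s') = {}" if "s' \<in> set L" for s'
  proof -
    have "s' \<noteq> s" using that Cons.prems(2) by auto
    then show "gap_end s' \<notin> gap_verts s" "gap_end s \<notin> gap_verts s'" "set ws \<inter> set (gap_new s') = {}"
      using Cons.prems(4)[of s s'] Cons.prems(4)[of s' s] that by (auto simp: s gap_new_def)
  qed
  have fv: "f \<subseteq> gap_verts s' \<and> gap_end s' \<in> f" if "f \<in> gap_faces s'" for f and s' :: "'a gap"
    using that by (cases s') (auto simp: gap_faces_def gap_verts_def gap_end_def)
  have dis: "gap_faces s \<inter> gap_faces s' = {}" if "s' \<in> set L" for s'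
    using fv[of _ s] fv[of _ s'] other(2)[OF that] by blast
  have eq: "G \<union> \<Union>(gap_faces ` set (s # L)) = K \<union> {{u, v, b}, {u, v, c}}"
    by (auto simp: K_def s gap_faces_def)
  have "gap_faces s \<inter> K = {}" using n(1) dis unfolding K_def by blast
  then have "{u, v, b} \<notin> K" "{u, v, c} \<notin> K" by (auto simp: s gap_faces_def)
  then have T1: "triang (V \<union> set ws) (K \<union> gap_strip s)"
    unfolding s gap_strip_def prod.case using triang_strip[OF Cons.prems(1)[unfolded eq]] n by blast
  define G' where "G' = G \<union> gap_strip s"
  have sv: "f \<subseteq> gap_verts s" if "f \<in> gap_strip s" for f
    using strip_sub[of f "u # ws @ [v]" b c] that by (auto simp: s gap_strip_def gap_verts_def)
  have "triang ((V \<union> set ws) \<union> \<Union>((set \<circ> gap_new) ` set L)) (G' \<union> \<Union>(gap_strip ` set L))"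
  proof (rule Cons.IH)
    have "K \<union> gap_strip s = G' \<union> \<Union>(gap_faces ` set L)" unfolding K_def G'_def by blast
    then show "triang (V \<union> set ws) (G' \<union> \<Union>(gap_faces ` set L))" using T1 by simp
    show "distinct L" using Cons.prems(2) by simp
    show "gap_faces s' \<inter> G' = {} \<and> fst (gap_poles s') \<noteq> snd (gap_poles s') \<and> distinct (gap_new s') \<and> set (gap_new s') \<inter> (V \<union> set ws) = {}"
      if s': "s' \<in> set L" for s'
    proof -
      have "gap_faces s' \<inter> gap_strip s = {}" using fv[of _ s'] sv other(1)[OF s'] by blast
      then show ?thesis using Cons.prems(3)[of s'] s' other(3)[OF s'] unfolding G'_def by auto
    qed
    show "gap_end s1 \<notin> gap_verts s2 \<and> set (gap_new s1) \<inter> set (gap_new s2) = {}" if "s1 \<in> set L" "s2 \<in> set L" "s1 \<noteq> s2" for s1 s2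
      using Cons.prems(4)[of s1 s2] that by simp
  qed
  moreover have "(V \<union> set ws) \<union> \<Union>((set \<circ> gap_new) ` set L) = V \<union> \<Union>((set \<circ> gap_new) ` set (s # L))"
    by (auto simp: s gap_new_def)
  moreover have "G' \<union> \<Union>(gap_strip ` set L) = G \<union> \<Union>(gap_strip ` set (s # L))" unfolding G'_def by auto
  ultimately show ?case by simp
qed

section \<open>Building blocks of the general layers\<close>

text \<open>Found by a SAT search. Vertex \<open>6c + k\<close> of the core stands for the vertex of class \<open>c < 3\<close> with the \<open>k\<close>-th
  of the offsets \<open>0, q, 1, q + 1, h, q + h\<close>, where \<open>h\<close> ends the zigzag below; 18 and 19 are the hubs.
  The six pairs of gap faces are replaced by strips that contain the remaining offsets.\<close>

definition core_ranks :: "nat list list" where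
  "core_ranks = [[2, 7, 8, 14, 19, 12, 4, 15, 17, 6, 0, 11, 18, 13, 3, 9, 1, 10, 16, 5],
    [18, 14, 3, 11, 0, 10, 2, 8, 7, 15, 19, 13, 4, 12, 17, 5, 1, 9, 6, 16],
    [4, 13, 17, 6, 0, 14, 18, 5, 3, 11, 1, 12, 2, 8, 7, 16, 19, 15, 9, 10]]"

definition core_faces :: "(nat \<times> nat \<times> nat) list" where
  "core_faces = [(0, 3, 7), (0, 3, 14), (0, 7, 8), (0, 10, 16), (1, 2, 6), (1, 2, 15), (1, 6, 9), (1, 11, 17),
    (2, 12, 15), (3, 13, 14), (4, 6, 16), (4, 10, 12), (5, 7, 17), (5, 11, 13), (5, 11, 17), (6, 9, 19),
    (6, 14, 19), (7, 8, 18), (7, 15, 18), (8, 12, 18), (9, 13, 19), (12, 15, 18), (13, 14, 19)]"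

definition core_gaps :: "(nat \<times> nat \<times> nat) list" where
  "core_gaps = [(2, 4, 6), (2, 4, 12), (3, 5, 7), (3, 5, 13), (8, 10, 12), (8, 10, 0), (9, 11, 13), (9, 11, 1),
    (14, 16, 0), (14, 16, 6), (15, 17, 1), (15, 17, 7)]"

text \<open>The indices refer to \<open>hub_list\<close> below: 0 and 1 are the hubs, 2 and 3 are z
  and w, 4 to 7 have offset 0 or \<open>q\<close> in the classes 1 and 2, and 8 to 12 belong to
  class 0. A strip between the hubs along the edge from 9 to 12 takes in the rest of class
  0.\<close>

definition hub_ranks :: "nat list list" where
  "hub_ranks = [[11, 3, 5, 2, 12, 4, 0, 1, 6, 7, 9, 8, 10],
    [4, 8, 3, 11, 0, 2, 1, 12, 5, 6, 9, 10, 7],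
    [2, 6, 10, 3, 0, 11, 12, 1, 9, 8, 5, 4, 7]]"

definition hub_faces :: "(nat \<times> nat \<times> nat) list" where
  "hub_faces = [(0, 1, 12), (9, 8, 0), (9, 8, 1), (2, 0, 8), (2, 8, 1), (2, 1, 5), (2, 5, 4), (2, 4, 0),
    (0, 4, 7), (1, 6, 5), (4, 6, 5), (3, 0, 7), (3, 7, 6), (3, 6, 1), (3, 1, 11), (3, 11, 0),
    (11, 10, 0), (11, 10, 1), (10, 0, 1)]"

definition hub_gaps :: "(nat \<times> nat \<times> nat) list" where
  "hub_gaps = [(9, 12, 0), (9, 12, 1)]"

text \<open>An octahedron on the 4-cycle 0, 1, 2, 3 with poles 4 and 5; the triangle 0, 1, 4 is its
  outer face.\<close>

definition octa_ranks :: "nat list list" where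
  "octa_ranks = [[5, 0, 2, 3, 1, 4],
    [0, 5, 4, 2, 1, 3],
    [0, 1, 3, 4, 5, 2]]"

definition octa_faces :: "(nat \<times> nat \<times> nat) list" where
  "octa_faces = [(0, 1, 5), (1, 2, 4), (1, 2, 5), (2, 3, 4), (2, 3, 5), (3, 0, 4), (3, 0, 5)]"

lemma triang_core: "triang {..<20} (tri ` set (core_faces @ core_gaps))"
  by (rule triang_faces_ok[of _ core_ranks]) code_simp

lemma triang_hub: "triang {..<13} (tri ` set (hub_faces @ hub_gaps))"
  by (rule triang_faces_ok[of _ hub_ranks]) code_simp

lemma triang_octa: "triang {..<6} (tri ` set octa_faces)"
  by (rule triang_faces_ok[of _ octa_ranks]) code_simp

definition tril :: "'v list \<Rightarrow> nat \<times> nat \<times> nat \<Rightarrow> 'v set" where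
  "tril xs = (\<lambda>(a, b, c). {xs ! a, xs ! b, xs ! c})"

lemma triang_relabel:
  assumes "triang {..<n} (tri ` set fs)" "distinct xs" "length xs = n"
  shows "triang (set xs) (tril xs ` set fs)"
proof -
  have "inj_on ((!) xs) {..<n}" using assms(2,3) by (simp add: inj_on_nth)
  then have "triang ((!) xs ` {..<n}) ((`) ((!) xs) ` tri ` set fs)" by (rule triang_image[OF assms(1)])
  moreover have "(!) xs ` {..<n} = set xs" using assms(3) by (auto simp: set_conv_nth)
  moreover have "(`) ((!) xs) ` tri ` set fs = tril xs ` set fs"
    unfolding image_image by (rule image_cong) (auto simp: tri_def tril_def)
  ultimately show ?thesis by simp
qed

text \<open>The zigzag 1, q - 1, 2, q - 2, ... through the numbers from 1 to q - 1: consecutive entries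
  realise every difference from 1 to q - 2 exactly once.\<close>

definition zig :: "nat \<Rightarrow> nat \<Rightarrow> nat" where
  "zig q j = (if even j then j div 2 + 1 else q - 1 - j div 2)"

lemma zig_double [simp]: "zig q (2 * k) = k + 1" "zig q (Suc (2 * k)) = q - 1 - k"
  by (simp_all add: zig_def)

lemma double_cases:
  fixes j :: nat
  obtains k where "j = 2 * k" | k where "j = Suc (2 * k)"
  by (metis evenE oddE Suc_eq_plus1)

lemma zig_range: "j < q - 1 \<Longrightarrow> 1 \<le> zig q j \<and> zig q j \<le> q - 1"
  by (cases j rule: double_cases) auto

lemma zig_inj: "inj_on (zig q) {..<q - 1}"
proof (rule inj_onI)
  fix i j assume h: "i \<in> {..<q - 1}" "j \<in> {..<q - 1}" "zig q i = zig q j"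
  obtain k l where "i = 2 * k \<or> i = Suc (2 * k)" "j = 2 * l \<or> j = Suc (2 * l)"
    by (metis double_cases)
  then show "i = j"
  proof (elim disjE)
    assume "i = 2 * k" "j = 2 * l" then show ?thesis using h by simp
  next
    assume e: "i = 2 * k" "j = Suc (2 * l)"
    then have "k + 1 = q - 1 - l" "2 * k < q - 1" "Suc (2 * l) < q - 1" using h by simp_all
    then show ?thesis by linarith
  next
    assume e: "i = Suc (2 * k)" "j = 2 * l"
    then have "l + 1 = q - 1 - k" "2 * l < q - 1" "Suc (2 * k) < q - 1" using h by simp_all
    then show ?thesis by linarith
  next
    assume e: "i = Suc (2 * k)" "j = Suc (2 * l)"
    then have "q - 1 - k = q - 1 - l" "Suc (2 * l) < q - 1" "Suc (2 * k) < q - 1" using h by simp_all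
    then show ?thesis using e by linarith
  qed
qed

lemma zig_surj: "1 \<le> x \<Longrightarrow> x \<le> q - 1 \<Longrightarrow> \<exists>j<q - 1. zig q j = x"
proof (cases "2 * x \<le> q")
  case True
  assume "1 \<le> x" "x \<le> q - 1"
  then show ?thesis using True by (intro exI[of _ "2 * (x - 1)"]) simp
next
  case False
  assume h: "1 \<le> x" "x \<le> q - 1"
  then show ?thesis using False by (intro exI[of _ "Suc (2 * (q - 1 - x))"]) simp
qed

lemma zig_diff:
  assumes "1 \<le> d" "d \<le> q - 2"
  shows "\<exists>j. Suc j < q - 1 \<and> (zig q (Suc j) = zig q j + d \<or> zig q j = zig q (Suc j) + d)"
\<comment> \<open>The entries \<open>j\<close> and \<open>j + 1\<close> of the zigzag differ by q -
  2 - j, which gives the witness.\<close>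
proof (intro exI[of _ "q - d - 2"] conjI)
  show "Suc (q - d - 2) < q - 1" using assms by linarith
  show "zig q (Suc (q - d - 2)) = zig q (q - d - 2) + d \<or> zig q (q - d - 2) = zig q (Suc (q - d - 2)) + d"
  proof (cases "even (q - d)")
    case True
    then obtain k where k: "q - d = 2 * k" by (elim evenE)
    then obtain k' where k': "k = Suc k'" using assms by (cases k) auto
    have j: "q - d - 2 = 2 * k'" using k k' by simp
    have "q = d + 2 * k' + 2" using k k' assms by linarith
    then show ?thesis unfolding j zig_double by simp
  next
    case False
    then obtain k where k: "q - d = 2 * k + 1" by (elim oddE)
    then obtain k' where k': "k = Suc k'" using assms by (cases k) auto
    have j: "q - d - 2 = Suc (2 * k')" "Suc (Suc (2 * k')) = 2 * Suc k'" using k k' by simp_all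
    have "q = d + 2 * k' + 3" using k k' assms by linarith
    then show ?thesis unfolding j zig_double by simp
  qed
qed

section \<open>Euler's bound\<close>

definition open_arc :: "(real \<Rightarrow> complex) \<Rightarrow> complex set" where
  "open_arc g = path_image g - {pathstart g, pathfinish g}"

text \<open>Incidence of the face of \<open>p\<close> with an edge. The ends of the edge are left
  out, since a face may reach an end without bordering the edge.\<close>

definition touches :: "complex set \<Rightarrow> complex \<Rightarrow> (real \<Rightarrow> complex) \<Rightarrow> bool" where
  "touches X p g \<longleftrightarrow> closure (connected_component_set (- X) p) \<inter> open_arc g \<noteq> {}"

section \<open>Faces at a single arc\<close>

context
  fixes g :: "real \<Rightarrow> complex" and Y :: "complex set"
  assumes g: "arc g" and Y: "closed Y" and gY: "path_image g \<inter> Y = {pathstart g, pathfinish g}"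
begin

lemma connected_open_arc: "connected (open_arc g)" "open_arc g \<noteq> {}" "open_arc g \<inter> Y = {}"
proof -
  have sp: "simple_path g" using g by (rule arc_imp_simple_path)
  show "connected (open_arc g)" unfolding open_arc_def using sp by (rule connected_simple_path_endless)
  have "open_arc g = g ` {0<..<1}" unfolding open_arc_def using sp by (rule simple_path_endless)
  then show "open_arc g \<noteq> {}" by simp
  show "open_arc g \<inter> Y = {}" using gY unfolding open_arc_def by blast
qed

lemma ball_off:
  assumes "x \<in> open_arc g"
  obtains \<epsilon> where "\<epsilon> > 0" "ball x \<epsilon> \<inter> Y = {}"
proof -
  have "x \<in> - Y" "open (- Y)" using assms connected_open_arc(3) Y by auto
  then show thesis using that by (metis disjoint_eq_subset_Compl open_contains_ball)
qed

text \<open>Deleting the arc merges all faces that border it into the one face of \<open>Y\<close>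
  that contains the open arc.\<close>

lemma touches_outside:
  assumes p: "touches (Y \<union> path_image g) p g" and x: "x \<in> open_arc g"
  shows "connected_component (- Y) p x"
proof -
  obtain y where y: "y \<in> open_arc g" "y \<in> closure (connected_component_set (- (Y \<union> path_image g)) p)"
    using p unfolding touches_def by blast
  obtain \<epsilon> where e: "\<epsilon> > 0" "ball y \<epsilon> \<inter> Y = {}" using ball_off[OF y(1)] .
  obtain z where z: "connected_component (- (Y \<union> path_image g)) p z" "dist z y < \<epsilon>"
    using y(2) e(1) by (auto simp: closure_approachable)
  have "connected_component (- Y) p z" by (rule connected_component_of_subset[OF z(1)]) auto
  moreover have "connected_component (- Y) z y"
    unfolding connected_component_def using e z(2) by (intro exI[of _ "ball y \<epsilon>"]) (auto simp: dist_commute)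
  moreover have "connected_component (- Y) y x"
    unfolding connected_component_def using connected_open_arc(1,3) y x by (intro exI[of _ "open_arc g"]) auto
  ultimately show ?thesis by (meson connected_component_trans)
qed

lemma touches_notin:
  assumes "touches (Y \<union> path_image g) p g"
  shows "p \<notin> Y \<union> path_image g"
proof
  assume "p \<in> Y \<union> path_image g"
  then have "connected_component_set (- (Y \<union> path_image g)) p = {}"
    using connected_component_eq_empty[of "- (Y \<union> path_image g)" p] by blast
  then show False using assms unfolding touches_def by (metis closure_empty inf_bot_left)
qed

text \<open>Janiszewski's theorem: the arc meets \<open>Y1\<close>, and their union meets \<open>Y2\<close>, in a single point.\<close>

lemma bridge_one_face:
  assumes Y12: "Y = Y1 \<union> Y2" "compact Y1" "closed Y2" "Y1 \<inter> Y2 = {}" "pathstart g \<in> Y1" "pathfinish g \<in> Y2"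
    and p: "touches (Y \<union> path_image g) p g" and q: "touches (Y \<union> path_image g) q g"
  shows "connected_component (- (Y \<union> path_image g)) p q"
proof -
  obtain x where x: "x \<in> open_arc g" using connected_open_arc(2) by blast
  have pq: "connected_component (- Y) p q"
    using touches_outside[OF p x] touches_outside[OF q x] by (meson connected_component_sym connected_component_trans)
  have c1: "connected_component (- Y1) p q" "connected_component (- Y2) p q"
    by (rule connected_component_of_subset[OF pq], use Y12 in auto)+
  have "connected (- path_image g)" using connected_arc_complement[OF g] by simp
  then have cg: "connected_component (- path_image g) p q"
    using touches_notin[OF p] touches_notin[OF q] unfolding connected_component_def by blast
  have i1: "path_image g \<inter> Y1 = {pathstart g}" "(path_image g \<union> Y1) \<inter> Y2 = {pathfinish g}"
    using gY Y12 by auto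
  have "connected_component (- (path_image g \<union> Y1)) p q"
    by (rule Janiszewski[OF _ compact_imp_closed[OF Y12(2)] _ cg c1(1)]) (use i1 compact_arc_image[OF g] in auto)
  then have "connected_component (- ((path_image g \<union> Y1) \<union> Y2)) p q"
    by (rule Janiszewski[OF _ Y12(3) _ _ c1(2), rotated 2]) (use i1 Y12(2) compact_arc_image[OF g] in \<open>auto intro: compact_Un\<close>)
  then show ?thesis using Y12(1) by (simp add: Un_ac)
qed

text \<open>A path in \<open>Y\<close> between the ends of \<open>g\<close> contains an arc
  \<open>h\<close>, which closes \<open>g\<close> to a Jordan curve. That this curve meets
  \<open>Y\<close> in \<open>h\<close>, a connected set, is what Janiszewski's theorem
  needs.\<close>

lemma cycle_through:
  assumes "path_component Y (pathstart g) (pathfinish g)"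
  obtains h where "arc h" "path_image h \<subseteq> Y" "simple_path (g +++ h)" "pathfinish (g +++ h) = pathstart (g +++ h)"
    "path_image (g +++ h) = path_image g \<union> path_image h" "path_image (g +++ h) \<inter> Y = path_image h"
proof -
  have ne: "pathstart g \<noteq> pathfinish g" using arc_distinct_ends[OF g] by metis
  obtain c where c: "path c" "path_image c \<subseteq> Y" "pathstart c = pathfinish g" "pathfinish c = pathstart g"
    using path_component_sym[OF assms] unfolding path_component_def by blast
  obtain h where h: "arc h" "path_image h \<subseteq> path_image c" "pathstart h = pathfinish g" "pathfinish h = pathstart g"
    using path_contains_arc[OF c(1,3,4)] ne by metis
  have hY: "path_image h \<subseteq> Y" using h c by auto
  have pi: "path_image (g +++ h) = path_image g \<union> path_image h" using h by (simp add: path_image_join)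
  show thesis
  proof (rule that[OF h(1) hY _ _ pi])
    show "simple_path (g +++ h)" by (rule simple_path_join_loop[OF g h(1)]) (use h hY gY in auto)
    show "pathfinish (g +++ h) = pathstart (g +++ h)" using h by simp
    have "{pathstart g, pathfinish g} \<subseteq> path_image h"
      using pathstart_in_path_image[of h] pathfinish_in_path_image[of h] h(3,4) by simp
    then show "path_image (g +++ h) \<inter> Y = path_image h" unfolding pi Int_Un_distrib2 using hY gY by blast
  qed
qed

text \<open>Two of three faces at the arc lie on the same side of the Jordan curve \<open>J\<close> through it, and \<open>J\<close> meets the
  rest of the drawing in an arc, so Janiszewski's theorem identifies these two faces.\<close>

lemma cycle_two_faces:
  assumes Yc: "path_component Y (pathstart g) (pathfinish g)"
    and p: "touches (Y \<union> path_image g) p g" and q: "touches (Y \<union> path_image g) q g" and r: "touches (Y \<union> path_image g) r g"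
  shows "connected_component (- (Y \<union> path_image g)) p q \<or> connected_component (- (Y \<union> path_image g)) p r \<or>
    connected_component (- (Y \<union> path_image g)) q r"
proof -
  obtain x where x: "x \<in> open_arc g" using connected_open_arc(2) by blast
  obtain h where h: "arc h" "path_image h \<subseteq> Y" "simple_path (g +++ h)" "pathfinish (g +++ h) = pathstart (g +++ h)"
    "path_image (g +++ h) = path_image g \<union> path_image h" "path_image (g +++ h) \<inter> Y = path_image h"
    using cycle_through[OF Yc] by blast
  define J where "J = path_image (g +++ h)"
  note J = Jordan_inside_outside[OF h(3,4), folded J_def]
  have two: "connected_component (- (Y \<union> path_image g)) a b"
    if a: "touches (Y \<union> path_image g) a g" and b: "touches (Y \<union> path_image g) b g" and ab: "connected_component (- J) a b" for a b
  proof -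
    have "connected_component (- Y) a b"
      using touches_outside[OF a x] touches_outside[OF b x] by (meson connected_component_sym connected_component_trans)
    then have "connected_component (- (J \<union> Y)) a b"
      by (intro Janiszewski) (use h(6) connected_arc_image[OF h(1)] compact_simple_path_image[OF h(3)] ab Y in \<open>simp_all add: J_def\<close>)
    then show ?thesis by (rule connected_component_of_subset) (use h in \<open>auto simp: J_def\<close>)
  qed
  have side: "a \<in> inside J \<or> a \<in> outside J" if "touches (Y \<union> path_image g) a g" for a
  proof -
    have "a \<notin> J" using touches_notin[OF that] h by (auto simp: J_def)
    then show ?thesis using J by blast
  qed
  have same: "connected_component (- J) a b" if "(a \<in> inside J \<and> b \<in> inside J) \<or> (a \<in> outside J \<and> b \<in> outside J)" for a b
  proof -
    have "inside J \<subseteq> - J" "outside J \<subseteq> - J" "connected (inside J)" "connected (outside J)"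
      using J inside_no_overlap[of J] outside_no_overlap[of J] by blast+
    then show ?thesis using that unfolding connected_component_def by blast
  qed
  have pair: "connected_component (- (Y \<union> path_image g)) a b"
    if a: "touches (Y \<union> path_image g) a g" and b: "touches (Y \<union> path_image g) b g" and ab: "a \<in> inside J \<longleftrightarrow> b \<in> inside J" for a b
    by (rule two[OF a b same]) (use side[OF a] side[OF b] ab in blast)
  consider "p \<in> inside J \<longleftrightarrow> q \<in> inside J" | "p \<in> inside J \<longleftrightarrow> r \<in> inside J" | "q \<in> inside J \<longleftrightarrow> r \<in> inside J" by blast
  then show ?thesis using pair[OF p q] pair[OF p r] pair[OF q r] by cases simp_all
qed

text \<open>Close to a point of the open arc there are points inside and outside the Jordan curve
  through it. A small disc off \<open>Y\<close> keeps them in one face of \<open>Y\<close>, while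
  the curve separates them once the arc is drawn.\<close>

lemma cycle_new_face:
  assumes Yc: "path_component Y (pathstart g) (pathfinish g)" and x: "x \<in> open_arc g"
  obtains p q where "connected_component (- Y) p x" "connected_component (- Y) q x" "p \<notin> path_image g" "q \<notin> path_image g"
    "\<not> connected_component (- (Y \<union> path_image g)) p q"
proof -
  obtain h where h: "arc h" "path_image h \<subseteq> Y" "simple_path (g +++ h)" "pathfinish (g +++ h) = pathstart (g +++ h)"
    "path_image (g +++ h) = path_image g \<union> path_image h" "path_image (g +++ h) \<inter> Y = path_image h"
    using cycle_through[OF Yc] by blast
  define J where "J = path_image (g +++ h)"
  note J = Jordan_inside_outside[OF h(3,4), folded J_def]
  have xJ: "x \<in> J" using x h by (auto simp: J_def open_arc_def)
  obtain \<epsilon> where e: "\<epsilon> > 0" "ball x \<epsilon> \<inter> Y = {}" using ball_off[OF x] .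
  have "x \<in> closure (inside J)" "x \<in> closure (outside J)" using J xJ by (auto simp: frontier_def)
  then obtain p q where pq: "p \<in> inside J" "dist p x < \<epsilon>" "q \<in> outside J" "dist q x < \<epsilon>"
    using e(1) by (meson closure_approachable)
  have near: "connected_component (- Y) z x" if "dist z x < \<epsilon>" for z
    unfolding connected_component_def using e that by (intro exI[of _ "ball x \<epsilon>"]) (auto simp: dist_commute)
  have "\<not> connected_component (- J) p q"
  proof
    assume "connected_component (- J) p q"
    then obtain C where C: "connected C" "C \<subseteq> - J" "p \<in> C" "q \<in> C" unfolding connected_component_def by blast
    then show False using connectedD[OF C(1), of "inside J" "outside J"] J pq by blast
  qed
  moreover have "J \<subseteq> Y \<union> path_image g" using h by (auto simp: J_def)
  ultimately have "\<not> connected_component (- (Y \<union> path_image g)) p q"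
    by (meson Compl_anti_mono connected_component_of_subset)
  moreover have "path_image g \<subseteq> J" using h(5) by (simp add: J_def)
  then have "p \<notin> path_image g" "q \<notin> path_image g"
    using pq(1,3) inside_no_overlap[of J] outside_no_overlap[of J] by (meson disjoint_iff subsetD)+
  ultimately show thesis by (intro that[OF near[OF pq(2)] near[OF pq(4)]])
qed

end

section \<open>Sets that do not separate the plane, and separations of a drawing\<close>

lemma connected_Compl_Un_finite:
  fixes S P :: "complex set"
  assumes "finite P" "compact S" "connected (- S)"
  shows "connected (- (S \<union> P))"
  using assms(1)
proof (induction P)
  case empty
  then show ?case using assms(3) by simp
next
  case (insert x P)
  have "connected (- ((S \<union> P) \<union> {x}))"
  proof (rule Janiszewski_connected)
    show "compact (S \<union> P)" using assms(2) finite_imp_compact[OF insert.hyps(1)] by (rule compact_Un)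
    show "connected ((S \<union> P) \<inter> {x})" by (cases "x \<in> S \<union> P") auto
    show "connected (- {x})" by (rule connected_punctured_universe) simp
  qed (use insert.IH in auto)
  then show ?case by simp
qed

text \<open>Applied to the boundary of a face with at most two edges. In a simple graph two edges
  share at most one vertex, so the arcs meet in at most one point and Janiszewski's theorem
  applies.\<close>

lemma connected_Compl_few_arcs:
  assumes arcs: "\<And>g. g \<in> A \<Longrightarrow> arc g" and A: "finite A" "card A \<le> 2"
    and meet: "\<And>g h. g \<in> A \<Longrightarrow> h \<in> A \<Longrightarrow> g \<noteq> h \<Longrightarrow> connected (path_image g \<inter> path_image h)"
    and P: "finite P"
  shows "connected (- ((\<Union>g\<in>A. path_image g) \<union> P :: complex set))"
proof (rule connected_Compl_Un_finite[OF P])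
  show "compact (\<Union>g\<in>A. path_image g)" using A(1) arcs by (intro compact_UN) (auto simp: compact_arc_image)
  have c: "connected (- path_image g)" if "g \<in> A" for g using connected_arc_complement[OF arcs[OF that]] by simp
  have "card A = 0 \<or> card A = 1 \<or> card A = 2" using A(2) by linarith
  then show "connected (- (\<Union>g\<in>A. path_image g))"
  proof (elim disjE)
    assume "card A = 0" then show ?thesis using A by (simp add: connected_UNIV)
  next
    assume "card A = 1" then obtain g where "A = {g}" by (rule card_1_singletonE)
    then show ?thesis using c by simp
  next
    assume "card A = 2" then obtain g h where gh: "A = {g, h}" "g \<noteq> h" by (meson card_2_iff)
    have "connected (- (path_image g \<union> path_image h))"
      by (rule Janiszewski_connected) (use gh c arcs meet in \<open>auto simp: compact_arc_image closed_arc_image\<close>)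
    then show ?thesis using gh by simp
  qed
qed

text \<open>Each member lies in one path component, and there are finitely many members. So the
  component of \<open>a\<close> and the rest are both compact, which is the separation required at a
  bridge.\<close>

lemma separation_Union:
  fixes \<P> :: "'a::t2_space set set"
  assumes "finite \<P>" and P: "\<And>S. S \<in> \<P> \<Longrightarrow> compact S \<and> path_connected S"
    and ab: "a \<in> \<Union>\<P>" "b \<in> \<Union>\<P>" "\<not> path_component (\<Union>\<P>) a b"
  obtains Y1 Y2 where "\<Union>\<P> = Y1 \<union> Y2" "compact Y1" "compact Y2" "Y1 \<inter> Y2 = {}" "a \<in> Y1" "b \<in> Y2"
proof -
  define C where "C = path_component_set (\<Union>\<P>) a"
  have dich: "S \<subseteq> C" if S: "S \<in> \<P>" "S \<inter> C \<noteq> {}" for S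
  proof -
    obtain x where x: "x \<in> S" "path_component (\<Union>\<P>) a x" using S(2) unfolding C_def by blast
    have "path_component (\<Union>\<P>) x y" if "y \<in> S" for y
    proof -
      have "path_component S x y" using P[OF \<open>S \<in> \<P>\<close>] x(1) that by (simp add: path_connected_component)
      then show ?thesis by (rule path_component_of_subset[rotated]) (use \<open>S \<in> \<P>\<close> in blast)
    qed
    then show ?thesis using x(2) unfolding C_def by (blast intro: path_component_trans)
  qed
  show thesis
  proof (rule that[of "\<Union>{S\<in>\<P>. S \<subseteq> C}" "\<Union>{S\<in>\<P>. \<not> S \<subseteq> C}"])
    show "compact (\<Union>{S\<in>\<P>. S \<subseteq> C})" "compact (\<Union>{S\<in>\<P>. \<not> S \<subseteq> C})" using assms(1) P by (auto intro!: compact_Union)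
    show "\<Union>{S\<in>\<P>. S \<subseteq> C} \<inter> \<Union>{S\<in>\<P>. \<not> S \<subseteq> C} = {}" using dich by blast
    have "a \<in> C" using ab(1) unfolding C_def by (simp add: path_component_refl)
    then show "a \<in> \<Union>{S\<in>\<P>. S \<subseteq> C}" using dich ab(1) by blast
    have "b \<notin> C" using ab(3) unfolding C_def by simp
    then show "b \<in> \<Union>{S\<in>\<P>. \<not> S \<subseteq> C}" using ab(2) by blast
  qed auto
qed

section \<open>Counting the faces of a drawing\<close>

definition image_of :: "('a \<Rightarrow> complex) \<Rightarrow> ('a set \<Rightarrow> real \<Rightarrow> complex) \<Rightarrow> 'a set \<Rightarrow> 'a set set \<Rightarrow> complex set" where
  "image_of f \<gamma> V F = f ` V \<union> (\<Union>e\<in>F. path_image (\<gamma> e))"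

text \<open>A choice of points in pairwise different faces; its size is a lower bound for the number
  of faces.\<close>

definition scattered :: "complex set \<Rightarrow> complex set \<Rightarrow> bool" where
  "scattered X Q \<longleftrightarrow> finite Q \<and> Q \<inter> X = {} \<and> (\<forall>p\<in>Q. \<forall>q\<in>Q. p \<noteq> q \<longrightarrow> \<not> connected_component (- X) p q)"

context
  fixes f :: "'a \<Rightarrow> complex" and \<gamma> :: "'a set \<Rightarrow> real \<Rightarrow> complex" and V :: "'a set" and E :: "'a set set"
  assumes D: "drawing f \<gamma> V E" and V: "finite V"
begin

abbreviation "drawn \<equiv> image_of f \<gamma> V"

lemma edgeE:
  assumes "e \<in> E"
  obtains u v where "e = {u, v}" "u \<noteq> v" "u \<in> V" "v \<in> V" "arc (\<gamma> e)" "pathstart (\<gamma> e) = f u" "pathfinish (\<gamma> e) = f v"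
    "path_image (\<gamma> e) \<inter> f ` V = {f u, f v}"
  using drawingD(2)[OF D assms] by (elim exE conjE) (rule that)

lemma finite_edges: "finite E"
proof (rule finite_subset)
  show "E \<subseteq> Pow V"
  proof
    fix e assume "e \<in> E" then show "e \<in> Pow V" by (elim edgeE) simp
  qed
qed (use V in simp)

lemma edge_arc: "e \<in> E \<Longrightarrow> arc (\<gamma> e)"
  by (elim edgeE)

lemma compact_drawn: "F \<subseteq> E \<Longrightarrow> compact (drawn F)"
  unfolding image_of_def
proof (intro compact_Un compact_UN)
  show "compact (f ` V)" using V by (intro finite_imp_compact finite_imageI)
qed (use finite_subset[OF _ finite_edges] edge_arc compact_arc_image in blast)+

lemma drawn_insert: "drawn (insert e F) = drawn F \<union> path_image (\<gamma> e)"
  by (auto simp: image_of_def)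

lemma drawn_mono: "F \<subseteq> F' \<Longrightarrow> drawn F \<subseteq> drawn F'"
  by (auto simp: image_of_def)

lemma edge_Int_drawn:
  assumes e: "e \<in> E" "e \<notin> F" "F \<subseteq> E"
  shows "path_image (\<gamma> e) \<inter> drawn F = {pathstart (\<gamma> e), pathfinish (\<gamma> e)}"
proof -
  obtain u v where uv: "e = {u, v}" "u \<in> V" "v \<in> V" "pathstart (\<gamma> e) = f u" "pathfinish (\<gamma> e) = f v"
    "path_image (\<gamma> e) \<inter> f ` V = {f u, f v}" using edgeE[OF e(1)] by metis
  have "path_image (\<gamma> e) \<inter> path_image (\<gamma> e') \<subseteq> f ` V" if "e' \<in> F" for e'
  proof -
    have "path_image (\<gamma> e) \<inter> path_image (\<gamma> e') \<subseteq> f ` (e \<inter> e')" using drawingD(3)[OF D e(1), of e'] that e by blast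
    also have "\<dots> \<subseteq> f ` V" using uv by auto
    finally show ?thesis .
  qed
  then have "path_image (\<gamma> e) \<inter> drawn F = path_image (\<gamma> e) \<inter> f ` V" unfolding image_of_def by blast
  then show ?thesis using uv by simp
qed

text \<open>Induction over the edges with a map \<open>r\<close> from vertices to labels of
  components. An edge is taken into \<open>T\<close> only if it joins two labels, which then merge,
  so the size of \<open>T\<close> plus the number of labels never exceeds the size of
  \<open>V\<close>.\<close>

lemma spanning_forest:
  assumes "F \<subseteq> E" "V \<noteq> {}"
  shows "\<exists>T\<subseteq>F. card T < card V \<and> (\<forall>e\<in>F. path_component (drawn T) (pathstart (\<gamma> e)) (pathfinish (\<gamma> e)))"
proof -
  have "finite F" using assms(1) finite_edges by (rule finite_subset)
  then have "\<exists>T r. T \<subseteq> F \<and> card T + card (r ` V) \<le> card V \<and> (\<forall>e\<in>F. \<forall>u\<in>e. \<forall>v\<in>e. r u = r v) \<and>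
      (\<forall>u\<in>V. \<forall>v\<in>V. (r u :: 'a) = r v \<longrightarrow> path_component (drawn T) (f u) (f v))"
    using assms(1)
  proof (induction F)
    case empty
    show ?case by (rule exI[of _ "{}"], rule exI[of _ id]) (auto simp: image_of_def path_component_refl)
  next
    case (insert e F)
    then have "F \<subseteq> E" by simp
    from insert.IH[OF this] obtain T and r :: "'a \<Rightarrow> 'a" where T0: "T \<subseteq> F \<and> card T + card (r ` V) \<le> card V \<and>
      (\<forall>e\<in>F. \<forall>u\<in>e. \<forall>v\<in>e. r u = r v) \<and> (\<forall>u\<in>V. \<forall>v\<in>V. r u = r v \<longrightarrow> path_component (drawn T) (f u) (f v))"
      by (elim exE) (rule that)
    have T: "T \<subseteq> F" "card T + card (r ` V) \<le> card V" "\<And>e u v. e \<in> F \<Longrightarrow> u \<in> e \<Longrightarrow> v \<in> e \<Longrightarrow> r u = r v"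
      "\<And>u v. u \<in> V \<Longrightarrow> v \<in> V \<Longrightarrow> r u = r v \<Longrightarrow> path_component (drawn T) (f u) (f v)"
      using T0[THEN conjunct1] T0[THEN conjunct2, THEN conjunct1] T0[THEN conjunct2, THEN conjunct2] by blast+
    have "e \<in> E" using insert.prems by simp
    then obtain x y where xy: "e = {x, y}" "x \<in> V" "y \<in> V" "arc (\<gamma> e)" "pathstart (\<gamma> e) = f x" "pathfinish (\<gamma> e) = f y"
      using edgeE by metis
    show ?case
    proof (cases "r x = r y")
      case True
      have "r u = r v" if "e' \<in> insert e F" "u \<in> e'" "v \<in> e'" for e' u v
      proof (cases "e' = e")
        case e: True
        then have "u = x \<or> u = y" "v = x \<or> v = y" using that(2,3) xy(1) by auto
        then show ?thesis using True by metis
      next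
        case False
        then show ?thesis using T(3)[of e' u v] that by blast
      qed
      then show ?thesis using T(1,2,4) by (intro exI[of _ T] exI[of _ r]) blast
    next
      case False
      define r' where "r' u = (if r u = r x then r y else r u)" for u
      have "r' ` V \<subseteq> r ` V - {r x}" using False xy by (auto simp: r'_def)
      then have "card (r' ` V) \<le> card (r ` V - {r x})" using V by (intro card_mono) auto
      moreover have "card (r ` V - {r x}) < card (r ` V)" using V xy by (intro psubset_card_mono) auto
      moreover have "card (insert e T) \<le> Suc (card T)" by (rule card_insert_le_m1) auto
      ultimately have c: "card (insert e T) + card (r' ` V) \<le> card V" using T(2) by linarith
      have old: "path_component (drawn (insert e T)) (f u) (f v)" if "u \<in> V" "v \<in> V" "r u = r v" for u v
        using T(4)[OF that] by (rule path_component_of_subset[rotated]) (auto simp: drawn_insert)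
      have "path_component (path_image (\<gamma> e)) (f x) (f y)"
        unfolding path_component_def using xy arc_imp_path by blast
      then have new: "path_component (drawn (insert e T)) (f x) (f y)"
        by (rule path_component_of_subset[rotated]) (auto simp: drawn_insert)
      have 4: "path_component (drawn (insert e T)) (f u) (f v)" if uv: "u \<in> V" "v \<in> V" "r' u = r' v" for u v
      proof -
        consider "r u = r v" | "r u = r x" "r v = r y" | "r u = r y" "r v = r x"
          using uv(3) unfolding r'_def by (metis (full_types))
        then show ?thesis
        proof cases
          case 1 then show ?thesis using old uv by blast
        next
          case 2 then show ?thesis using old[of u x] old[of y v] new uv xy by (metis path_component_trans)
        next
          case 3 then show ?thesis using old[of u y] old[of x v] new uv xy by (metis path_component_trans path_component_sym)
        qed
      qed
      have "r' u = r' v" if "e' \<in> insert e F" "u \<in> e'" "v \<in> e'" for e' u v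
      proof (cases "e' = e")
        case True
        then show ?thesis using that xy(1) False by (auto simp: r'_def)
      next
        case False
        then show ?thesis using T(3)[of e' u v] that by (simp add: r'_def)
      qed
      then show ?thesis using T(1) c 4 by (intro exI[of _ "insert e T"] exI[of _ r']) blast
    qed
  qed
  then obtain T and r :: "'a \<Rightarrow> 'a" where T: "T \<subseteq> F" "card T + card (r ` V) \<le> card V" "\<forall>e\<in>F. \<forall>u\<in>e. \<forall>v\<in>e. r u = r v"
      "\<forall>u\<in>V. \<forall>v\<in>V. r u = r v \<longrightarrow> path_component (drawn T) (f u) (f v)" by blast
  have "card (r ` V) > 0" using V assms(2) by (simp add: card_gt_0_iff)
  then have "card T < card V" using T(2) by linarith
  moreover have "path_component (drawn T) (pathstart (\<gamma> e)) (pathfinish (\<gamma> e))" if "e \<in> F" for e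
  proof -
    have "e \<in> E" using that assms(1) by auto
    then obtain x y where xy: "e = {x, y}" "x \<in> V" "y \<in> V" "pathstart (\<gamma> e) = f x" "pathfinish (\<gamma> e) = f y"
      using edgeE by metis
    then show ?thesis using T(3,4) that by auto
  qed
  ultimately show ?thesis using T(1) by blast
qed

text \<open>Every edge outside \<open>T\<close> closes a cycle and thus splits the face
  \<open>D\<close> that contains it. At most one chosen point lies in \<open>D\<close>; it is
  replaced by two points on different sides of the cycle.\<close>

lemma many_faces:
  assumes T: "T \<subseteq> E" and e: "\<And>e. e \<in> E \<Longrightarrow> path_component (drawn T) (pathstart (\<gamma> e)) (pathfinish (\<gamma> e))"
    and F: "finite F" "F \<subseteq> E - T"
  shows "\<exists>Q. scattered (drawn (T \<union> F)) Q \<and> card Q \<ge> Suc (card F)"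
  using F
proof (induction F)
  case empty
  have "drawn T \<noteq> UNIV" using compact_drawn[OF T] not_compact_UNIV by metis
  then obtain p where "p \<notin> drawn T" by blast
  then show ?case by (intro exI[of _ "{p}"]) (auto simp: scattered_def)
next
  case (insert e F)
  define Y where "Y = drawn (T \<union> F)"
  obtain Q where Q: "scattered Y Q" "card Q \<ge> Suc (card F)" using insert unfolding Y_def by auto
  have TF: "T \<union> F \<subseteq> E" "e \<in> E" "e \<notin> T \<union> F" using T insert by auto
  have ar: "arc (\<gamma> e)" "closed Y" "path_image (\<gamma> e) \<inter> Y = {pathstart (\<gamma> e), pathfinish (\<gamma> e)}"
    unfolding Y_def by (rule edge_arc[OF TF(2)], rule compact_imp_closed[OF compact_drawn[OF TF(1)]], rule edge_Int_drawn[OF TF(2,3,1)])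
  have Yc: "path_component Y (pathstart (\<gamma> e)) (pathfinish (\<gamma> e))"
    using e[OF TF(2)] unfolding Y_def by (rule path_component_of_subset[rotated]) (rule drawn_mono, simp)
  obtain x where x: "x \<in> open_arc (\<gamma> e)" using connected_open_arc(2)[OF ar] by blast
  obtain p q where pq: "connected_component (- Y) p x" "connected_component (- Y) q x"
    "p \<notin> path_image (\<gamma> e)" "q \<notin> path_image (\<gamma> e)" "\<not> connected_component (- (Y \<union> path_image (\<gamma> e))) p q"
    by (rule cycle_new_face[OF ar Yc x])
  define D where "D = connected_component_set (- Y) x"
  have Dsub: "open_arc (\<gamma> e) \<subseteq> D"
    unfolding D_def using connected_component_maximal[OF x connected_open_arc(1)[OF ar]] connected_open_arc(3)[OF ar] by blast
  have pY: "p \<notin> Y" "q \<notin> Y" using connected_component_in[OF pq(1)] connected_component_in[OF pq(2)] by simp_all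
  have pqD: "p \<in> D" "q \<in> D" using pq(1,2)[THEN connected_component_sym] by (simp_all add: D_def)
  have far: "\<not> connected_component (- Y) a b" if "a \<notin> D" "b \<in> D" for a b
    using that unfolding D_def by (metis connected_component_sym connected_component_trans mem_Collect_eq)
  have Y': "drawn (T \<union> insert e F) = Y \<union> path_image (\<gamma> e)" unfolding Y_def using drawn_insert[of e "T \<union> F"] by simp
  have mono: "connected_component (- Y) a b" if "connected_component (- (Y \<union> path_image (\<gamma> e))) a b" for a b
    using that by (rule connected_component_of_subset) auto
  have "p \<noteq> q" using pq(5) pY pq(3) by auto
  have fin: "finite Q" using Q by (simp add: scattered_def)
  have QD: "card (Q \<inter> D) \<le> 1"
  proof -
    have "a = b" if "a \<in> Q \<inter> D" "b \<in> Q \<inter> D" for a b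
      using that Q(1) unfolding scattered_def D_def by (metis IntD1 IntD2 connected_component_sym connected_component_trans mem_Collect_eq)
    then show ?thesis using fin by (simp add: card_le_Suc0_iff_eq)
  qed
  have "card Q = card (Q - D) + card (Q \<inter> D)" using fin by (metis Int_Diff_Un Int_Diff_disjoint card_Un_disjoint finite_Diff finite_Int add.commute)
  then have "card (Q - D) \<ge> card F" using Q(2) QD by linarith
  moreover have "card ((Q - D) \<union> {p, q}) = card (Q - D) + 2"
    using pqD \<open>p \<noteq> q\<close> fin by (subst card_Un_disjoint) auto
  ultimately have card: "card ((Q - D) \<union> {p, q}) \<ge> Suc (card (insert e F))" using insert.hyps by simp
  have "scattered (drawn (T \<union> insert e F)) ((Q - D) \<union> {p, q})"
    unfolding scattered_def Y'
  proof (intro conjI ballI impI)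
    show "finite ((Q - D) \<union> {p, q})" using fin by simp
    have "path_image (\<gamma> e) \<subseteq> D \<union> Y" using Dsub ar(3) unfolding open_arc_def by blast
    then show "((Q - D) \<union> {p, q}) \<inter> (Y \<union> path_image (\<gamma> e)) = {}"
      using Q(1) pY pq(3,4) unfolding scattered_def by blast
    fix a b assume ab: "a \<in> (Q - D) \<union> {p, q}" "b \<in> (Q - D) \<union> {p, q}" "a \<noteq> b"
    then consider "a \<in> Q - D" "b \<in> Q - D" | "a \<notin> D" "b \<in> D" | "b \<notin> D" "a \<in> D" | "{a, b} = {p, q}"
      using pqD by blast
    then show "\<not> connected_component (- (Y \<union> path_image (\<gamma> e))) a b"
    proof cases
      case 1 then show ?thesis using Q(1) ab(3) mono unfolding scattered_def by blast
    next
      case 2 then show ?thesis using far mono by blast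
    next
      case 3 then show ?thesis using far mono connected_component_sym by blast
    next
      case 4 then show ?thesis using pq(5) connected_component_sym by (metis doubleton_eq_iff)
    qed
  qed
  then show ?case using card by blast
qed

text \<open>An edge whose ends are still connected without it lies on a cycle and separates at most
  two faces. Otherwise it is a bridge and borders only one.\<close>

lemma at_most_two_faces:
  assumes Q: "scattered (drawn E) Q" and e: "e \<in> E"
  shows "card {q \<in> Q. touches (drawn E) q (\<gamma> e)} \<le> 2"
proof (rule ccontr)
  assume "\<not> ?thesis"
  then have "3 \<le> card {q \<in> Q. touches (drawn E) q (\<gamma> e)}" by simp
  then obtain S where S: "S \<subseteq> {q \<in> Q. touches (drawn E) q (\<gamma> e)}" "card S = 3" by (meson obtain_subset_with_card_n)
  then obtain p q r where pqr: "S = {p, q, r}" "p \<noteq> q" "p \<noteq> r" "q \<noteq> r" by (auto simp: card_3_iff)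
  define Y where "Y = drawn (E - {e})"
  have XE: "drawn E = Y \<union> path_image (\<gamma> e)" unfolding Y_def using drawn_insert[of e "E - {e}"] e by (simp add: insert_absorb)
  have ar: "arc (\<gamma> e)" "closed Y" "path_image (\<gamma> e) \<inter> Y = {pathstart (\<gamma> e), pathfinish (\<gamma> e)}"
    unfolding Y_def by (rule edge_arc[OF e], rule compact_imp_closed[OF compact_drawn], simp, rule edge_Int_drawn[OF e], auto)
  have t: "touches (Y \<union> path_image (\<gamma> e)) x (\<gamma> e)" if "x \<in> {p, q, r}" for x using that S(1) pqr(1) XE by auto
  have n: "\<not> connected_component (- (Y \<union> path_image (\<gamma> e))) x y" if "x \<in> {p, q, r}" "y \<in> {p, q, r}" "x \<noteq> y" for x y
    using that S(1) pqr(1) Q unfolding XE scattered_def by blast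
  show False
  proof (cases "path_component Y (pathstart (\<gamma> e)) (pathfinish (\<gamma> e))")
    case True
    then show ?thesis using cycle_two_faces[OF ar True t t t, of p q r] n pqr by simp
  next
    case False
    define \<P> where "\<P> = (\<lambda>v. {f v}) ` V \<union> (\<lambda>e. path_image (\<gamma> e)) ` (E - {e})"
    have YP: "Y = \<Union>\<P>" unfolding Y_def \<P>_def image_of_def by auto
    have "finite \<P>" unfolding \<P>_def using V finite_edges by simp
    moreover have "compact S \<and> path_connected S" if "S \<in> \<P>" for S
      using that edge_arc unfolding \<P>_def by (auto simp: compact_arc_image path_connected_path_image arc_imp_path)
    moreover have "pathstart (\<gamma> e) \<in> \<Union>\<P>" "pathfinish (\<gamma> e) \<in> \<Union>\<P>" using ar(3) YP by auto
    ultimately obtain Y1 Y2 where Y12: "\<Union>\<P> = Y1 \<union> Y2" "compact Y1" "compact Y2" "Y1 \<inter> Y2 = {}" "pathstart (\<gamma> e) \<in> Y1" "pathfinish (\<gamma> e) \<in> Y2"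
      using separation_Union[of \<P> "pathstart (\<gamma> e)" "pathfinish (\<gamma> e)"] False unfolding YP by blast
    have "connected_component (- (Y \<union> path_image (\<gamma> e))) p q"
      by (rule bridge_one_face[OF ar _ Y12(2) compact_imp_closed[OF Y12(3)] Y12(4-6) t t]) (use Y12 YP in auto)
    then show ?thesis using n pqr by simp
  qed
qed

text \<open>Otherwise the boundary of the face lies in the union of at most two arcs and finitely many points,
  which does not separate the plane, so that this union is the whole drawing.\<close>

lemma at_least_three_edges:
  assumes E3: "card E \<ge> 3" and q: "q \<notin> drawn E"
  shows "card {e \<in> E. touches (drawn E) q (\<gamma> e)} \<ge> 3"
proof (rule ccontr)
  define T where "T = {e \<in> E. touches (drawn E) q (\<gamma> e)}"
  assume "\<not> ?thesis"
  then have T2: "card T \<le> 2" by (simp add: T_def)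
  have TE: "T \<subseteq> E" "finite T" using finite_edges by (auto simp: T_def)
  define C where "C = connected_component_set (- drawn E) q"
  have cXE: "closed (drawn E)" using compact_drawn[of E] compact_imp_closed by blast
  have "open C" unfolding C_def using cXE by (intro open_connected_component) auto
  have "frontier C \<subseteq> drawn E" unfolding C_def using frontier_of_connected_component_subset[of "- drawn E" q] cXE
    by (metis frontier_complement frontier_subset_closed subset_trans)
  have fr: "frontier C \<subseteq> drawn T"
  proof
    fix x assume x: "x \<in> frontier C"
    then have "x \<in> drawn E" "x \<in> closure C" using \<open>frontier C \<subseteq> drawn E\<close> by (auto simp: frontier_def)
    then consider "x \<in> f ` V" | e where "e \<in> E" "x \<in> path_image (\<gamma> e)" unfolding image_of_def by blast
    then show "x \<in> drawn T"
    proof cases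
      case 1 then show ?thesis by (simp add: image_of_def)
    next
      case (2 e)
      show ?thesis
      proof (cases "x \<in> open_arc (\<gamma> e)")
        case True
        then have "e \<in> T" using 2 \<open>x \<in> closure C\<close> unfolding T_def touches_def C_def by blast
        then show ?thesis using 2 unfolding image_of_def by blast
      next
        case False
        then have "x \<in> f ` V" using 2 edgeE[OF 2(1)] unfolding open_arc_def by (metis Diff_iff Int_iff)
        then show ?thesis by (simp add: image_of_def)
      qed
    qed
  qed
  have "connected (- ((\<Union>g\<in>\<gamma> ` T. path_image g) \<union> f ` V))"
  proof (rule connected_Compl_few_arcs)
    show "card (\<gamma> ` T) \<le> 2" using card_image_le[OF TE(2), of \<gamma>] T2 by linarith
    fix g h assume "g \<in> \<gamma> ` T" "h \<in> \<gamma> ` T" "g \<noteq> h"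
    then obtain e e' where e: "e \<in> E" "e' \<in> E" "g = \<gamma> e" "h = \<gamma> e'" "e \<noteq> e'" using TE(1) by blast
    obtain u v where uv: "e = {u, v}" "u \<noteq> v" using edgeE[OF e(1)] by metis
    obtain u' v' where uv': "e' = {u', v'}" "u' \<noteq> v'" using edgeE[OF e(2)] by metis
    have "a = b" if "a \<in> e \<inter> e'" "b \<in> e \<inter> e'" for a b using that e(5) uv uv' by blast
    then obtain x where "e \<inter> e' \<subseteq> {x}" by blast
    then have "path_image g \<inter> path_image h \<subseteq> {f x}" using drawingD(3)[OF D e(1,2,5)] e(3,4) by blast
    then show "connected (path_image g \<inter> path_image h)" by (metis connected_empty connected_sing subset_singletonD)
  qed (use TE V edge_arc in auto)
  then have con: "connected (- drawn T)" by (simp add: image_of_def Un_commute)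
  have "q \<in> C" using q connected_component_refl[of q "- drawn E"] by (simp add: C_def)
  then have "C \<inter> - drawn T \<noteq> {}" using q drawn_mono[OF TE(1)] by blast
  have "- drawn T \<subseteq> C"
  proof (rule ccontr)
    assume "\<not> - drawn T \<subseteq> C"
    then have "(- drawn T) \<inter> frontier C \<noteq> {}"
      using connected_Int_frontier[OF con, of C] \<open>C \<inter> - drawn T \<noteq> {}\<close> by blast
    then show False using fr by blast
  qed
  then have sub: "drawn E \<subseteq> drawn T" unfolding C_def using connected_component_subset[of "- drawn E" q] by blast
  have "E \<subseteq> T"
  proof
    fix e assume e: "e \<in> E"
    show "e \<in> T"
    proof (rule ccontr)
      assume "e \<notin> T"
      then have ar: "arc (\<gamma> e)" "closed (drawn T)" "path_image (\<gamma> e) \<inter> drawn T = {pathstart (\<gamma> e), pathfinish (\<gamma> e)}"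
        using edge_arc[OF e] compact_imp_closed[OF compact_drawn[OF TE(1)]] edge_Int_drawn[OF e _ TE(1)] by simp_all
      have "open_arc (\<gamma> e) \<subseteq> drawn E" using e unfolding open_arc_def image_of_def by blast
      then show False using connected_open_arc(2,3)[OF ar] sub by blast
    qed
  qed
  then have "card E \<le> card T" using TE(2) by (rule card_mono[rotated])
  then show False using T2 E3 by linarith
qed

text \<open>Counting incidences twice gives \<open>3 * card Q \<le> 2 * card E\<close>, while
  \<open>Q\<close> has at least E - T + 1 points and the forest \<open>T\<close> fewer than V edges.
  With fewer than three edges the bound is immediate from V \<ge> 3.\<close>

lemma drawing_edge_bound:
  assumes V3: "card V \<ge> 3"
  shows "card E + 6 \<le> 3 * card V"
proof (cases "card E \<ge> 3")
  case False then show ?thesis using V3 by linarith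
next
  case True
  have "V \<noteq> {}" using V3 by auto
  obtain T where T: "T \<subseteq> E" "card T < card V" "\<And>e. e \<in> E \<Longrightarrow> path_component (drawn T) (pathstart (\<gamma> e)) (pathfinish (\<gamma> e))"
    using spanning_forest[OF subset_refl \<open>V \<noteq> {}\<close>] by blast
  obtain Q where Q: "scattered (drawn (T \<union> (E - T))) Q" "card Q \<ge> Suc (card (E - T))"
    using many_faces[OF T(1) T(3), of "E - T"] finite_edges by auto
  have TE: "T \<union> (E - T) = E" "card (E - T) = card E - card T" "card T \<le> card E"
    using T(1) finite_edges by (auto intro: card_Diff_subset card_mono finite_subset)
  note Q' = Q[unfolded TE(1)]
  have fin: "finite Q" using Q' by (simp add: scattered_def)
  define R where "R q e \<longleftrightarrow> touches (drawn E) q (\<gamma> e)" for q e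
  have "3 * card Q = (\<Sum>q\<in>Q. 3)" by simp
  also have "\<dots> \<le> (\<Sum>q\<in>Q. card {e\<in>E. R q e})"
    using at_least_three_edges[OF True] Q'(1) unfolding R_def scattered_def by (intro sum_mono) blast
  also have "\<dots> = (\<Sum>q\<in>Q. \<Sum>e\<in>E. if R q e then 1 else 0)" using finite_edges by (simp add: sum.If_cases Int_def)
  also have "\<dots> = (\<Sum>e\<in>E. \<Sum>q\<in>Q. if R q e then 1 else 0)" by (rule sum.swap)
  also have "\<dots> = (\<Sum>e\<in>E. card {q\<in>Q. R q e})" using fin by (simp add: sum.If_cases Int_def)
  also have "\<dots> \<le> (\<Sum>e\<in>E. 2)" using at_most_two_faces[OF Q'(1)] unfolding R_def by (intro sum_mono)
  finally have "3 * card Q \<le> 2 * card E" by simp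
  then show ?thesis using Q'(2) T(2) TE(2,3) by linarith
qed

end

lemma planar_edge_bound:
  assumes "planar V E" "finite V" "card V \<ge> 3"
  shows "card E + 6 \<le> 3 * card V"
  using assms drawing_edge_bound unfolding planar_iff_drawing by blast

section \<open>Lower bounds for the number of layers\<close>

lemma copy_edge:
  assumes "u < n" "v < n" "u \<noteq> v" "w < m"
  shows "{(u, w), (v, w)} \<in> snd (cartesian_product (complete_graph n) (path_graph m))"
proof -
  have "{u, v} \<in> snd (complete_graph n)" "w \<in> fst (path_graph m)"
    using assms unfolding complete_graph_def path_graph_def by auto
  then show ?thesis using assms(3) unfolding cartesian_product_def snd_conv by blast
qed

text \<open>Only the first \<open>N\<close> vertices of copy 0 are counted. Thus one favourable
  value of \<open>N\<close> serves all larger \<open>n\<close>.\<close>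

lemma decomposable_product_ge:
  assumes "decomposable (cartesian_product (complete_graph n) (path_graph m)) k" and m: "m \<ge> 1" and N: "3 \<le> N" "N \<le> n"
  shows "N choose 2 \<le> k * (3 * N - 6)"
proof -
  define G where "G = cartesian_product (complete_graph n) (path_graph m)"
  obtain Es where Es: "\<And>i. i < k \<Longrightarrow> planar (fst G) (Es i)" "(\<Union>i<k. Es i) = snd G"
    using assms(1) unfolding decomposable_def G_def by blast
  define h where "h = (\<lambda>u :: nat. (u, 0 :: nat))"
  define F where "F i = {e. e \<subseteq> {0..<N} \<and> h ` e \<in> Es i}" for i
  have fst: "fst G = {0..<n} \<times> {0..<m}" by (simp add: G_def cartesian_product_def complete_graph_def path_graph_def)
  have "card (F i) \<le> 3 * N - 6" if "i < k" for i
  proof -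
    have "planar {0..<N} (F i)"
      by (rule planar_pullback[OF Es(1)[OF that], of h]) (use N m in \<open>auto simp: h_def fst F_def inj_on_def\<close>)
    then have "card (F i) + 6 \<le> 3 * N" using planar_edge_bound[of "{0..<N}"] N(1) by simp
    then show ?thesis by linarith
  qed
  then have "(\<Sum>i<k. card (F i)) \<le> (\<Sum>i<k. 3 * N - 6)" by (intro sum_mono) simp
  moreover have "card (\<Union>i<k. F i) \<le> (\<Sum>i<k. card (F i))" by (rule card_UN_le) simp
  moreover have "{e. e \<subseteq> {0..<N} \<and> card e = 2} \<subseteq> (\<Union>i<k. F i)"
  proof clarify
    fix e assume e: "e \<subseteq> {0..<N}" "card e = 2"
    then obtain u v where uv: "e = {u, v}" "u \<noteq> v" by (meson card_2_iff)
    then have "u < n" "v < n" using e N by auto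
    then have "{(u, 0), (v, 0)} \<in> snd G" unfolding G_def using uv(2) m by (intro copy_edge) auto
    then have "h ` e \<in> snd G" using uv(1) by (simp add: h_def)
    then show "e \<in> (\<Union>i<k. F i)" using e Es(2) unfolding F_def by blast
  qed
  then have "card {e. e \<subseteq> {0..<N} \<and> card e = 2} \<le> card (\<Union>i<k. F i)"
    by (rule card_mono[rotated]) (auto simp: F_def intro: finite_subset[OF _ finite_Pow_iff[THEN iffD2, of "{0..<N}"]])
  moreover have "card {e. e \<subseteq> {0..<N} \<and> card e = 2} = N choose 2" using n_subsets[of "{0..<N}" 2] by simp
  ultimately show ?thesis by simp
qed

text \<open>The complete graph on 6p + 5 vertices has 18p^2 + 27p + 10 edges, exactly one more than
  p + 1 planar layers can hold.\<close>

lemma decomposable_product_lower: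
  assumes d: "decomposable (cartesian_product (complete_graph n) (path_graph m)) k" and m: "m \<ge> 1" and N: "6 * p + 5 \<le> n"
  shows "p + 2 \<le> k"
proof (rule ccontr)
  assume "\<not> p + 2 \<le> k"
  then have "k \<le> p + 1" by simp
  have "(6 * p + 5) choose 2 \<le> k * (3 * (6 * p + 5) - 6)" by (rule decomposable_product_ge[OF d m _ N]) simp
  also have "\<dots> \<le> (p + 1) * (3 * (6 * p + 5) - 6)" using \<open>k \<le> p + 1\<close> by (rule mult_le_mono1)
  finally have "(6 * p + 5) choose 2 \<le> (p + 1) * (3 * (6 * p + 5) - 6)" .
  moreover have "(6 * p + 5) choose 2 = (6 * p + 5) * (3 * p + 2)"
  proof -
    have "(6 * p + 5) * (6 * p + 5 - 1) = 2 * ((6 * p + 5) * (3 * p + 2))" by (simp add: algebra_simps)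
    then show ?thesis unfolding choose_two by simp
  qed
  moreover have "3 * (6 * p + 5) - 6 = 18 * p + 9" by simp
  ultimately show False by (simp add: algebra_simps)
qed

lemma decomposable_product_pos:
  assumes d: "decomposable (cartesian_product (complete_graph n) (path_graph m)) k" and "m \<ge> 1" "n \<ge> 2"
  shows "1 \<le> k"
proof (rule ccontr)
  assume "\<not> 1 \<le> k"
  then have "snd (cartesian_product (complete_graph n) (path_graph m)) = {}"
    using d unfolding decomposable_def by auto
  moreover have "{(0, 0), (1, 0)} \<in> snd (cartesian_product (complete_graph n) (path_graph m))"
    using assms(2,3) by (intro copy_edge) auto
  ultimately show False by blast
qed

section \<open>The rotated layers\<close>

definition core_list :: "nat \<Rightarrow> (nat \<times> nat) list" where
  "core_list q = (let os = [0, q, 1, q + 1, zig q (q - 2), q + zig q (q - 2)] in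
     map (Pair 0) os @ map (Pair 1) os @ map (Pair 2) os @ [(3, 0), (4, 0)])"

definition zig_gap :: "nat \<Rightarrow> nat \<times> nat \<times> nat \<Rightarrow> nat \<Rightarrow> (nat \<times> nat) gap" where
  "zig_gap q = (\<lambda>(c, d, e) k. ((c, k + 1), (c, k + zig q (q - 2)), (d, k), (e, k), map (\<lambda>j. (c, k + zig q j)) [1..<q - 2]))"

definition layer_gaps :: "nat \<Rightarrow> (nat \<times> nat) gap list" where
  "layer_gaps q = concat (map (\<lambda>c. map (zig_gap q c) [0, q]) [(0, 1, 2), (1, 2, 0), (2, 0, 1)])"

text \<open>The classes are 0, 1, 2 with offsets below \<open>2q\<close>, and the hubs are \<open>(3, 0)\<close> and \<open>(4, 0)\<close>. For \<open>k = 0\<close> and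
  for \<open>k = q\<close>, the zigzag on the offsets \<open>k + 1, ..., k + q - 1\<close> of a class is joined to the vertices of offset
  \<open>k\<close> in the two other classes.\<close>

definition layer_faces :: "nat \<Rightarrow> (nat \<times> nat) set set" where
  "layer_faces q = tril (core_list q) ` set core_faces \<union> \<Union>(gap_strip ` set (layer_gaps q))"

definition plain_verts :: "nat \<Rightarrow> (nat \<times> nat) set" where
  "plain_verts q = {..<3} \<times> {..<2 * q} \<union> {(3, 0), (4, 0)}"

context
  fixes q :: nat
  assumes q: "q \<ge> 3"
begin

lemma zig_ends: "zig q 0 = 1" "2 \<le> zig q (q - 2)" "zig q (q - 2) < q"
proof -
  show "zig q 0 = 1" by (simp add: zig_def)
  have "q - 2 < q - 1" "0 < q - 1" "q - 2 \<noteq> 0" using q by auto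
  then have "zig q (q - 2) \<noteq> zig q 0" using inj_onD[OF zig_inj, of q "q - 2" 0] by (metis lessThan_iff)
  then show "2 \<le> zig q (q - 2)" "zig q (q - 2) < q"
    using zig_range[of "q - 2" q] q by (auto simp: zig_def)
qed

lemma core_list: "distinct (core_list q)" "length (core_list q) = 20"
  using zig_ends q by (auto simp: core_list_def Let_def)

lemma core_nths:
  "core_list q ! 0 = (0, 0)" "core_list q ! Suc 0 = (0, q)" "core_list q ! 2 = (0, 1)" "core_list q ! 3 = (0, q + 1)"
  "core_list q ! 4 = (0, zig q (q - 2))" "core_list q ! 5 = (0, q + zig q (q - 2))"
  "core_list q ! 6 = (1, 0)" "core_list q ! 7 = (1, q)" "core_list q ! 8 = (1, 1)" "core_list q ! 9 = (1, q + 1)"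
  "core_list q ! 10 = (1, zig q (q - 2))" "core_list q ! 11 = (1, q + zig q (q - 2))"
  "core_list q ! 12 = (2, 0)" "core_list q ! 13 = (2, q)" "core_list q ! 14 = (2, 1)" "core_list q ! 15 = (2, q + 1)"
  "core_list q ! 16 = (2, zig q (q - 2))" "core_list q ! 17 = (2, q + zig q (q - 2))"
  "core_list q ! 18 = (3, 0)" "core_list q ! 19 = (4, 0)"
  by (simp_all add: core_list_def nth_append)

lemma core_gap_faces: "\<Union>(gap_faces ` set (layer_gaps q)) = tril (core_list q) ` set core_gaps"
  by (simp add: layer_gaps_def zig_gap_def gap_faces_def core_gaps_def tril_def core_nths insert_commute Un_ac)

lemma core_disjoint: "tri ` set core_faces \<inter> tri ` set core_gaps = {}"
proof -
  have "list_all (\<lambda>f. list_all (\<lambda>g. \<not> tri f \<subseteq> tri g) core_gaps) core_faces" by code_simp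
  then show ?thesis unfolding list_all_iff by blast
qed

text \<open>The two ends of a gap and its new vertices together are the whole zigzag. Instantiated
  with \<open>refl\<close>, this is a rewrite rule.\<close>

lemma zig_list: "xs = (c, k + 1) # map (\<lambda>j. (c, k + zig q j)) [1..<q - 2] @ [(c, k + zig q (q - 2))] \<Longrightarrow>
   xs = map (\<lambda>j. (c, k + zig q j)) [0..<q - 1]"
proof -
  have "[0..<q - 1] = 0 # [1..<q - 2] @ [q - 2]"
  proof -
    have "q - 1 = Suc (q - 2)" using q by simp
    then have "[0..<q - 1] = [0..<q - 2] @ [q - 2]" by simp
    moreover have "[0..<q - 2] = 0 # [1..<q - 2]" using q by (simp add: upt_conv_Cons)
    ultimately show ?thesis by simp
  qed
  then show "xs = (c, k + 1) # map (\<lambda>j. (c, k + zig q j)) [1..<q - 2] @ [(c, k + zig q (q - 2))] \<Longrightarrow>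
   xs = map (\<lambda>j. (c, k + zig q j)) [0..<q - 1]" by (simp add: zig_ends(1))
qed

lemma gap_strip_zig: "gap_strip (zig_gap q (c, d, e) k) = strip (map (\<lambda>j. (c, k + zig q j)) [0..<q - 1]) (d, k) (e, k)"
  unfolding gap_strip_def zig_gap_def prod.case using zig_list[OF refl, of c k] by simp

lemma in_layer_gaps:
  "s \<in> set (layer_gaps q) \<longleftrightarrow> (\<exists>c d e k. (c, d, e) \<in> {(0, 1, 2), (1, 2, 0), (2, 0, 1)} \<and> k \<in> {0, q} \<and> s = zig_gap q (c, d, e) k)"
  by (auto simp: layer_gaps_def)

lemma zig_inner: "j \<in> {1..<q - 2} \<Longrightarrow> 1 < zig q j \<and> zig q j < q \<and> zig q j \<noteq> zig q (q - 2)"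
  using zig_range[of j q] inj_onD[OF zig_inj, of q j 0] inj_onD[OF zig_inj, of q j "q - 2"] zig_ends(1) q by force

text \<open>In both halves of each class the core supplies the offset 0 and the two ends of the
  zigzag, and the strips supply its inner entries. As the zigzag is onto 1, ..., q - 1, no offset is
  left out.\<close>

lemma triang_layer: "triang (plain_verts q) (layer_faces q)"
proof -
  define G where "G = tril (core_list q) ` set core_faces"
  have T: "triang (set (core_list q)) (G \<union> \<Union>(gap_faces ` set (layer_gaps q)))"
    using triang_relabel[OF triang_core core_list] unfolding core_gap_faces G_def by (simp add: image_Un)
  have GD: "\<Union>(gap_faces ` set (layer_gaps q)) \<inter> G = {}"
  proof -
    have im: "tril (core_list q) ` F = (`) ((!) (core_list q)) ` tri ` F" for F
      unfolding image_image by (rule image_cong) (auto simp: tri_def tril_def)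
    have sub: "tri ` set core_faces \<subseteq> Pow {..<20}" "tri ` set core_gaps \<subseteq> Pow {..<20}"
      using triangD(2)[OF triang_core] by (auto simp: image_Un)
    have inj: "inj_on ((`) ((!) (core_list q))) (Pow {..<20})"
      using core_list by (intro inj_on_image_Pow inj_on_nth) auto
    show ?thesis unfolding core_gap_faces G_def im
      unfolding inj_on_image_Int[OF inj sub(2,1), symmetric] using core_disjoint by (simp add: Int_commute)
  qed
  have "triang (set (core_list q) \<union> \<Union>((set \<circ> gap_new) ` set (layer_gaps q))) (G \<union> \<Union>(gap_strip ` set (layer_gaps q)))"
  proof (rule triang_strips[OF T])
    show "distinct (layer_gaps q)" using q by (auto simp: layer_gaps_def zig_gap_def)
  next
    fix s assume s: "s \<in> set (layer_gaps q)"
    then obtain c d e k where cde: "(c, d, e) \<in> {(0, 1, 2), (1, 2, 0), (2, 0, 1)}" "k \<in> {0, q}" "s = zig_gap q (c, d, e) k"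
      unfolding in_layer_gaps by blast
    have "distinct (gap_new s)"
      using inj_on_subset[OF zig_inj[of q], of "{1..<q - 2}"] unfolding cde(3) gap_new_def zig_gap_def prod.case
      by (force simp: distinct_map inj_on_def)
    moreover have "set (gap_new s) \<inter> set (core_list q) = {}"
      using cde(1,2) zig_ends q zig_inner unfolding cde(3) gap_new_def zig_gap_def prod.case core_list_def Let_def
      by fastforce
    moreover have "fst (gap_poles s) \<noteq> snd (gap_poles s)" using cde by (auto simp: gap_poles_def zig_gap_def)
    moreover have "gap_faces s \<inter> G = {}" using GD s by blast
    ultimately show "gap_faces s \<inter> G = {} \<and> fst (gap_poles s) \<noteq> snd (gap_poles s) \<and> distinct (gap_new s) \<and> set (gap_new s) \<inter> set (core_list q) = {}"
      by blast
  next
    fix s s' assume s: "s \<in> set (layer_gaps q)" "s' \<in> set (layer_gaps q)" "s \<noteq> s'"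
    obtain c d e k where cde: "(c, d, e) \<in> {(0, 1, 2), (1, 2, 0), (2, 0, 1)}" "k \<in> {0, q}" "s = zig_gap q (c, d, e) k"
      using s(1) unfolding in_layer_gaps by blast
    obtain c' d' e' k' where cde': "(c', d', e') \<in> {(0, 1, 2), (1, 2, 0), (2, 0, 1)}" "k' \<in> {0, q}" "s' = zig_gap q (c', d', e') k'"
      using s(2) unfolding in_layer_gaps by blast
    have ne: "c \<noteq> c' \<or> (k = 0 \<and> k' = q) \<or> (k = q \<and> k' = 0)" using s(3) cde cde' by auto
    have "gap_end s = (c, k + zig q (q - 2))" by (simp add: cde(3) gap_end_def zig_gap_def)
    moreover have "gap_verts s' = {(c', k' + 1), (c', k' + zig q (q - 2)), (d', k'), (e', k')} \<union> set (gap_new s')"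
      by (simp add: cde'(3) gap_verts_def gap_new_def zig_gap_def)
    moreover have new: "x = c' \<and> k' < y \<and> y < k' + q" if "(x, y) \<in> set (gap_new s')" for x y
      using that zig_inner by (fastforce simp: cde'(3) gap_new_def zig_gap_def)
    moreover have new': "x = c \<and> k < y \<and> y < k + q" if "(x, y) \<in> set (gap_new s)" for x y
      using that zig_inner by (fastforce simp: cde(3) gap_new_def zig_gap_def)
    ultimately show "gap_end s \<notin> gap_verts s' \<and> set (gap_new s) \<inter> set (gap_new s') = {}"
      using ne zig_ends(2,3) cde(2) cde'(2) by fastforce
  qed
  moreover have "set (core_list q) \<union> \<Union>((set \<circ> gap_new) ` set (layer_gaps q)) = plain_verts q"
  proof
    have "gap_new (zig_gap q (c, d, e) k) = map (\<lambda>j. (c, k + zig q j)) [1..<q - 2]" for c d e k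
      by (simp add: gap_new_def zig_gap_def)
    then have new: "\<Union>((set \<circ> gap_new) ` set (layer_gaps q)) = (\<Union>c\<in>{0, 1, 2}. \<Union>k\<in>{0, q}. (\<lambda>j. (c, k + zig q j)) ` {1..<q - 2})"
      unfolding layer_gaps_def by (simp add: Un_ac)
    show "set (core_list q) \<union> \<Union>((set \<circ> gap_new) ` set (layer_gaps q)) \<subseteq> plain_verts q"
      unfolding new using zig_ends q zig_inner by (fastforce simp: core_list_def Let_def plain_verts_def)
    show "plain_verts q \<subseteq> set (core_list q) \<union> \<Union>((set \<circ> gap_new) ` set (layer_gaps q))"
    proof
      fix x assume "x \<in> plain_verts q"
      then consider "x = (3, 0) \<or> x = (4, 0)" | c o' where "x = (c, o')" "c < 3" "o' < 2 * q" unfolding plain_verts_def by auto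
      then show "x \<in> set (core_list q) \<union> \<Union>((set \<circ> gap_new) ` set (layer_gaps q))"
      proof cases
        case 1 then show ?thesis by (auto simp: core_list_def Let_def)
      next
        case (2 c o')
        define k where "k = (if o' < q then 0 else q)"
        have k: "k \<in> {0, q}" "k \<le> o'" "o' - k < q" using 2 by (auto simp: k_def)
        have c: "c \<in> {0, 1, 2}" using 2 by auto
        have core: "(c, k + o'') \<in> set (core_list q)" if "o'' \<in> {0, 1, zig q (q - 2)}" for o''
          using that c k(1) by (elim insertE emptyE) (simp_all add: core_list_def Let_def)
        show ?thesis
        proof (cases "o' - k = 0")
          case True then show ?thesis using core[of 0] k 2 by simp
        next
          case False
          then have "1 \<le> o' - k" "o' - k \<le> q - 1" using k(3) by linarith+
          from zig_surj[OF this] obtain j where j: "j < q - 1" "zig q j = o' - k" by blast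
          then have x: "x = (c, k + zig q j)" using 2 k by simp
          consider "j = 0" | "j = q - 2" | "j \<in> {1..<q - 2}" using j by force
          then show ?thesis
          proof cases
            case 1 then show ?thesis using core[of 1] zig_ends(1) x by simp
          next
            case 2 then show ?thesis using core[of "zig q (q - 2)"] x by simp
          next
            case 3
            then show ?thesis using x c k(1) unfolding new by blast
          qed
        qed
      qed
    qed
  qed
  ultimately show ?thesis unfolding layer_faces_def G_def by simp
qed

lemma core_face: "f \<in> set core_faces \<Longrightarrow> tril (core_list q) f \<in> layer_faces q"
  unfolding layer_faces_def by blast

lemma strip_face_layer:
  assumes "(c, d, e) \<in> {(0, 1, 2), (1, 2, 0), (2, 0, 1)}" "k \<in> {0, q}"
  shows "strip (map (\<lambda>j. (c, k + zig q j)) [0..<q - 1]) (d, k) (e, k) \<subseteq> layer_faces q"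
proof -
  have "zig_gap q (c, d, e) k \<in> set (layer_gaps q)" using assms unfolding in_layer_gaps by blast
  then show ?thesis unfolding layer_faces_def gap_strip_zig[symmetric] by blast
qed

lemma layer_pole:
  assumes "(c, d, e) \<in> {(0, 1, 2), (1, 2, 0), (2, 0, 1)}" "k \<in> {0, q}" "1 \<le> s" "s < q"
  shows "joined (layer_faces q) (c, k + s) (d, k)" "joined (layer_faces q) (c, k + s) (e, k)"
proof -
  obtain j where j: "j < q - 1" "zig q j = s" using zig_surj[of s q] assms(3,4) by (metis Suc_diff_1 less_Suc_eq_le less_le_trans not_gr_zero not_less_zero)
  have "(c, k + s) \<in> set ((c, k + 1) # map (\<lambda>j. (c, k + zig q j)) [1..<q - 2] @ [(c, k + zig q (q - 2))])"
    unfolding zig_list[OF refl] using j by auto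
  from strip_pole[OF this, of "(d, k)" "(e, k)"] strip_face_layer[OF assms(1,2)]
  show "joined (layer_faces q) (c, k + s) (d, k)" "joined (layer_faces q) (c, k + s) (e, k)"
    unfolding zig_list[OF refl] by (blast intro: joined_mono)+
qed

text \<open>Under the rotations, \<open>k + r\<close> runs through all residues modulo 2q. So this
  yields all pairs in different classes whose offsets differ by 1 to q - 1, in both
  directions.\<close>

lemma layer_across:
  assumes "c < 3" "d < 3" "c \<noteq> d" "k \<in> {0, q}" "1 \<le> s" "s < q"
  shows "joined (layer_faces q) (c, k + s) (d, k)"
proof -
  have "(c, d) \<in> {(0,1),(0,2),(1,2),(1,0),(2,0),(2,1)}" using assms by auto
  then show ?thesis using layer_pole[of 0 1 2 k s] layer_pole[of 1 2 0 k s] layer_pole[of 2 0 1 k s] assms(4-6) by auto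
qed

text \<open>One start \<open>s\<close> works for both values of \<open>k\<close>, so the rotations
  carry the difference \<open>d\<close> to every position of the class.\<close>

lemma layer_within:
  assumes "c < 3" "1 \<le> d" "d \<le> q - 2"
  shows "\<exists>s. s + d < q \<and> (\<forall>k\<in>{0, q}. joined (layer_faces q) (c, k + s) (c, k + s + d))"
proof -
  obtain j where j: "Suc j < q - 1" "zig q (Suc j) = zig q j + d \<or> zig q j = zig q (Suc j) + d"
    using zig_diff[OF assms(2,3)] by blast
  have "c \<in> {0, 1, 2}" using assms by auto
  then obtain d' e :: nat where cde: "(c, d', e) \<in> {(0, 1, 2), (1, 2, 0), (2, 0, 1)}" by auto
  have J: "joined (layer_faces q) (c, k + zig q j) (c, k + zig q (Suc j))" if "k \<in> {0, q}" for k
  proof (rule joinedI)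
    show "{(c, k + zig q j), (c, k + zig q (Suc j)), (d', k)} \<in> layer_faces q"
      using strip_consecutive[of j "map (\<lambda>j. (c, k + zig q j)) [0..<q - 1]" "(d', k)" "(e, k)"]
        strip_face_layer[OF cde that] j(1) by auto
  qed auto
  have r: "zig q j < q" "zig q (Suc j) < q" using zig_range[of j q] zig_range[of "Suc j" q] j q by auto
  from j(2) show ?thesis
  proof
    assume h: "zig q (Suc j) = zig q j + d"
    then show ?thesis using J r by (intro exI[of _ "zig q j"]) (simp add: add.assoc)
  next
    assume h: "zig q j = zig q (Suc j) + d"
    then show ?thesis using J[THEN joined_sym] r by (intro exI[of _ "zig q (Suc j)"]) (simp add: add.assoc)
  qed
qed

lemma layer_index: "pair_in core_faces a b \<Longrightarrow> joined (layer_faces q) (core_list q ! a) (core_list q ! b)"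
  unfolding joined_tri[symmetric] joined_def
proof (elim bexE conjE)
  fix t assume "t \<in> tri ` set core_faces" "a \<in> t" "b \<in> t"
  then obtain f where "f \<in> set core_faces" "a \<in> tri f" "b \<in> tri f" by blast
  then show "\<exists>t\<in>layer_faces q. core_list q ! a \<in> t \<and> core_list q ! b \<in> t"
    using core_face by (intro bexI[of _ "tril (core_list q) f"]) (auto simp: tri_def tril_def)
qed

text \<open>Differences that the zigzags miss: q + 1 within a class, which is q - 1 read backwards;
  0 between classes; and q from class 0 to the classes 1 and 2. Still missing are the difference q
  within each class and between the classes 1 and 2.\<close>

lemma layer_special:
  assumes "k = 0 \<and> l = q \<or> k = q \<and> l = 0"
  shows "c < 3 \<Longrightarrow> joined (layer_faces q) (c, k) (c, l + 1)"
    and "c < 3 \<Longrightarrow> d < 3 \<Longrightarrow> c \<noteq> d \<Longrightarrow> joined (layer_faces q) (c, k + zig q (q - 2)) (d, k + zig q (q - 2))"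
    and "joined (layer_faces q) (0, k) (1, l)"
    and "joined (layer_faces q) (0, k + 1) (2, l + 1)"
proof -
  have "list_all (\<lambda>(a, b). pair_in core_faces a b)
    [(0, 3), (1, 2), (6, 9), (7, 8), (12, 15), (13, 14), (4, 10), (4, 16), (10, 16), (5, 11), (5, 17), (11, 17),
     (0, 7), (1, 6), (2, 15), (3, 14)]" by code_simp
  then have p: "pair_in core_faces 0 3" "pair_in core_faces 1 2" "pair_in core_faces 6 9" "pair_in core_faces 7 8"
    "pair_in core_faces 12 15" "pair_in core_faces 13 14" "pair_in core_faces 4 10" "pair_in core_faces 4 16"
    "pair_in core_faces 10 16" "pair_in core_faces 5 11" "pair_in core_faces 5 17" "pair_in core_faces 11 17"
    "pair_in core_faces 0 7" "pair_in core_faces 1 6" "pair_in core_faces 2 15" "pair_in core_faces 3 14"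
    by (simp_all only: list.pred_inject prod.case)
  note J = p[THEN layer_index, unfolded core_nths One_nat_def]
  have kl: "(k, l) = (0, q) \<or> (k, l) = (q, 0)" using assms by auto
  show "c < 3 \<Longrightarrow> joined (layer_faces q) (c, k) (c, l + 1)"
  proof -
    assume "c < 3"
    then have "c \<in> {0, 1, 2}" by auto
    then show ?thesis using kl J(1-6) by auto
  qed
  show "c < 3 \<Longrightarrow> d < 3 \<Longrightarrow> c \<noteq> d \<Longrightarrow> joined (layer_faces q) (c, k + zig q (q - 2)) (d, k + zig q (q - 2))"
  proof -
    assume "c < 3" "d < 3" "c \<noteq> d"
    then have "(c, d) \<in> {(0,1),(0,2),(1,2),(1,0),(2,0),(2,1)}" by auto
    then show ?thesis using kl J(7-12) J(7-12)[THEN joined_sym] by auto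
  qed
  show "joined (layer_faces q) (0, k) (1, l)" using kl J(13,14) by auto
  show "joined (layer_faces q) (0, k + 1) (2, l + 1)" using kl J(15,16) by auto
qed

text \<open>Rotating each of these edges covers q consecutive offsets. Hub 3 thus misses only
  \<open>(1, 0)\<close> and \<open>(2, q)\<close> in the classes 1 and 2, and hub 4 only
  \<open>(1, q)\<close> and \<open>(2, 0)\<close>.\<close>

lemma layer_hubs:
  "joined (layer_faces q) (3, 0) (1, q)" "joined (layer_faces q) (3, 0) (1, 1)"
  "joined (layer_faces q) (3, 0) (2, 0)" "joined (layer_faces q) (3, 0) (2, q + 1)"
  "joined (layer_faces q) (4, 0) (1, 0)" "joined (layer_faces q) (4, 0) (1, q + 1)"
  "joined (layer_faces q) (4, 0) (2, q)" "joined (layer_faces q) (4, 0) (2, 1)"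
proof -
  have "list_all (\<lambda>(a, b). pair_in core_faces a b)
    [(18, 7), (18, 8), (18, 12), (18, 15), (19, 6), (19, 9), (19, 13), (19, 14)]" by code_simp
  then have p: "pair_in core_faces 18 7" "pair_in core_faces 18 8" "pair_in core_faces 18 12" "pair_in core_faces 18 15"
    "pair_in core_faces 19 6" "pair_in core_faces 19 9" "pair_in core_faces 19 13" "pair_in core_faces 19 14"
    by (simp_all only: list.pred_inject prod.case)
  show "joined (layer_faces q) (3, 0) (1, q)" "joined (layer_faces q) (3, 0) (1, 1)"
    "joined (layer_faces q) (3, 0) (2, 0)" "joined (layer_faces q) (3, 0) (2, q + 1)"
    "joined (layer_faces q) (4, 0) (1, 0)" "joined (layer_faces q) (4, 0) (1, q + 1)"
    "joined (layer_faces q) (4, 0) (2, q)" "joined (layer_faces q) (4, 0) (2, 1)"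
    using p[THEN layer_index] unfolding core_nths by simp_all
qed

text \<open>The faces that will receive z or w. For the last one only two corners are stated, since
  the third depends on the neighbours of 2 in the zigzag.\<close>

lemma layer_free_faces:
  "{(0, q), (0, 1), (2, q + 1)} \<in> layer_faces q" "{(0, 0), (0, q + 1), (2, 1)} \<in> layer_faces q"
  "{(0, q), (0, 1), (1, 0)} \<in> layer_faces q" "{(0, 0), (0, q + 1), (1, q)} \<in> layer_faces q"
  "{(0, 0), (1, q), (1, 1)} \<in> layer_faces q" "{(0, q + 1), (0, 2 * q - 1), (1, q)} \<in> layer_faces q"
  "\<exists>t\<in>layer_faces q. (2, q + 2) \<in> t \<and> (0, q) \<in> t"
proof -
  have "(1, 2, 15) \<in> set core_faces" "(0, 3, 14) \<in> set core_faces" "(1, 2, 6) \<in> set core_faces"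
    "(0, 3, 7) \<in> set core_faces" "(0, 7, 8) \<in> set core_faces"
    by (simp_all add: core_faces_def)
  from this[THEN core_face]
  show "{(0, q), (0, 1), (2, q + 1)} \<in> layer_faces q" "{(0, 0), (0, q + 1), (2, 1)} \<in> layer_faces q"
    "{(0, q), (0, 1), (1, 0)} \<in> layer_faces q" "{(0, 0), (0, q + 1), (1, q)} \<in> layer_faces q"
    "{(0, 0), (1, q), (1, 1)} \<in> layer_faces q"
    by (simp_all add: tril_def core_nths)
  have e: "zig q 0 = 1" "zig q (Suc 0) = q - 1" by (simp_all add: zig_def)
  have "{(0, q + zig q 0), (0, q + zig q (Suc 0)), (1, q)} \<in> layer_faces q"
    using strip_consecutive[of 0 "map (\<lambda>j. (0, q + zig q j)) [0..<q - 1]" "(1, q)" "(2 :: nat, q)"]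
      strip_face_layer[of 0 1 2 q] q by auto
  then show "{(0, q + 1), (0, 2 * q - 1), (1, q)} \<in> layer_faces q"
    unfolding e using q by (simp add: mult_2)
  show "\<exists>t\<in>layer_faces q. (2, q + 2) \<in> t \<and> (0, q) \<in> t"
    using layer_pole(1)[of 2 0 1 q 2] q unfolding joined_def by simp
qed

end

section \<open>Rotations, and the pieces of the last layer\<close>

definition rot :: "nat \<Rightarrow> nat \<Rightarrow> nat \<times> nat \<Rightarrow> nat \<times> nat" where
  "rot q r = (\<lambda>(c, i). if c < 3 then (c, (i + r) mod (2 * q)) else (c, i))"

text \<open>The two faces of the unrotated layer into which the rotation \<open>r\<close> puts \<open>z = (5, 0)\<close> and \<open>w = (6, 0)\<close>. They are
  chosen such that, over all \<open>r\<close>, all vertices of class 0 but one become adjacent to \<open>z\<close>, all but another one to \<open>w\<close>,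
  and the vertices of offset 0 or \<open>q\<close> in class 2 to \<open>z\<close>, in class 1 to \<open>w\<close>.\<close>

definition low_host :: "nat \<Rightarrow> nat \<Rightarrow> (nat \<times> nat) set" where
  "low_host q r = (if r + 3 \<le> q then {(0, q), (0, 1), (2, q + 1)}
     else if r + 2 = q then {(2, q + 2), (0, q)} else {(0, 0), (0, q + 1), (2, 1)})"

definition high_host :: "nat \<Rightarrow> nat \<Rightarrow> (nat \<times> nat) set" where
  "high_host q r = (if r = 0 then {(0, q), (0, 1), (1, 0)}
     else if r = 1 then {(0, q + 1), (0, 2 * q - 1), (1, q)}
     else if r + 2 \<le> q then {(0, 0), (0, q + 1), (1, q)} else {(0, 0), (1, q), (1, 1)})"

lemma triang_host_two:
  assumes T: "triang V K" and F: "F \<in> K" "F' \<in> K" "F \<noteq> F'" and zw: "z \<notin> V" "w \<notin> V" "z \<noteq> w"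
  shows "\<exists>K'. triang (insert w (insert z V)) K' \<and> (\<forall>x y. joined K x y \<longrightarrow> joined K' x y) \<and>
    (\<forall>x\<in>F. joined K' x z) \<and> (\<forall>x\<in>F'. joined K' x w)"
proof -
  obtain a b c where abc: "F = {a, b, c}" using triangD(2)[OF T F(1)] by (auto simp: card_3_iff)
  obtain a' b' c' where abc': "F' = {a', b', c'}" using triangD(2)[OF T F(2)] by (auto simp: card_3_iff)
  obtain K1 where K1: "triang (insert z V) K1" "\<And>x y. joined K x y \<Longrightarrow> joined K1 x y"
    "\<And>x. x \<in> F \<Longrightarrow> joined K1 x z" "K - {F} \<subseteq> K1"
    using triang_host[OF T F(1)[unfolded abc] zw(1)] unfolding abc[symmetric] by blast
  have "F' \<in> K1" using K1(4) F by blast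
  moreover have "w \<notin> insert z V" using zw by auto
  ultimately obtain K2 where "triang (insert w (insert z V)) K2" "\<And>x y. joined K1 x y \<Longrightarrow> joined K2 x y"
    "\<And>x. x \<in> F' \<Longrightarrow> joined K2 x w"
    using triang_host[OF K1(1), of a' b' c' w] unfolding abc'[symmetric] by blast
  then show ?thesis using K1(2,3) by blast
qed

lemma finite_plain_verts: "finite (plain_verts q)" "card (plain_verts q) = 6 * q + 2"
proof -
  show "finite (plain_verts q)" by (simp add: plain_verts_def)
  have "{..<3} \<times> {..<2 * q} \<inter> {(3, 0), (4, 0)} = ({} :: (nat \<times> nat) set)" by auto
  then show "card (plain_verts q) = 6 * q + 2" unfolding plain_verts_def
    by (subst card_Un_disjoint) auto
qed

context
  fixes q :: nat
  assumes q: "q \<ge> 3"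
begin

lemma rot_bij: "inj_on (rot q r) (plain_verts q)" "rot q r ` plain_verts q = plain_verts q"
proof -
  have le: "i = j" if h: "j \<le> i" "i < 2 * q" "(i + r) mod (2 * q) = (j + r) mod (2 * q)" for i j
  proof -
    have "2 * q dvd (i + r) - (j + r)" using h(1,3) mod_eq_dvd_iff_nat[of "j + r" "i + r" "2 * q"] by simp
    then have "2 * q dvd i - j" by simp
    moreover have "i - j < 2 * q" using h(2) by simp
    ultimately have "i - j = 0" using dvd_imp_le by (metis not_less not_gr_zero)
    then show ?thesis using h(1) by simp
  qed
  then have m: "i = j" if h: "i < 2 * q" "j < 2 * q" "(i + r) mod (2 * q) = (j + r) mod (2 * q)" for i j
    using le[of i j] le[of j i] h by (metis nle_le)
  show inj: "inj_on (rot q r) (plain_verts q)"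
  proof (rule inj_onI)
    fix x y assume xy: "x \<in> plain_verts q" "y \<in> plain_verts q" "rot q r x = rot q r y"
    obtain c i where x: "x = (c, i)" by (cases x)
    obtain d j where y: "y = (d, j)" by (cases y)
    have cd: "c = d" using xy(3) by (simp add: rot_def x y split: if_splits)
    show "x = y"
    proof (cases "c < 3")
      case True
      then show ?thesis using m[of i j] xy cd by (simp add: rot_def x y plain_verts_def)
    next
      case False
      then show ?thesis using xy cd by (simp add: rot_def x y)
    qed
  qed
  have "rot q r ` plain_verts q \<subseteq> plain_verts q" using q by (auto simp: rot_def plain_verts_def)
  then show "rot q r ` plain_verts q = plain_verts q"
    using endo_inj_surj[OF finite_plain_verts(1) _ inj] by blast
qed

lemma hosts:
  assumes "r < q"
  shows "\<exists>F\<in>layer_faces q. \<exists>F'\<in>layer_faces q. F \<noteq> F' \<and> low_host q r \<subseteq> F \<and> high_host q r \<subseteq> F'"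
proof -
  have "\<exists>F\<in>layer_faces q. low_host q r \<subseteq> F"
  proof -
    consider "r + 3 \<le> q" | "r + 2 = q" | "\<not> r + 3 \<le> q" "r + 2 \<noteq> q" by blast
    then show ?thesis
    proof cases
      case 1 then show ?thesis by (intro bexI[OF _ layer_free_faces(1)[OF q]]) (simp add: low_host_def)
    next
      case 2
      obtain t where "t \<in> layer_faces q" "(2, q + 2) \<in> t" "(0, q) \<in> t" using layer_free_faces(7)[OF q] by blast
      then show ?thesis using 2 by (intro bexI[of _ t]) (simp_all add: low_host_def)
    next
      case 3 then show ?thesis by (intro bexI[OF _ layer_free_faces(2)[OF q]]) (simp add: low_host_def)
    qed
  qed
  then obtain F where F: "F \<in> layer_faces q" "low_host q r \<subseteq> F" by blast
  have high: "high_host q r \<in> layer_faces q"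
    using layer_free_faces(3-6)[OF q] unfolding high_host_def by simp
  \<comment> \<open>The two faces differ because only the one for z has a corner in class 2.\<close>
  have "\<exists>x\<in>low_host q r. fst x = 2" by (auto simp: low_host_def)
  moreover have "\<forall>x\<in>high_host q r. fst x \<noteq> 2" by (auto simp: high_host_def)
  ultimately have "F \<noteq> high_host q r" using F(2) by blast
  then show ?thesis using F high by blast
qed

lemma layers:
  "\<exists>K. \<forall>r<q. triang (insert (6, 0) (insert (5, 0) (plain_verts q))) (K r) \<and>
     (\<forall>x y. joined (layer_faces q) x y \<longrightarrow> joined (K r) (rot q r x) (rot q r y)) \<and>
     (\<forall>x\<in>low_host q r. joined (K r) (rot q r x) (5, 0)) \<and>
     (\<forall>x\<in>high_host q r. joined (K r) (rot q r x) (6, 0))"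
proof -
  have "\<exists>K. triang (insert (6, 0) (insert (5, 0) (plain_verts q))) K \<and>
     (\<forall>x y. joined (layer_faces q) x y \<longrightarrow> joined K (rot q r x) (rot q r y)) \<and>
     (\<forall>x\<in>low_host q r. joined K (rot q r x) (5, 0)) \<and>
     (\<forall>x\<in>high_host q r. joined K (rot q r x) (6, 0))" if r: "r < q" for r
  proof -
    obtain F F' where F: "F \<in> layer_faces q" "F' \<in> layer_faces q" "F \<noteq> F'" "low_host q r \<subseteq> F" "high_host q r \<subseteq> F'"
      using hosts[OF r] by blast
    have T: "triang (plain_verts q) ((`) (rot q r) ` layer_faces q)"
      using triang_image[OF triang_layer[OF q] rot_bij(1)] rot_bij(2) by simp
    have zw: "(5, 0) \<notin> plain_verts q" "(6, 0) \<notin> plain_verts q" "(5, 0) \<noteq> (6 :: nat, 0 :: nat)"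
      by (simp_all add: plain_verts_def)
    have "rot q r ` F \<noteq> rot q r ` F'"
      using inj_on_image_eq_iff[OF rot_bij(1)] triangD(2)[OF triang_layer[OF q]] F(1-3) by blast
    from triang_host_two[OF T imageI[OF F(1)] imageI[OF F(2)] this zw]
    obtain K where K: "triang (insert (6, 0) (insert (5, 0) (plain_verts q))) K \<and>
      (\<forall>x y. joined ((`) (rot q r) ` layer_faces q) x y \<longrightarrow> joined K x y) \<and>
      (\<forall>x\<in>rot q r ` F. joined K x (5, 0)) \<and> (\<forall>x\<in>rot q r ` F'. joined K x (6, 0))"
      by (elim exE) (rule that)
    show ?thesis
    proof (intro exI[of _ K] conjI allI impI ballI)
      show "triang (insert (6, 0) (insert (5, 0) (plain_verts q))) K" using K by (rule conjunct1)
      show "joined K (rot q r x) (rot q r y)" if "joined (layer_faces q) x y" for x y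
        using K[THEN conjunct2, THEN conjunct1, rule_format, OF joined_image[OF that]] .
      show "joined K (rot q r x) (5, 0)" if "x \<in> low_host q r" for x
        using K[THEN conjunct2, THEN conjunct2, THEN conjunct1, rule_format, OF imageI[OF subsetD[OF F(4) that]]] .
      show "joined K (rot q r x) (6, 0)" if "x \<in> high_host q r" for x
        using K[THEN conjunct2, THEN conjunct2, THEN conjunct2, rule_format, OF imageI[OF subsetD[OF F(5) that]]] .
    qed
  qed
  then show ?thesis by metis
qed

definition hub_list :: "(nat \<times> nat) list" where
  "hub_list = [(3, 0), (4, 0), (5, 0), (6, 0), (1, 0), (1, q), (2, 0), (2, q), (0, 2 * q - 1), (0, q - 1), (0, 1), (0, q + 1), (0, q)]"

text \<open>Offsets that differ by \<open>q\<close> are neighbours in the chain, so its strip also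
  supplies the edges of difference q in class 0. The final \<open>(0, 0)\<close> is followed by the
  end \<open>(0, q)\<close> of the gap; the pairs of 1 and of q - 1 belong to the fixed
  part.\<close>

definition hub_chain :: "(nat \<times> nat) list" where
  "hub_chain = concat (map (\<lambda>i. [(0, i), (0, q + i)]) [2..<q - 1]) @ [(0, 0)]"

definition hub_verts :: "(nat \<times> nat) set" where
  "hub_verts = {0} \<times> {..<2 * q} \<union> {(1, 0), (1, q), (2, 0), (2, q), (3, 0), (4, 0)}"

text \<open>The piece collects what the rotations leave open around the hubs: their edges to class 0
  and to each other, the four missed edges to the classes 1 and 2, the pairs of difference q in
  class 0, the 4-cycle of offset 0, and the missing edges to z and w.\<close>

lemma hub_exists:
  "\<exists>K. triang (insert (6, 0) (insert (5, 0) hub_verts)) K \<and>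
    (\<forall>i<2 * q. joined K (0, i) (3, 0) \<and> joined K (0, i) (4, 0)) \<and>
    (\<forall>i<q. joined K (0, i) (0, q + i)) \<and> joined K (3, 0) (4, 0) \<and>
    joined K (3, 0) (1, 0) \<and> joined K (3, 0) (2, q) \<and> joined K (4, 0) (1, q) \<and> joined K (4, 0) (2, 0) \<and>
    joined K (1, 0) (1, q) \<and> joined K (2, 0) (2, q) \<and> joined K (1, 0) (2, q) \<and> joined K (1, q) (2, 0) \<and>
    (\<forall>x\<in>{(3, 0), (4, 0), (1, 0), (1, q), (0, 2 * q - 1)}. joined K x (5, 0)) \<and>
    (\<forall>x\<in>{(3, 0), (4, 0), (2, 0), (2, q), (0, q + 1)}. joined K x (6, 0))"
proof -
  define G where "G = tril hub_list ` set hub_faces"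
  define K where "K = G \<union> strip ((0, q - 1) # hub_chain @ [(0, q)]) (3, 0) (4, 0)"
  have d: "distinct hub_list" "length hub_list = 13" using q by (auto simp: hub_list_def)
  have nths: "hub_list ! 0 = (3, 0)" "hub_list ! Suc 0 = (4, 0)" "hub_list ! 2 = (5, 0)" "hub_list ! 3 = (6, 0)"
    "hub_list ! 4 = (1, 0)" "hub_list ! 5 = (1, q)" "hub_list ! 6 = (2, 0)" "hub_list ! 7 = (2, q)" "hub_list ! 8 = (0, 2 * q - 1)"
    "hub_list ! 9 = (0, q - 1)" "hub_list ! 10 = (0, 1)" "hub_list ! 11 = (0, q + 1)" "hub_list ! 12 = (0, q)"
    by (simp_all add: hub_list_def)
  have gaps: "tril hub_list ` set hub_gaps = {{(0, q - 1), (0, q), (3, 0)}, {(0, q - 1), (0, q), (4, 0)}}"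
    by (simp add: hub_gaps_def tril_def nths)
  have T: "triang (set hub_list) (G \<union> {{(0, q - 1), (0, q), (3, 0)}, {(0, q - 1), (0, q), (4, 0)}})"
    using triang_relabel[OF triang_hub d] unfolding G_def set_append image_Un gaps .
  define I where "I = {0} \<union> {2..<q - 1} \<union> {2 + q..<q - 1 + q}"
  have chain: "set hub_chain = Pair 0 ` I"
  proof -
    have u: "(\<Union>i\<in>S. {(0, i), (0, q + i)}) \<union> {(0, 0)} = Pair 0 ` ({0} \<union> S \<union> (+) q ` S)" for S by auto
    have "set hub_chain = (\<Union>i\<in>{2..<q - 1}. {(0, i), (0, q + i)}) \<union> {(0, 0)}" by (simp add: hub_chain_def)
    then show ?thesis unfolding I_def u image_add_atLeastLessThan .
  qed
  have "triang (set hub_list \<union> set hub_chain) K"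
    unfolding K_def
  proof (rule triang_strip[OF T])
    show "{(0, q - 1), (0, q), (3, 0)} \<notin> G" "{(0, q - 1), (0, q), (4, 0)} \<notin> G"
    proof -
      have "\<forall>t\<in>G. (0, q - 1) \<in> t \<longrightarrow> (0, q) \<notin> t"
        using q by (simp add: G_def hub_faces_def tril_def nths) linarith
      then show "{(0, q - 1), (0, q), (3, 0)} \<notin> G" "{(0, q - 1), (0, q), (4, 0)} \<notin> G" by blast+
    qed
    have "distinct (concat (map (\<lambda>i. [(0 :: nat, i), (0, q + i)]) [2..<k]))" if "k \<le> q" for k
      using that by (induction k) auto
    then show "distinct hub_chain" using q by (auto simp: hub_chain_def)
    show "set hub_chain \<inter> set hub_list = {}" using q unfolding chain by (auto simp: hub_list_def I_def)
  qed simp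
  moreover have "set hub_list \<union> set hub_chain = insert (6, 0) (insert (5, 0) hub_verts)"
  proof -
    have I: "{2 * q - 1, q - 1, 1, q + 1, q} \<union> I = {..<2 * q}" using q by (auto simp: I_def)
    have hl: "set hub_list = Pair 0 ` {2 * q - 1, q - 1, 1, q + 1, q} \<union> {(3, 0), (4, 0), (5, 0), (6, 0), (1, 0), (1, q), (2, 0), (2, q)}"
      by (auto simp: hub_list_def)
    have a: "{0} \<times> {..<2 * q} = Pair 0 ` {2 * q - 1, q - 1, 1, q + 1, q} \<union> Pair 0 ` I"
      unfolding image_Un[symmetric] I by auto
    show ?thesis unfolding chain hub_verts_def hl a by blast
  qed
  ultimately have TK: "triang (insert (6, 0) (insert (5, 0) hub_verts)) K" by simp
  have idx: "joined K (hub_list ! a) (hub_list ! b)" if ab: "pair_in hub_faces a b" for a b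
  proof -
    obtain f where f: "f \<in> set hub_faces" "a \<in> tri f" "b \<in> tri f"
      using ab unfolding joined_tri[symmetric] joined_def by blast
    have "tril hub_list f \<in> K" using f(1) unfolding K_def G_def by blast
    then show ?thesis by (rule joinedI) (use f(2,3) in \<open>auto simp: tri_def tril_def\<close>)
  qed
  have "list_all (\<lambda>(a, b). pair_in hub_faces a b)
    [(8, 0), (8, 1), (10, 0), (10, 1), (11, 0), (11, 1), (10, 11), (9, 8), (0, 1), (0, 4), (0, 7), (1, 5), (1, 6),
     (4, 5), (6, 7), (4, 7), (5, 6), (0, 2), (1, 2), (4, 2), (5, 2), (8, 2), (0, 3), (1, 3), (6, 3), (7, 3), (11, 3)]"
    by code_simp
  then have p: "pair_in hub_faces 8 0" "pair_in hub_faces 8 1" "pair_in hub_faces 10 0" "pair_in hub_faces 10 1"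
    "pair_in hub_faces 11 0" "pair_in hub_faces 11 1" "pair_in hub_faces 10 11" "pair_in hub_faces 9 8"
    "pair_in hub_faces 0 1" "pair_in hub_faces 0 4" "pair_in hub_faces 0 7" "pair_in hub_faces 1 5" "pair_in hub_faces 1 6"
    "pair_in hub_faces 4 5" "pair_in hub_faces 6 7" "pair_in hub_faces 4 7" "pair_in hub_faces 5 6"
    "pair_in hub_faces 0 2" "pair_in hub_faces 1 2" "pair_in hub_faces 4 2" "pair_in hub_faces 5 2" "pair_in hub_faces 8 2"
    "pair_in hub_faces 0 3" "pair_in hub_faces 1 3" "pair_in hub_faces 6 3" "pair_in hub_faces 7 3" "pair_in hub_faces 11 3"
    by (simp_all only: list.pred_inject prod.case)
  note J = p[THEN idx, unfolded One_nat_def nths]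
  have pole: "joined K (0, i) (3, 0) \<and> joined K (0, i) (4, 0)" if "i < 2 * q" for i
  proof -
    have i: "i < 2 * q" by (rule that)
    consider "i = 2 * q - 1" | "i = 1" | "i = q + 1" | "(0, i) \<in> set ((0, q - 1) # hub_chain @ [(0, q)])"
    proof -
      have "i \<in> {2 * q - 1, q - 1, 1, q + 1, q} \<or> i \<in> I" using i q by (auto simp: I_def)
      then have "i \<in> {2 * q - 1, 1, q + 1} \<or> (0, i) \<in> set ((0, q - 1) # hub_chain @ [(0, q)])"
        unfolding set_append list.set chain by blast
      then show thesis using that by blast
    qed
    then show ?thesis
    proof cases
      case 4
      from strip_pole[OF this, of "(3, 0)" "(4, 0)"] show ?thesis unfolding K_def by (blast intro: joined_mono)
    qed (use J(1-6) in auto)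
  qed
  have mid: "{x, y, (3, 0)} \<in> strip (xs @ x # y # ys) (3, 0) (4, 0)" for x y xs and ys :: "(nat \<times> nat) list"
    using strip_consecutive[of "length xs" "xs @ x # y # ys" "(3, 0)" "(4, 0)"] by (simp add: nth_append)
  have diag: "joined K (0, i) (0, q + i)" if i: "i < q" for i
  proof -
    consider "i = 1" | "i = q - 1" | "i = 0" | "i \<in> {2..<q - 1}" using i by force
    then show ?thesis
    proof cases
      case 1 then show ?thesis using J(7) by simp
    next
      case 2
      then have "q + i = 2 * q - 1" using q by simp
      then show ?thesis using J(8) 2 by simp
    next
      case 3
      have "{(0, 0), (0, q), (3, 0)} \<in> K"
        using mid[of "(0, 0)" "(0, q)" "(0, q - 1) # concat (map (\<lambda>i. [(0, i), (0, q + i)]) [2..<q - 1])" "[]"]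
        unfolding K_def hub_chain_def by simp
      then show ?thesis using 3 by (auto intro: joinedI)
    next
      case 4
      then have i2: "2 \<le> i" "i < q - 1" by auto
      then have "i + (q - 1 - i) = q - 1" by simp
      then have "[2..<q - 1] = [2..<i] @ i # [Suc i..<q - 1]"
        using upt_add_eq_append[OF i2(1), of "q - 1 - i"] upt_conv_Cons[OF i2(2)] by (simp only:)
      then have "{(0, i), (0, q + i), (3, 0)} \<in> K"
        using mid[of "(0, i)" "(0, q + i)" "(0, q - 1) # concat (map (\<lambda>i. [(0, i), (0, q + i)]) [2..<i])"]
        unfolding K_def hub_chain_def by simp
      then show ?thesis by (auto intro: joinedI)
    qed
  qed
  show ?thesis
    by (intro exI[of _ K] conjI TK) (use pole diag J in auto)
qed

text \<open>The edges that all rotations miss form 4-cycles on the offsets \<open>i, q + i\<close> of the classes 1 and 2; with \<open>z\<close>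
  and \<open>w\<close> each of them spans an octahedron. The cycle for \<open>i = 0\<close> is part of the hub piece.\<close>

lemma octa_exists:
  assumes "0 < i" "i < q"
  shows "\<exists>K. triang (insert (6, 0) (insert (5, 0) {(1 :: nat, i), (1, q + i), (2, i), (2, q + i)})) K \<and>
    joined K (1, i) (1, q + i) \<and> joined K (2, i) (2, q + i) \<and> joined K (1, q + i) (2, i) \<and> joined K (1, i) (2, q + i) \<and>
    (\<forall>x\<in>{(1, i), (1, q + i), (2, i), (2, q + i)}. joined K x (5, 0) \<and> joined K x (6, 0))"
proof -
  define xs where "xs = [(1, i), (1, q + i), (2, i), (2, q + i), (5, 0), (6 :: nat, 0)]"
  have d: "distinct xs" "length xs = 6" using q by (auto simp: xs_def)
  have "triang (set xs) (tril xs ` set octa_faces)" by (rule triang_relabel[OF triang_octa d])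
  moreover have "set xs = insert (6, 0) (insert (5, 0) {(1, i), (1, q + i), (2, i), (2, q + i)})" by (auto simp: xs_def)
  moreover have "tril xs ` set octa_faces =
    {{xs ! 0, xs ! 1, xs ! 5}, {xs ! 1, xs ! 2, xs ! 4}, {xs ! 1, xs ! 2, xs ! 5}, {xs ! 2, xs ! 3, xs ! 4},
     {xs ! 2, xs ! 3, xs ! 5}, {xs ! 3, xs ! 0, xs ! 4}, {xs ! 3, xs ! 0, xs ! 5}}"
    by (simp add: octa_faces_def tril_def)
  ultimately show ?thesis
    by (intro exI[of _ "tril xs ` set octa_faces"]) (simp add: joined_def xs_def)
qed

end

section \<open>Assembling the layers\<close>

lemma planar_UN:
  assumes "finite I" "\<And>i. i \<in> I \<Longrightarrow> finite (V i) \<and> planar (V i) (E i)"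
    and "\<And>i j. i \<in> I \<Longrightarrow> j \<in> I \<Longrightarrow> i \<noteq> j \<Longrightarrow> V i \<inter> V j = {}"
  shows "planar (\<Union>i\<in>I. V i) (\<Union>i\<in>I. E i)"
  using assms
proof (induction I)
  case empty
  show ?case by (simp add: planar_def)
next
  case (insert i I)
  have "planar (V i \<union> (\<Union>j\<in>I. V j)) (E i \<union> (\<Union>j\<in>I. E j))"
  proof (rule planar_disjoint_union)
    show "V i \<inter> (\<Union>j\<in>I. V j) = {}" using insert.prems(2)[of i] insert.hyps(2) by blast
    show "planar (\<Union>j\<in>I. V j) (\<Union>j\<in>I. E j)" using insert.IH insert.prems by simp
  qed (use insert.hyps(1) insert.prems(1) in auto)
  then show ?case by simp
qed

lemma stacked_UN: "stacked m (\<Union>i\<in>I. S i) (\<lambda>k. \<Union>i\<in>I. P i k) = (\<Union>i\<in>I. stacked m (S i) (P i))"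
  unfolding stacked_def by blast

text \<open>For \<open>t\<close> in \<open>{0, q}\<close>, \<open>q - t\<close> is the other element
  and congruent to \<open>t + q\<close>. This turns the two cases of \<open>layer_special\<close>
  into a single offset difference.\<close>

lemma antipode_mod:
  fixes q :: nat
  assumes "t \<in> {0, q}"
  shows "(q - t + x) mod (2 * q) = (t + x + q) mod (2 * q)"
proof -
  have "q + x + q = x + 2 * q" by simp
  then have h: "(q + x + q) mod (2 * q) = x mod (2 * q)" by (simp only: mod_add_self2)
  consider "t = 0" | "t = q" using assms by blast
  then show ?thesis
  proof cases
    case 1 then show ?thesis by (simp add: add.commute)
  next
    case 2 show ?thesis unfolding 2 h by simp
  qed
qed

text \<open>The sums of 0 or \<open>q\<close> with a shift below \<open>q\<close> reach every
  residue modulo 2q. Patterns present at both 0 and \<open>q\<close> thus need only \<open>q\<close>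
  rotations.\<close>

lemma shift_mod:
  fixes q :: nat
  assumes "i < 2 * q" "s \<le> 2 * q"
  shows "\<exists>r<q. \<exists>t\<in>{0, q}. (t + s + r) mod (2 * q) = i"
proof -
  define j where "j = (if s \<le> i then i - s else i + 2 * q - s)"
  have j: "j < 2 * q" "(j + s) mod (2 * q) = i" using assms by (auto simp: j_def)
  have "\<exists>r<q. \<exists>t\<in>{0, q}. j = t + r"
    using j(1) by (cases "j < q") (auto intro!: exI[of _ "j - q"])
  then show ?thesis using j(2) by (metis add.assoc add.commute)
qed

lemma decomposable_large:
  assumes q: "q \<ge> 3" and n: "n \<le> 6 * q + 2"
  shows "decomposable (cartesian_product (complete_graph n) (path_graph m)) (q + 1)"
proof -
  define V where "V = plain_verts q"
  define z w :: "nat \<times> nat" where "z = (5, 0)" and "w = (6, 0)"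
  obtain K where K: "\<And>r. r < q \<Longrightarrow> triang (insert w (insert z V)) (K r)"
    "\<And>r x y. r < q \<Longrightarrow> joined (layer_faces q) x y \<Longrightarrow> joined (K r) (rot q r x) (rot q r y)"
    "\<And>r x. r < q \<Longrightarrow> x \<in> low_host q r \<Longrightarrow> joined (K r) (rot q r x) z"
    "\<And>r x. r < q \<Longrightarrow> x \<in> high_host q r \<Longrightarrow> joined (K r) (rot q r x) w"
  proof -
    obtain K where "\<forall>r<q. triang (insert (6, 0) (insert (5, 0) (plain_verts q))) (K r) \<and>
     (\<forall>x y. joined (layer_faces q) x y \<longrightarrow> joined (K r) (rot q r x) (rot q r y)) \<and>
     (\<forall>x\<in>low_host q r. joined (K r) (rot q r x) (5, 0)) \<and>
     (\<forall>x\<in>high_host q r. joined (K r) (rot q r x) (6, 0))"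
      using layers[OF q] by (elim exE) (rule that)
    note K = this[rule_format, folded z_def w_def V_def]
    show thesis
    proof (rule that)
      show "triang (insert w (insert z V)) (K r)" if "r < q" for r using K[OF that] by (rule conjunct1)
      show "joined (K r) (rot q r x) (rot q r y)" if "r < q" "joined (layer_faces q) x y" for r x y
        using K[OF that(1), THEN conjunct2, THEN conjunct1] that(2) by blast
      show "joined (K r) (rot q r x) z" if "r < q" "x \<in> low_host q r" for r x
        using K[OF that(1), THEN conjunct2, THEN conjunct2, THEN conjunct1] that(2) by blast
      show "joined (K r) (rot q r x) w" if "r < q" "x \<in> high_host q r" for r x
        using K[OF that(1), THEN conjunct2, THEN conjunct2, THEN conjunct2] that(2) by blast
    qed
  qed
  obtain H where HH: "triang (insert w (insert z (hub_verts q))) H \<and>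
    (\<forall>i<2 * q. joined H (0, i) (3, 0) \<and> joined H (0, i) (4, 0)) \<and>
    (\<forall>i<q. joined H (0, i) (0, q + i)) \<and> joined H (3, 0) (4, 0) \<and>
    joined H (3, 0) (1, 0) \<and> joined H (3, 0) (2, q) \<and> joined H (4, 0) (1, q) \<and> joined H (4, 0) (2, 0) \<and>
    joined H (1, 0) (1, q) \<and> joined H (2, 0) (2, q) \<and> joined H (1, 0) (2, q) \<and> joined H (1, q) (2, 0) \<and>
    (\<forall>x\<in>{(3, 0), (4, 0), (1, 0), (1, q), (0, 2 * q - 1)}. joined H x z) \<and>
    (\<forall>x\<in>{(3, 0), (4, 0), (2, 0), (2, q), (0, q + 1)}. joined H x w)"
    using hub_exists[OF q, folded z_def w_def] by (elim exE) (rule that)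
  have H: "triang (insert w (insert z (hub_verts q))) H" "\<forall>i<2 * q. joined H (0, i) (3, 0) \<and> joined H (0, i) (4, 0)"
    "\<forall>i<q. joined H (0, i) (0, q + i)" "joined H (3, 0) (4, 0)" "joined H (3, 0) (1, 0)" "joined H (3, 0) (2, q)"
    "joined H (4, 0) (1, q)" "joined H (4, 0) (2, 0)" "joined H (1, 0) (1, q)" "joined H (2, 0) (2, q)"
    "joined H (1, 0) (2, q)" "joined H (1, q) (2, 0)"
    "\<forall>x\<in>{(3, 0), (4, 0), (1, 0), (1, q), (0, 2 * q - 1)}. joined H x z"
    "\<forall>x\<in>{(3, 0), (4, 0), (2, 0), (2, q), (0, q + 1)}. joined H x w"
    using HH by - (elim conjE, assumption)+
  have "\<forall>i\<in>{0<..<q}. \<exists>K. triang (insert w (insert z {(1 :: nat, i), (1, q + i), (2, i), (2, q + i)})) K \<and>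
    joined K (1, i) (1, q + i) \<and> joined K (2, i) (2, q + i) \<and> joined K (1, q + i) (2, i) \<and> joined K (1, i) (2, q + i) \<and>
    (\<forall>x\<in>{(1, i), (1, q + i), (2, i), (2, q + i)}. joined K x z \<and> joined K x w)"
    using octa_exists[OF q] unfolding z_def w_def by simp
  then obtain O' where O': "\<forall>i\<in>{0<..<q}. triang (insert w (insert z {(1 :: nat, i), (1, q + i), (2, i), (2, q + i)})) (O' i) \<and>
    joined (O' i) (1, i) (1, q + i) \<and> joined (O' i) (2, i) (2, q + i) \<and> joined (O' i) (1, q + i) (2, i) \<and> joined (O' i) (1, i) (2, q + i) \<and>
    (\<forall>x\<in>{(1, i), (1, q + i), (2, i), (2, q + i)}. joined (O' i) x z \<and> joined (O' i) x w)"
    by (rule bchoice[THEN exE])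
  define VV where "VV i = (if i = 0 then hub_verts q else {(1, i), (1, q + i), (2, i), (2, q + i)})" for i
  define KK where "KK i = (if i = 0 then H else O' i)" for i
  have TV: "triang (insert w (insert z (VV i))) (KK i)" if "i < q" for i
    using that H(1) O' by (auto simp: VV_def KK_def)
  have oct: "joined (KK i) (1, i) (1, q + i)" "joined (KK i) (2, i) (2, q + i)" "joined (KK i) (1, q + i) (2, i)" "joined (KK i) (1, i) (2, q + i)"
    if "i < q" for i
  proof -
    have "joined (KK i) (1, i) (1, q + i) \<and> joined (KK i) (2, i) (2, q + i) \<and> joined (KK i) (1, q + i) (2, i) \<and> joined (KK i) (1, i) (2, q + i)"
    proof (cases "i = 0")
      case True then show ?thesis using H(9-12) joined_sym[OF H(12)] by (simp add: KK_def)
    next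
      case False then show ?thesis using O'[rule_format, of i] that by (simp add: KK_def)
    qed
    then show "joined (KK i) (1, i) (1, q + i)" "joined (KK i) (2, i) (2, q + i)" "joined (KK i) (1, q + i) (2, i)" "joined (KK i) (1, i) (2, q + i)"
      by auto
  qed
  have octzw: "joined (KK i) x z" "joined (KK i) x w" if "0 < i" "i < q" "x \<in> {(1, i), (1, q + i), (2, i), (2, q + i)}" for i x
    using O'[rule_format, of i] that by (auto simp: KK_def)
  have VVV: "(\<Union>i\<in>{..<q}. VV i) = V"
  proof
    show "(\<Union>i\<in>{..<q}. VV i) \<subseteq> V" by (auto simp: VV_def hub_verts_def[OF q] V_def plain_verts_def split: if_splits)
    show "V \<subseteq> (\<Union>i\<in>{..<q}. VV i)"
    proof
      fix x assume x: "x \<in> V"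
      show "x \<in> (\<Union>i\<in>{..<q}. VV i)"
      proof (cases "x \<in> hub_verts q")
        case True then show ?thesis using q by (intro UN_I[of 0]) (auto simp: VV_def)
      next
        case False
        obtain c i where ci: "x = (c, i)" by (cases x)
        have h: "c = 1 \<or> c = 2" "i < 2 * q" "i \<noteq> 0" "i \<noteq> q"
          using x False unfolding ci by (auto simp: V_def plain_verts_def hub_verts_def[OF q])
        show ?thesis
        proof (cases "i < q")
          case True then show ?thesis using h ci by (intro UN_I[of i]) (auto simp: VV_def)
        next
          case False then show ?thesis using h ci by (intro UN_I[of "i - q"]) (auto simp: VV_def)
        qed
      qed
    qed
  qed
  have VVd: "VV i \<inter> VV j = {}" if "i < q" "j < q" "i \<noteq> j" for i j
    using that by (auto simp: VV_def hub_verts_def[OF q])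
  \<comment> \<open>Layer \<open>q\<close> is mirrored piece by piece. The pieces have disjoint
    vertex sets and each is mirrored around its own z and w, so they do not compete for these two
    vertices.\<close>
  define S where "S r = (if r < q then sides V (K r) else (\<Union>i\<in>{..<q}. sides (VV i) (KK i)))" for r
  define P where "P r = (if r < q then spokes V (K r) z w else (\<lambda>k. \<Union>i\<in>{..<q}. spokes (VV i) (KK i) z w k))" for r
  have zwV: "z \<notin> V" "w \<notin> V" "z \<noteq> w" by (auto simp: z_def w_def V_def plain_verts_def)
  have finV: "finite V" "card V = 6 * q + 2" using finite_plain_verts by (auto simp: V_def)
  have pl: "planar (V \<times> {..<m}) (stacked m (S r) (P r))" if "r < q + 1" for r
  proof (cases "r < q")
    case True
    have "planar (V \<times> {..<m}) (stacked m (sides V (K r)) (spokes V (K r) z w))"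
      by (rule planar_layer[OF K(1)[OF True] zwV(3)]) (use zwV in auto)
    then show ?thesis using True by (simp add: S_def P_def)
  next
    case False
    have "planar (\<Union>i\<in>{..<q}. VV i \<times> {..<m}) (\<Union>i\<in>{..<q}. stacked m (sides (VV i) (KK i)) (spokes (VV i) (KK i) z w))"
    proof (rule planar_UN)
      fix i assume "i \<in> {..<q}"
      then have i: "i < q" by simp
      have sub: "VV i \<subseteq> V" using i VVV by auto
      then have "finite (VV i)" using finV finite_subset by blast
      moreover have "planar (VV i \<times> {..<m}) (stacked m (sides (VV i) (KK i)) (spokes (VV i) (KK i) z w))"
        by (rule planar_layer[OF TV[OF i] zwV(3)]) (use zwV sub in auto)
      ultimately show "finite (VV i \<times> {..<m}) \<and> planar (VV i \<times> {..<m}) (stacked m (sides (VV i) (KK i)) (spokes (VV i) (KK i) z w))"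
        by simp
    next
      show "VV i \<times> {..<m} \<inter> VV j \<times> {..<m} = {}" if "i \<in> {..<q}" "j \<in> {..<q}" "i \<noteq> j" for i j
        using VVd[of i j] that by blast
    qed simp
    moreover have "(\<Union>i\<in>{..<q}. VV i \<times> {..<m}) = V \<times> {..<m}" using VVV by blast
    ultimately show ?thesis using False by (simp add: S_def P_def stacked_UN)
  qed
  define J where "J u v \<longleftrightarrow> (\<exists>r<q + 1. {u, v} \<in> S r)" for u v
  have Jsym: "J u v" if "J v u" for u v using that by (simp add: J_def insert_commute)
  have Jl: "J (rot q r x) (rot q r y)"
    if r: "r < q" and xy: "joined (layer_faces q) x y" "rot q r x \<in> V" "rot q r y \<in> V" "rot q r x \<noteq> rot q r y" for r x y
  proof -
    have "{rot q r x, rot q r y} \<in> sides V (K r)" unfolding sides_def using K(2)[OF r xy(1)] xy by blast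
    then show ?thesis unfolding J_def S_def using r by (intro exI[of _ r]) simp
  qed
  have Jp: "J u v" if i: "i < q" and uv: "u \<in> VV i" "v \<in> VV i" "u \<noteq> v" "joined (KK i) u v" for i u v
  proof -
    have "{u, v} \<in> sides (VV i) (KK i)" unfolding sides_def using uv by blast
    then show ?thesis unfolding J_def S_def using i by (intro exI[of _ q]) auto
  qed
  have hv: "(0, i) \<in> VV 0 \<longleftrightarrow> i < 2 * q" "(3, 0) \<in> VV 0" "(4, 0) \<in> VV 0" "(1, 0) \<in> VV 0" "(1, q) \<in> VV 0" "(2, 0) \<in> VV 0" "(2, q) \<in> VV 0" for i
    by (auto simp: VV_def hub_verts_def[OF q])
  have Jh: "J u v" if "u \<in> VV 0" "v \<in> VV 0" "u \<noteq> v" "joined H u v" for u v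
    using Jp[of 0 u v] that q by (simp add: KK_def)
  have q0: "0 < 2 * q" "0 < q" using q by auto
  have rotc: "rot q r (c, i) = (c, (i + r) mod (2 * q))" if "c < 3" for r c i using that by (simp add: rot_def)
  have inV: "(c, i mod (2 * q)) \<in> V" "i < 2 * q \<Longrightarrow> (c, i) \<in> V" if "c < 3" for c i
    using that q0 by (auto simp: V_def plain_verts_def)
  have JL: "J (c, (a + r) mod (2 * q)) (d, (b + r) mod (2 * q))"
    if "r < q" "c < 3" "d < 3" "joined (layer_faces q) (c, a) (d, b)" "c \<noteq> d \<or> (a + r) mod (2 * q) \<noteq> (b + r) mod (2 * q)" for r c d a b
    using Jl[OF that(1,4)] that(2,3,5) inV(1) rotc by (metis prod.inject)
  \<comment> \<open>Pairs are sorted by offset difference. Between classes, \<open>A1\<close> covers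
    1 to q - 1, \<open>A4\<close> covers 0, and \<open>A5\<close>, \<open>A6\<close>,
    \<open>A8\<close> cover q. Within a class, \<open>A2\<close> covers 1 to q - 2,
    \<open>A3\<close> covers q + 1, and \<open>A7\<close> covers q.\<close>
  have A1: "J (c, (i + s) mod (2 * q)) (d, i)" if h: "c < 3" "d < 3" "c \<noteq> d" "1 \<le> s" "s < q" "i < 2 * q" for c d s i
  proof -
    obtain r t where rt: "r < q" "t \<in> {0, q}" "(t + 0 + r) mod (2 * q) = i" using shift_mod[OF h(6), of 0] by blast
    have "J (c, (t + s + r) mod (2 * q)) (d, (t + r) mod (2 * q))"
      using JL[OF rt(1) h(1,2) layer_across[OF q h(1-3) rt(2) h(4,5)]] h(3) by simp
    moreover have "(t + s + r) mod (2 * q) = (i + s) mod (2 * q)"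
      using mod_add_left_eq[of "t + 0 + r" "2 * q" s] rt(3) by (simp add: ac_simps)
    ultimately show ?thesis using rt(3) by simp
  qed
  have ne: "i \<noteq> (i + e) mod (2 * q)" if h: "i < 2 * q" "0 < e" "e < 2 * q" for i e
    using h by (cases "i + e < 2 * q") (auto simp: mod_if)
  have A2: "J (c, i) (c, (i + e) mod (2 * q))" if h: "c < 3" "1 \<le> e" "e \<le> q - 2" "i < 2 * q" for c e i
  proof -
    obtain s where s: "s + e < q" "\<forall>k\<in>{0, q}. joined (layer_faces q) (c, k + s) (c, k + s + e)"
      using layer_within[OF q h(1-3)] by blast
    have "s \<le> 2 * q" using s(1) by simp
    from shift_mod[OF h(4) this] obtain r t where rt: "r < q" "t \<in> {0, q}" "(t + s + r) mod (2 * q) = i" by blast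
    have m: "(t + s + e + r) mod (2 * q) = (i + e) mod (2 * q)"
      using mod_add_left_eq[of "t + s + r" "2 * q" e] rt(3) by (simp add: ac_simps)
    have "i \<noteq> (i + e) mod (2 * q)" using ne[of i e] h by auto
    then show ?thesis using JL[OF rt(1) h(1,1) bspec[OF s(2) rt(2)]] unfolding m rt(3) by blast
  qed
  have sp: "t = 0 \<and> q - t = q \<or> t = q \<and> q - t = 0" if h: "t \<in> {0, q}" for t using h by auto
  have A3: "J (c, i) (c, (i + q + 1) mod (2 * q))" if h: "c < 3" "i < 2 * q" for c i
  proof -
    obtain r t where rt: "r < q" "t \<in> {0, q}" "(t + 0 + r) mod (2 * q) = i" using shift_mod[OF h(2), of 0] by blast
    have m: "(q - t + 1 + r) mod (2 * q) = (i + q + 1) mod (2 * q)"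
      using antipode_mod[OF rt(2), of "1 + r"] mod_add_left_eq[of "t + 0 + r" "2 * q" "q + 1"] rt(3) by (simp add: ac_simps)
    have "i \<noteq> (i + (q + 1)) mod (2 * q)" using ne[of i "q + 1"] h q by auto
    then show ?thesis using JL[OF rt(1) h(1,1) layer_special(1)[OF q sp[OF rt(2)] h(1)]] rt(3) unfolding m by (simp add: add.assoc)
  qed
  have A4: "J (c, i) (d, i)" if h: "c < 3" "d < 3" "c \<noteq> d" "i < 2 * q" for c d i
  proof -
    have "zig q (q - 2) \<le> 2 * q" using zig_ends(3)[OF q] by simp
    then obtain r t where rt: "r < q" "t \<in> {0, q}" "(t + zig q (q - 2) + r) mod (2 * q) = i" using shift_mod[OF h(4)] by blast
    show ?thesis using JL[OF rt(1) h(1,2) layer_special(2)[OF q sp[OF rt(2)] h(1-3)]] h(3) unfolding rt(3) by blast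
  qed
  have A5: "J (0, i) (1, (i + q) mod (2 * q))" if h: "i < 2 * q" for i
  proof -
    obtain r t where rt: "r < q" "t \<in> {0, q}" "(t + 0 + r) mod (2 * q) = i" using shift_mod[OF h, of 0] by blast
    have m: "(q - t + r) mod (2 * q) = (i + q) mod (2 * q)"
      using antipode_mod[OF rt(2), of r] mod_add_left_eq[of "t + 0 + r" "2 * q" q] rt(3) by (simp add: ac_simps)
    show ?thesis using JL[OF rt(1) _ _ layer_special(3)[OF q sp[OF rt(2)]]] rt(3) unfolding m by simp
  qed
  have A6: "J (0, i) (2, (i + q) mod (2 * q))" if h: "i < 2 * q" for i
  proof -
    have "1 \<le> 2 * q" using q by simp
    from shift_mod[OF h this] obtain r t where rt: "r < q" "t \<in> {0, q}" "(t + 1 + r) mod (2 * q) = i" by blast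
    have m: "(q - t + 1 + r) mod (2 * q) = (i + q) mod (2 * q)"
      using antipode_mod[OF rt(2), of "1 + r"] mod_add_left_eq[of "t + 1 + r" "2 * q" q] rt(3) by (simp add: ac_simps)
    show ?thesis using JL[OF rt(1) _ _ layer_special(4)[OF q sp[OF rt(2)]]] unfolding m rt(3) by simp
  qed
  have ov: "(1, i) \<in> VV i" "(1, q + i) \<in> VV i" "(2, i) \<in> VV i" "(2, q + i) \<in> VV i" for i
    by (auto simp: VV_def hub_verts_def[OF q])
  have A7: "J (c, i) (c, q + i)" if "c < 3" "i < q" for c i
  proof -
    have "c = 0 \<or> c = 1 \<or> c = 2" using that(1) by auto
    then show ?thesis
    proof (elim disjE)
      assume "c = 0" then show ?thesis using Jh[OF _ _ _ H(3)[rule_format, OF that(2)]] hv that q0 by simp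
    qed (use Jp[OF that(2)] ov oct[OF that(2)] q0 in auto)
  qed
  have A8: "J (1, i) (2, q + i)" "J (1, q + i) (2, i)" if "i < q" for i
    using Jp[OF that] ov oct[OF that] by auto
  \<comment> \<open>For differences that are read backwards modulo 2q.\<close>
  have wrap: "a mod (2 * q) = i" if "a = i + 2 * q" "i < 2 * q" for a i using that by simp
  have same: "J (c, i) (c, j)" if "c < 3" "i < j" "j < 2 * q" for c i j
  proof -
    define e where "e = j - i"
    have e: "j = i + e" "0 < e" "e < 2 * q" using that by (auto simp: e_def)
    have il: "i < 2 * q" using that by simp
    consider "e \<le> q - 2" | "e = q - 1" | "e = q" | "e = q + 1" | "q + 2 \<le> e" using q by linarith
    then show ?thesis
    proof cases
      case 1 then show ?thesis using A2[OF that(1), of e i] e il that(3) by simp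
    next
      case 2
      then have "j + q + 1 = i + 2 * q" using e q by simp
      then have "(j + q + 1) mod (2 * q) = i" using il by (rule wrap)
      then show ?thesis using A3[OF that(1,3)] Jsym by simp
    next
      case 3 then show ?thesis using A7[OF that(1), of i] e that(3) by (simp add: add.commute)
    next
      case 4 then show ?thesis using A3[OF that(1) il] e that(3) by (simp add: add.assoc)
    next
      case 5
      have "j + (2 * q - e) = i + 2 * q" using e by simp
      then have "(j + (2 * q - e)) mod (2 * q) = i" using il by (rule wrap)
      moreover have "1 \<le> 2 * q - e" "2 * q - e \<le> q - 2" using 5 e by auto
      ultimately show ?thesis using A2[OF that(1), of "2 * q - e" j] that(3) Jsym by simp
    qed
  qed
  have diff: "J (c, i) (d, j)" if "c < 3" "d < 3" "c \<noteq> d" "i < j" "j < 2 * q" for c d i j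
  proof -
    define e where "e = j - i"
    have e: "j = i + e" "0 < e" "e < 2 * q" using that by (auto simp: e_def)
    have il: "i < 2 * q" using that by simp
    consider "e < q" | "e = q" | "q < e" by linarith
    then show ?thesis
    proof cases
      case 1 then show ?thesis using A1[of d c e i] that e il Jsym by simp
    next
      case 3
      have "j + (2 * q - e) = i + 2 * q" using e by simp
      then have "(j + (2 * q - e)) mod (2 * q) = i" using il by (rule wrap)
      then show ?thesis using A1[of c d "2 * q - e" j] that e 3 by simp
    next
      case 2
      have j: "j = i + q" "i < q" using 2 e that by auto
      have m: "(i + q) mod (2 * q) = i + q" "(i + q + q) mod (2 * q) = i" using j(2) by (auto simp: mult_2 mod_if)
      have "(c, d) \<in> {(0,1),(0,2),(1,2),(1,0),(2,0),(2,1)}" using that by auto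
      then show ?thesis using A5[of i] A5[of "i + q"] A6[of i] A6[of "i + q"] A8[of i] j m Jsym by (auto simp: add.commute)
    qed
  qed
  have plain: "J (c, i) (d, j)" if "c < 3" "d < 3" "i < 2 * q" "j < 2 * q" "(c, i) \<noteq> (d, j)" for c d i j
  proof (cases "c = d")
    case True
    then have "i < j \<or> j < i" using that(5) by auto
    then show ?thesis using same[OF that(1) _ that(4)] same[OF that(1) _ that(3)] Jsym True by blast
  next
    case False
    consider "i = j" | "i < j" | "j < i" by linarith
    then show ?thesis
    proof cases
      case 1 then show ?thesis using A4[OF that(1,2) False that(3)] by simp
    next
      case 2 show ?thesis by (rule diff[OF that(1,2) False 2 that(4)])
    next
      case 3 show ?thesis by (rule Jsym[OF diff[OF that(2,1) False[symmetric] 3 that(3)]])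
    qed
  qed
  have JX: "J (d, 0) (c, (i + r) mod (2 * q))" if "r < q" "c < 3" "joined (layer_faces q) (d, 0) (c, i)" "d = 3 \<or> d = 4" for r c i d
  proof -
    have d: "rot q r (d, 0) = (d, 0)" "(d, 0) \<in> V" "d \<noteq> c"
      using that(2,4) by (auto simp: rot_def V_def plain_verts_def)
    then have "(d, 0) \<noteq> (c, (i + r) mod (2 * q))" by simp
    then show ?thesis using Jl[OF that(1,3)] d inV(1)[OF that(2)] unfolding rotc[OF that(2)] d(1) by blast
  qed
  have X1: "J (3, 0) (1, i)" "J (4, 0) (2, i)" if "1 \<le> i" "i \<le> q" for i
    using JX[of "i - 1" 1 3 1] JX[of "i - 1" 2 4 1] layer_hubs[OF q] that q by simp_all
  have X0: "J (4, 0) (1, i)" "J (3, 0) (2, i)" if "i < q" for i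
    using JX[of i 1 4 0] JX[of i 2 3 0] layer_hubs[OF q] that by simp_all
  have Xq: "J (3, 0) (1, i)" "J (4, 0) (2, i)" if "q \<le> i" "i < 2 * q" for i
    using JX[of "i - q" 1 3 q] JX[of "i - q" 2 4 q] layer_hubs[OF q] that by simp_all
  have Xq1: "J (4, 0) (1, i)" "J (3, 0) (2, i)" if "q + 1 \<le> i" "i < 2 * q" for i
    using JX[of "i - q - 1" 1 4 "q + 1"] JX[of "i - q - 1" 2 3 "q + 1"] layer_hubs[OF q] that by simp_all
  have hub: "J (d, 0) (c, i)" if "c < 3" "i < 2 * q" "d = 3 \<or> d = 4" for c d i
  proof -
    have c: "c = 0 \<or> c = 1 \<or> c = 2" using that(1) by auto
    have "J (3, 0) (0, i)" "J (4, 0) (0, i)"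
      using Jh[of "(0, i)" "(3, 0)"] Jh[of "(0, i)" "(4, 0)"] H(2) hv that(2) Jsym by simp_all
    moreover have "J (3, 0) (1, i)"
      using Jh[OF hv(2,4) _ H(5)] X1(1)[of i] Xq(1)[of i] that(2) by (cases "i = 0"; cases "i \<le> q") auto
    moreover have "J (4, 0) (2, i)"
      using Jh[OF hv(3,6) _ H(8)] X1(2)[of i] Xq(2)[of i] that(2) by (cases "i = 0"; cases "i \<le> q") auto
    moreover have "J (3, 0) (2, i)"
      using Jh[OF hv(2,7) _ H(6)] X0(2)[of i] Xq1(2)[of i] that(2) by (cases "i = q"; cases "i < q") auto
    moreover have "J (4, 0) (1, i)"
      using Jh[OF hv(3,5) _ H(7)] X0(1)[of i] Xq1(1)[of i] that(2) by (cases "i = q"; cases "i < q") auto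
    ultimately show ?thesis using c that(3) by (elim disjE) simp_all
  qed
  have Vcases: "(\<exists>c i. u = (c, i) \<and> c < 3 \<and> i < 2 * q) \<or> u = (3, 0) \<or> u = (4, 0)" if "u \<in> V" for u
    using that by (auto simp: V_def plain_verts_def)
  have J: "J u v" if uv: "u \<in> V" "v \<in> V" "u \<noteq> v" for u v
  proof -
    have XY: "J (3, 0) (4, 0)" using Jh[OF hv(2,3) _ H(4)] by simp
    from Vcases[OF uv(1)] Vcases[OF uv(2)] show ?thesis
    proof (elim disjE exE conjE)
      fix c i d j assume "u = (c, i)" "c < 3" "i < 2 * q" "v = (d, j)" "d < 3" "j < 2 * q"
      then show ?thesis using plain[of c d i j] uv(3) by simp
    qed (use hub XY Jsym uv(3) in auto)
  qed
  have Pl: "u \<in> P r k" if "r < q" "u \<in> V" "joined (K r) u (if even k then w else z)" for r u k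
    using that by (simp add: P_def spokes_def)
  have Pq: "u \<in> P q k" if "i < q" "u \<in> VV i" "joined (KK i) u (if even k then w else z)" for i u k
    using that by (auto simp: P_def spokes_def)
  \<comment> \<open>Joined to z somewhere, in a rotated layer or in a piece of the last one;
    \<open>W\<close> is the same for w. The layers for \<open>Z\<close> and \<open>W\<close> need
    not agree, as each path edge asks for one of them only.\<close>
  define Z where "Z u \<longleftrightarrow> (\<exists>r<q. joined (K r) u z) \<or> (\<exists>i<q. u \<in> VV i \<and> joined (KK i) u z)" for u
  define W where "W u \<longleftrightarrow> (\<exists>r<q. joined (K r) u w) \<or> (\<exists>i<q. u \<in> VV i \<and> joined (KK i) u w)" for u
  have Zl: "Z (c, (a + r) mod (2 * q))" if "r < q" "(c, a) \<in> low_host q r" "c < 3" for r c a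
    using K(3)[OF that(1,2)] that(1) unfolding rotc[OF that(3)] Z_def by blast
  have Wl: "W (c, (a + r) mod (2 * q))" if "r < q" "(c, a) \<in> high_host q r" "c < 3" for r c a
    using K(4)[OF that(1,2)] that(1) unfolding rotc[OF that(3)] W_def by blast
  have Zp: "Z u" if "i < q" "u \<in> VV i" "joined (KK i) u z" for u i using that unfolding Z_def by blast
  have Wp: "W u" if "i < q" "u \<in> VV i" "joined (KK i) u w" for u i using that unfolding W_def by blast
  have ZH: "Z u" if "u \<in> {(3, 0), (4, 0), (1, 0), (1, q), (0, 2 * q - 1)}" for u
  proof (rule Zp[OF q0(2)])
    show "u \<in> VV 0" using that hv(2-5) hv(1)[of "2 * q - 1"] q0 by (elim insertE emptyE) simp_all
    show "joined (KK 0) u z" using bspec[OF H(13) that] by (simp add: KK_def)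
  qed
  have WH: "W u" if "u \<in> {(3, 0), (4, 0), (2, 0), (2, q), (0, q + 1)}" for u
  proof (rule Wp[OF q0(2)])
    show "u \<in> VV 0" using that hv(2,3,6,7) hv(1)[of "q + 1"] q by (elim insertE emptyE) simp_all
    show "joined (KK 0) u w" using bspec[OF H(14) that] by (simp add: KK_def)
  qed
  have Zq: "Z (c, q)" "Z (c, 0)" "W (c, q)" "W (c, 0)" if "c = 1 \<or> c = 2" for c
  proof -
    have "Z (2, q)" using Zl[of "q - 1" 2 1] q by (simp add: low_host_def)
    moreover have "Z (2, 0)"
    proof -
      have "(q + 2 + (q - 2)) mod (2 * q) = 0" by (rule wrap) (use q in auto)
      moreover have "(2, q + 2) \<in> low_host q (q - 2)" using q by (auto simp: low_host_def)
      ultimately show ?thesis using Zl[of "q - 2" 2 "q + 2"] q0 by simp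
    qed
    moreover have "W (1, 0)" using Wl[of 0 1 0] q by (simp add: high_host_def)
    moreover have "W (1, q)" using Wl[of "q - 1" 1 1] q by (simp add: high_host_def)
    ultimately show "Z (c, q)" "Z (c, 0)" "W (c, q)" "W (c, 0)" using that ZH WH by auto
  qed
  have ZW12: "Z (c, i) \<and> W (c, i)" if c: "c = 1 \<or> c = 2" and i: "i < 2 * q" for c i
  proof -
    consider "i = 0 \<or> i = q" | "0 < i" "i < q" | "q < i" by linarith
    then show ?thesis
    proof cases
      case 1 then show ?thesis using Zq[OF c] by blast
    next
      case 2
      have ci: "(c, i) \<in> {(1, i), (1, q + i), (2, i), (2, q + i)}" using c by auto
      have "(c, i) \<in> VV i" using c ov by blast
      then show ?thesis using Zp[OF 2(2) _ octzw(1)[OF 2 ci]] Wp[OF 2(2) _ octzw(2)[OF 2 ci]] by blast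
    next
      case 3
      have j: "0 < i - q" "i - q < q" "q + (i - q) = i" using 3 i by auto
      have ci: "(c, i) \<in> {(1, i - q), (1, q + (i - q)), (2, i - q), (2, q + (i - q))}" using c j(3) by auto
      have "(c, i) \<in> VV (i - q)" using c ov(2,4)[of "i - q"] j(3) by auto
      then show ?thesis using Zp[OF j(2) _ octzw(1)[OF j(1,2) ci]] Wp[OF j(2) _ octzw(2)[OF j(1,2) ci]] by blast
    qed
  qed
  have Z0: "Z (0, i)" if i: "i < 2 * q" for i
  proof -
    \<comment> \<open>Rotations r \<le> q - 3 move the offsets q and 1 onto q to 2q - 3 and 1 to q -
      2; r = q - 2 reaches 2q - 2, and r = q - 1 reaches q - 1 and 0. Only 2q - 1 is left to the hub
      piece.\<close>
    consider "i = 2 * q - 1" | "q \<le> i" "i + 3 \<le> 2 * q" | "1 \<le> i" "i + 2 \<le> q" | "i + 2 = 2 * q" | "i + 1 = q" | "i = 0"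
      using i by linarith
    then show ?thesis
    proof cases
      case 1 then show ?thesis using ZH by simp
    next
      case 2 then show ?thesis using Zl[of "i - q" 0 q] by (simp add: low_host_def)
    next
      case 3 then show ?thesis using Zl[of "i - 1" 0 1] by (simp add: low_host_def)
    next
      case 4
      then have "(q + (q - 2)) mod (2 * q) = i" "(0, q) \<in> low_host q (q - 2)" using q by (auto simp: low_host_def)
      then show ?thesis using Zl[of "q - 2" 0 q] q0 by simp
    next
      case 5 then show ?thesis using Zl[of i 0 0] by (simp add: low_host_def)
    next
      case 6
      have "(q + 1 + (q - 1)) mod (2 * q) = 0" by (rule wrap) (use q in auto)
      moreover have "(0, q + 1) \<in> low_host q (q - 1)" using q by (auto simp: low_host_def)
      ultimately show ?thesis using Zl[of "q - 1" 0 "q + 1"] 6 q0 by simp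
    qed
  qed
  have W0: "W (0, i)" if i: "i < 2 * q" for i
  proof -
    \<comment> \<open>Rotation 0 reaches q and 1, rotation 1 reaches q + 2 and 0, the rotations 2 to
      q - 2 reach 2 to q - 2 and q + 3 to 2q - 1, and the last one reaches q - 1. Only q + 1 is left
      to the hub piece.\<close>
    consider "i = q" | "i = 1" | "i = q + 2" | "i = 0" | "2 \<le> i" "i + 2 \<le> q" | "q + 3 \<le> i" | "i + 1 = q" | "i = q + 1"
      using i by linarith
    then show ?thesis
    proof cases
      case 1 then show ?thesis using Wl[of 0 0 q] q by (simp add: high_host_def)
    next
      case 2 then show ?thesis using Wl[of 0 0 1] q by (simp add: high_host_def)
    next
      case 3 then show ?thesis using Wl[of 1 0 "q + 1"] q by (simp add: high_host_def)
    next
      case 4 then show ?thesis using Wl[of 1 0 "2 * q - 1"] q by (simp add: high_host_def)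
    next
      case 5 then show ?thesis using Wl[of i 0 0] by (simp add: high_host_def)
    next
      case 6 then show ?thesis using Wl[of "i - q - 1" 0 "q + 1"] i by (simp add: high_host_def)
    next
      case 7 then show ?thesis using Wl[of i 0 0] q by (simp add: high_host_def)
    next
      case 8 then show ?thesis using WH by simp
    qed
  qed
  have ZW: "Z u \<and> W u" if "u \<in> V" for u
    using Vcases[OF that]
  proof (elim disjE exE conjE)
    fix c i assume "u = (c, i)" "c < 3" "i < 2 * q"
    moreover have "c = 0 \<or> c = 1 \<or> c = 2" using \<open>c < 3\<close> by auto
    ultimately show ?thesis using Z0 W0 ZW12 by blast
  qed (use ZH WH in auto)
  have P: "\<exists>r<q + 1. u \<in> P r k" if u: "u \<in> V" for u k
  proof -
    have "(\<exists>r<q. joined (K r) u (if even k then w else z)) \<or> (\<exists>i<q. u \<in> VV i \<and> joined (KK i) u (if even k then w else z))"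
      using ZW[OF u] unfolding Z_def W_def by (cases "even k") simp_all
    then show ?thesis
    proof (elim disjE exE conjE)
      fix r assume "r < q" "joined (K r) u (if even k then w else z)"
      then show ?thesis using Pl[OF _ u] by (intro exI[of _ r]) simp
    next
      fix i assume "i < q" "u \<in> VV i" "joined (KK i) u (if even k then w else z)"
      then show ?thesis using Pq by (intro exI[of _ q]) simp
    qed
  qed
  obtain g where "bij_betw g {0..<card V} V" using ex_bij_betw_nat_finite[OF finV(1)] by blast
  then have g: "inj_on g {0..<n}" "g ` {0..<n} \<subseteq> V"
    using n finV(2) by (auto simp: bij_betw_def intro: inj_on_subset)
  show ?thesis
    by (rule decomposable_product[OF g pl J[unfolded J_def] P])
qed

theorem theorem4p1:
  fixes n m :: nat
  assumes "n \<ge> 2" and "m \<ge> 3" and "n \<noteq> 8"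
    and "\<not> (\<exists>p. n = 6 * p + 3)" and "\<not> (\<exists>p. n = 6 * p + 4)"
  shows "thickness (cartesian_product (complete_graph n) (path_graph m)) = (n + 9) div 6"
proof (cases "n = 2")
  case True
  have "thickness (cartesian_product (complete_graph n) (path_graph m)) = 1"
  proof (rule thickness_eqI)
    show "decomposable (cartesian_product (complete_graph n) (path_graph m)) 1"
      using decomposable_layers_ok[OF layers_two_ok(1), of n m] True unfolding layers_two_ok(2) by simp
    show "1 \<le> l" if "decomposable (cartesian_product (complete_graph n) (path_graph m)) l" for l
      by (rule decomposable_product_pos[OF that]) (use assms(1,2) in simp_all)
  qed
  then show ?thesis using True by simp
next
  case False
  \<comment> \<open>With n = 2 settled and the residues 3 and 4 excluded, \<open>n\<close> lies
    between 6p + 5 and 6p + 8, where the claimed value is p + 2.\<close>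
  define p where "p = (n - 5) div 6"
  have n: "6 * p + 5 \<le> n" "n \<le> 6 * p + 8"
  proof -
    have n5: "n \<ge> 5" using assms(1,4,5) False by presburger
    then show "6 * p + 5 \<le> n" unfolding p_def by presburger
    have "n \<noteq> 6 * Suc p + 3" "n \<noteq> 6 * Suc p + 4" using assms(4,5) by blast+
    then show "n \<le> 6 * p + 8" using n5 unfolding p_def by presburger
  qed
  have "thickness (cartesian_product (complete_graph n) (path_graph m)) = p + 2"
  proof (rule thickness_eqI)
    show "p + 2 \<le> l" if "decomposable (cartesian_product (complete_graph n) (path_graph m)) l" for l
      by (rule decomposable_product_lower[OF that _ n(1)]) (use assms(2) in simp)
    consider "p = 0" | "p = 1" | "p \<ge> 2" by linarith
    then show "decomposable (cartesian_product (complete_graph n) (path_graph m)) (p + 2)"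
    proof cases
      case 1
      then have "n \<le> 7" using n(2) assms(3) by simp
      moreover have "p + 2 = 2" using 1 by simp
      ultimately show ?thesis using decomposable_layers_ok[OF layers_seven_ok(1), of n m] layers_seven_ok(2) by metis
    next
      \<comment> \<open>This is q = 2, where the zigzag has a single entry: its two ends coincide
        and the core degenerates, so a table is used.\<close>
      case 2
      then have "n \<le> 14" using n(2) by simp
      moreover have "p + 2 = 3" using 2 by simp
      ultimately show ?thesis using decomposable_layers_ok[OF layers_fourteen_ok(1), of n m] layers_fourteen_ok(2) by metis
    next
      case 3
      then have "decomposable (cartesian_product (complete_graph n) (path_graph m)) (p + 1 + 1)"
        using n(2) by (intro decomposable_large) auto
      then show ?thesis by simp
    qed
  qed
  moreover have "(n + 9) div 6 = p + 2" using n by presburger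
  ultimately show ?thesis by simp
qed

end
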